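(* The group $\mathrm{Gms}(M)$, with the topology described in the context, is a Polish group; that is, it is a separable topological group, it is complete with respect to the two-sided uniform structure, and it is homeomorphic to a complete metric space.
   Context: $\mathbb{R}^\times$ denotes the multiplicative group of positive reals, with coordinate $t$. $(M,\mu)$ is a Lebesgue space with a continuous (non-atomic) probability measure $\mu$ (so it is isomorphic mod $0$ to $[0,1]$ with Lebesgue measure). $\mathrm{Gms}(M)$ is the group of all invertible measurable transformations $g$ of $M$ (identified if equal almost everywhere) that leave $\mu$ quasi-invariant (images and preimages of null sets are null). $g'$ denotes the Radon--Nikodym derivative, so $\mu(gA)=\int_A g'\,d\mu$. For measurable $A,B\subset M$ and $g\in\mathrm{Gms}(M)$, $\kappa[g;A,B]$ is the distribution of $g'$ on $A\cap g^{-1}(B)$, i.e. the measure on $\mathbb{R}^\times$ given by $\kappa[g;A,B](E)=\mu\{x\in A\cap g^{-1}(B): g'(x)\in E\}$. For a measure $\kappa$ on $\mathbb{R}^\times$, $t\kappa$ denotes the measure with density $t$ with respect to $\kappa$. Topology on $\mathrm{Gms}(M)$: the coarsest topology such that for all measurable $A,B\subset M$ the maps $g\mapsto \kappa[g;A,B]$ and $g\mapsto t\kappa[g;A,B]$ are continuous for weak convergence of finite measures on $\mathbb{R}^\times$; thus $g_j\to g$ iff $\kappa[g_j;A,B]\to\kappa[g;A,B]$ and $t\kappa[g_j;A,B]\to t\kappa[g;A,B]$ weakly for all measurable $A,B$. Completeness with respect to the two-sided uniform structure (Raikov completeness) means, for a metrizable group: if for a sequence $g_i$ the double sequences $g_ig_j^{-1}$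 and $g_i^{-1}g_j$ converge to $1$ as $i,j\to\infty$, then $g_i$ has a limit in the group. *)

theory Defs
  imports "HOL-Probability.Probability" "HOL-Algebra.Group"
begin

definition isomorphic_mod0 :: "'a measure \<Rightarrow> 'b measure \<Rightarrow> bool" where
  "isomorphic_mod0 M N \<longleftrightarrow>
     (\<exists>A\<in>null_sets M. \<exists>B\<in>null_sets N. \<exists>f.
        let M' = restrict_space M (space M - A); N' = restrict_space N (space N - B) in
        bij_betw f (space M') (space N') \<and> f \<in> measurable M' N' \<and>
        inv_into (space M') f \<in> measurable N' M' \<and> distr M' N' f = N')"

text \<open>Lebesgue spaces are understood in Rokhlin's sense, hence the completeness of the measure.
  A general Lebesgue space may also have atoms; a continuous measure has none, and being a
  probability measure it is then carried mod 0 by the unit interval.\<close>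

definition continuous_lebesgue_space :: "'a measure \<Rightarrow> bool" where
  "continuous_lebesgue_space M \<longleftrightarrow>
     prob_space M \<and> complete_measure M \<and>
     isomorphic_mod0 M (lebesgue_on {0..1::real})"

definition gms_maps :: "'a measure \<Rightarrow> ('a \<Rightarrow> 'a) set" where
  "gms_maps M = {g. bij_betw g (space M) (space M) \<and>
     g \<in> measurable M M \<and> inv_into (space M) g \<in> measurable M M \<and>
     (\<forall>N\<in>null_sets M. g ` N \<in> null_sets M \<and> g -` N \<inter> space M \<in> null_sets M)}"

definition ae_eq_rel :: "'a measure \<Rightarrow> (('a \<Rightarrow> 'a) \<times> ('a \<Rightarrow> 'a)) set" where
  "ae_eq_rel M = {(f, g). f \<in> gms_maps M \<and> g \<in> gms_maps M \<and> (AE x in M. f x = g x)}"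

definition gms_mult :: "'a measure \<Rightarrow> ('a \<Rightarrow> 'a) set \<Rightarrow> ('a \<Rightarrow> 'a) set \<Rightarrow> ('a \<Rightarrow> 'a) set" where
  "gms_mult M X Y = {h \<in> gms_maps M. \<exists>f\<in>X. \<exists>g\<in>Y. AE x in M. h x = f (g x)}"

definition Gms :: "'a measure \<Rightarrow> ('a \<Rightarrow> 'a) set monoid" where
  "Gms M = \<lparr>carrier = gms_maps M // ae_eq_rel M,
            mult = gms_mult M,
            one = ae_eq_rel M `` {\<lambda>x. x}\<rparr>"

definition finite_measures_on :: "'a::topological_space set \<Rightarrow> 'a measure set" where
  "finite_measures_on X =
     {N. finite_measure N \<and> space N = X \<and> sets N = sets (restrict_space borel X)}"

definition weak_topology_on :: "'a::topological_space set \<Rightarrow> 'a measure topology" where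
  "weak_topology_on X = topology_generated_by
     {{N \<in> finite_measures_on X. (\<integral>t. \<phi> t \<partial>N) \<in> U} | (\<phi>::'a \<Rightarrow> real) U.
        continuous_on X \<phi> \<and> bounded (\<phi> ` X) \<and> open U}"

text \<open>The measure \<open>distr M M (inv_into (space M) g)\<close> sends \<open>A\<close> to the measure of \<open>g ` A\<close>.\<close>

definition gms_deriv :: "'a measure \<Rightarrow> ('a \<Rightarrow> 'a) \<Rightarrow> 'a \<Rightarrow> real" where
  "gms_deriv M g = (\<lambda>x. enn2real (RN_deriv M (distr M M (inv_into (space M) g)) x))"

text \<open>Points of the null set where the chosen version of the derivative is not positive are
  not counted, as \<open>E\<close> consists of positive reals.\<close>

definition kappa_map :: "'a measure \<Rightarrow> ('a \<Rightarrow> 'a) \<Rightarrow> 'a set \<Rightarrow> 'a set \<Rightarrow> real measure" where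
  "kappa_map M g A B =
     measure_of {0<..} (sets (restrict_space borel {0<..}))
       (\<lambda>E. emeasure M {x \<in> A \<inter> (g -` B \<inter> space M). gms_deriv M g x \<in> E})"

text \<open>The choice of the representative of the class \<open>X\<close> is immaterial,
  see \<open>kappa_map_cong\<close> below.\<close>

definition kappa :: "'a measure \<Rightarrow> ('a \<Rightarrow> 'a) set \<Rightarrow> 'a set \<Rightarrow> 'a set \<Rightarrow> real measure" where
  "kappa M X A B = kappa_map M (SOME g. g \<in> X) A B"

definition Gms_topology :: "'a measure \<Rightarrow> ('a \<Rightarrow> 'a) set topology" where
  "Gms_topology M = topology_generated_by
     ({{X \<in> carrier (Gms M). kappa M X A B \<in> W} | A B W.
         A \<in> sets M \<and> B \<in> sets M \<and> openin (weak_topology_on {0<..}) W} \<union>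
      {{X \<in> carrier (Gms M). density (kappa M X A B) ennreal \<in> W} | A B W.
         A \<in> sets M \<and> B \<in> sets M \<and> openin (weak_topology_on {0<..}) W})"

definition topological_group :: "('g, 'm) monoid_scheme \<Rightarrow> 'g topology \<Rightarrow> bool" where
  "topological_group G T \<longleftrightarrow>
     group G \<and> topspace T = carrier G \<and>
     continuous_map (prod_topology T T) T (\<lambda>(x, y). x \<otimes>\<^bsub>G\<^esub> y) \<and>
     continuous_map T T (\<lambda>x. inv\<^bsub>G\<^esub> x)"

text \<open>Completeness with respect to the two-sided uniform structure, in the sequential form
  that is adequate for metrizable groups.\<close>

definition raikov_complete :: "('g, 'm) monoid_scheme \<Rightarrow> 'g topology \<Rightarrow> bool" where
  "raikov_complete G T \<longleftrightarrow>
     (\<forall>s::nat \<Rightarrow> 'g. range s \<subseteq> carrier G \<longrightarrow>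
        limitin T (\<lambda>(i, j). s i \<otimes>\<^bsub>G\<^esub> inv\<^bsub>G\<^esub> (s j)) \<one>\<^bsub>G\<^esub> (sequentially \<times>\<^sub>F sequentially) \<longrightarrow>
        limitin T (\<lambda>(i, j). inv\<^bsub>G\<^esub> (s i) \<otimes>\<^bsub>G\<^esub> s j) \<one>\<^bsub>G\<^esub> (sequentially \<times>\<^sub>F sequentially) \<longrightarrow>
        (\<exists>g. limitin T s g sequentially))"

lemma gms_image_eq_vimage:
  assumes "g \<in> gms_maps M" "A \<subseteq> space M"
  shows "inv_into (space M) g -` A \<inter> space M = g ` A"
proof -
  have b: "bij_betw g (space M) (space M)" using assms by (simp add: gms_maps_def)
  show ?thesis
  proof (intro Set.set_eqI iffI)
    fix y assume "y \<in> inv_into (space M) g -` A \<inter> space M"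
    then show "y \<in> g ` A"
      using bij_betw_inv_into_right[OF b, of y] by (force simp: image_iff)
  next
    fix y assume "y \<in> g ` A"
    then obtain x where "x \<in> A" "y = g x" by auto
    then show "y \<in> inv_into (space M) g -` A \<inter> space M"
      using assms(2) bij_betw_inv_into_left[OF b, of x] bij_betwE[OF b] by auto
  qed
qed

lemma emeasure_distr_inv_gms:
  assumes "g \<in> gms_maps M" "A \<in> sets M"
  shows "emeasure (distr M M (inv_into (space M) g)) A = emeasure M (g ` A)"
  using assms sets.sets_into_space[OF assms(2)]
  by (subst emeasure_distr) (auto simp: gms_image_eq_vimage, auto simp: gms_maps_def)

lemma gms_image_sets:
  assumes "g \<in> gms_maps M" "A \<in> sets M"
  shows "g ` A \<in> sets M"
proof -
  have "inv_into (space M) g -` A \<inter> space M \<in> sets M"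
    using assms by (auto simp: gms_maps_def intro: measurable_sets)
  then show ?thesis
    using gms_image_eq_vimage[OF assms(1) sets.sets_into_space[OF assms(2)]] by simp
qed

lemma distr_inv_gms_cong:
  assumes f: "f \<in> gms_maps M" and g: "g \<in> gms_maps M" and ae: "AE x in M. f x = g x"
  shows "distr M M (inv_into (space M) f) = distr M M (inv_into (space M) g)"
proof (rule measure_eqI)
  fix A assume "A \<in> sets (distr M M (inv_into (space M) f))"
  then have A: "A \<in> sets M" by simp
  obtain N where N: "N \<in> null_sets M" "{x \<in> space M. f x \<noteq> g x} \<subseteq> N"
    using ae by (auto elim!: AE_E simp: null_sets_def)
  have fN: "f ` N \<in> null_sets M" and gN: "g ` N \<in> null_sets M"
    using f g N by (auto simp: gms_maps_def)
  have "f ` A - (f ` N \<union> g ` N) = g ` A - (f ` N \<union> g ` N)"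
  proof -
    have "f x = g x" if "x \<in> A" "x \<notin> N" for x
      using that N(2) sets.sets_into_space[OF A] by auto
    then show ?thesis by (force simp: image_iff)
  qed
  moreover have "f ` N \<union> g ` N \<in> null_sets M" using fN gN by auto
  ultimately have "emeasure M (f ` A) = emeasure M (g ` A)"
    using emeasure_Diff_null_set gms_image_sets[OF f A] gms_image_sets[OF g A] by metis
  then show "emeasure (distr M M (inv_into (space M) f)) A =
      emeasure (distr M M (inv_into (space M) g)) A"
    using emeasure_distr_inv_gms[OF f A] emeasure_distr_inv_gms[OF g A] by simp
qed simp

lemma gms_deriv_measurable [measurable]: "gms_deriv M g \<in> borel_measurable M"
  unfolding gms_deriv_def by measurable

lemma kappa_map_set_measurable:
  assumes "g \<in> gms_maps M" "A \<in> sets M" "B \<in> sets M" "E \<in> sets borel"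
  shows "{x \<in> A \<inter> (g -` B \<inter> space M). gms_deriv M g x \<in> E} \<in> sets M"
proof -
  have "g -` B \<inter> space M \<in> sets M"
    using assms by (auto simp: gms_maps_def intro: measurable_sets)
  moreover have "gms_deriv M g -` E \<inter> space M \<in> sets M"
    using assms(4) measurable_sets[OF gms_deriv_measurable] by blast
  moreover have "{x \<in> A \<inter> (g -` B \<inter> space M). gms_deriv M g x \<in> E} =
      A \<inter> (g -` B \<inter> space M) \<inter> (gms_deriv M g -` E \<inter> space M)" by auto
  ultimately show ?thesis using assms(2) by auto
qed

lemma sigma_algebra_positive_borel:
  "sigma_algebra {0<..} (sets (restrict_space borel {0::real<..}))"
  using sets.sigma_algebra_axioms[of "restrict_space borel {0::real<..}"]
  by (simp add: space_restrict_space)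

lemma kappa_map_cong:
  assumes f: "f \<in> gms_maps M" and g: "g \<in> gms_maps M" and ae: "AE x in M. f x = g x"
    and A: "A \<in> sets M" and B: "B \<in> sets M"
  shows "kappa_map M f A B = kappa_map M g A B"
proof -
  have d: "gms_deriv M f = gms_deriv M g"
    unfolding gms_deriv_def distr_inv_gms_cong[OF f g ae] ..
  have eq: "emeasure M {x \<in> A \<inter> (f -` B \<inter> space M). gms_deriv M f x \<in> E} =
        emeasure M {x \<in> A \<inter> (g -` B \<inter> space M). gms_deriv M g x \<in> E}"
    if "E \<in> sets borel" for E
  proof (rule emeasure_eq_AE)
    show "AE x in M. (x \<in> {x \<in> A \<inter> (f -` B \<inter> space M). gms_deriv M f x \<in> E}) =
        (x \<in> {x \<in> A \<inter> (g -` B \<inter> space M). gms_deriv M g x \<in> E})"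
      using ae by eventually_elim (auto simp: d)
  qed (use kappa_map_set_measurable f g A B that in blast)+
  show ?thesis
    unfolding kappa_map_def
  proof (rule measure_of_eq)
    show "sets (restrict_space borel {0::real<..}) \<subseteq> Pow {0<..}"
      by (auto simp: sets_restrict_space)
    fix E assume "E \<in> sigma_sets {0<..} (sets (restrict_space borel {0::real<..}))"
    then have "E \<in> sets borel"
      unfolding sigma_algebra.sigma_sets_eq[OF sigma_algebra_positive_borel]
      by (auto simp: sets_restrict_space)
    then show "emeasure M {x \<in> A \<inter> (f -` B \<inter> space M). gms_deriv M f x \<in> E} =
        emeasure M {x \<in> A \<inter> (g -` B \<inter> space M). gms_deriv M g x \<in> E}" by (rule eq)
  qed
qed

lemma sets_kappa_map [simp]:
  "sets (kappa_map M g A B) = sets (restrict_space borel {0<..})"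
  unfolding kappa_map_def
  by (simp add: sigma_algebra.sets_measure_of_eq[OF sigma_algebra_positive_borel])

lemma emeasure_kappa_map:
  assumes "g \<in> gms_maps M" "A \<in> sets M" "B \<in> sets M"
    and "E \<in> sets (restrict_space borel {0<..})"
  shows "emeasure (kappa_map M g A B) E =
    emeasure M {x \<in> A \<inter> (g -` B \<inter> space M). gms_deriv M g x \<in> E}"
  unfolding kappa_map_def
proof (rule emeasure_measure_of_sigma)
  let ?S = "sets (restrict_space borel {0::real<..})"
  let ?P = "\<lambda>E. {x \<in> A \<inter> (g -` B \<inter> space M). gms_deriv M g x \<in> E}"
  have borel: "E \<in> sets borel" if "E \<in> ?S" for E
    using that by (auto simp: sets_restrict_space)
  show "sigma_algebra {0<..} ?S" by (rule sigma_algebra_positive_borel)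
  show "positive ?S (\<lambda>E. emeasure M (?P E))"
    by (simp add: positive_def)
  show "countably_additive ?S (\<lambda>E. emeasure M (?P E))"
  proof (rule countably_additiveI)
    fix F :: "nat \<Rightarrow> real set"
    assume F: "range F \<subseteq> ?S" "disjoint_family F"
    have "(\<Sum>i. emeasure M (?P (F i))) = emeasure M (\<Union>i. ?P (F i))"
    proof (rule suminf_emeasure)
      show "range (\<lambda>i. ?P (F i)) \<subseteq> sets M"
        using kappa_map_set_measurable[OF assms(1-3)] borel F(1) by blast
      show "disjoint_family (\<lambda>i. ?P (F i))"
        using F(2) by (auto simp: disjoint_family_on_def)
    qed
    also have "(\<Union>i. ?P (F i)) = ?P (\<Union>i. F i)" by auto
    finally show "(\<Sum>i. emeasure M (?P (F i))) = emeasure M (?P (\<Union>i. F i))" .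
  qed
qed (rule assms(4))

end

theory Submission
  imports Defs
begin

text \<open>A nonsingular transformation \<open>g\<close> of \<open>M\<close> acts on L1 by the isometry that sends \<open>k\<close> to
  \<open>(k \<circ> g) * g'\<close>. The topology of the group is the strong operator topology of these
  isometries, and a group of isometries of a separable complete metric space is a separable topological
  group in its strong topology. Completeness holds because a strong limit of such
  isometries is again of this form if their inverses converge as well.

  The topology is the strong one for the following reasons. Let \<open>a\<close> and \<open>b\<close> be the images of the
  indicator of \<open>B\<close> under the operators of \<open>h\<close> and \<open>g\<close>. Both have integral \<open>\<mu>(B)\<close>, so
  \<open>\<integral>\<bar>a - b\<bar> = 2 * (\<mu>(B) - \<integral>min a b)\<close>. If \<open>b\<close> is replaced by a step function with values \<open>y\<close> on
  sets \<open>A\<close>, then the last integral is the sum of the integrals of the bounded continuous functions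
  \<open>\<lambda>t. min t y\<close> against \<open>\<kappa>[h;A,B]\<close> (\<open>limitin_Gms_imp_koopman\<close>). Conversely, if the operators of \<open>g\<^sub>n\<close>
  converge strongly to that of \<open>g\<close>, then along subsequences \<open>g\<^sub>n'\<close> and \<open>(1\<^sub>B \<circ> g\<^sub>n) * g\<^sub>n'\<close> converge almost
  everywhere. As \<open>g' > 0\<close>, so does \<open>1\<^sub>B \<circ> g\<^sub>n\<close>, and dominated convergence shows that the integrals against
  \<open>\<kappa>\<close> and \<open>t\<kappa>\<close> converge (\<open>koopman_convergence_imp_limitin_Gms\<close>).

  For completeness let the operators of \<open>g\<^sub>n\<close> and of their inverses be Cauchy sequences at every vector.
  The isomorphism of \<open>M\<close> with the unit interval serves as a real coordinate on \<open>M\<close>. The derivatives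
  of \<open>g\<^sub>n\<close> have a limit \<open>w\<close> in L1, which is positive since the limit operator is onto, and along a
  subsequence the coordinates of \<open>g\<^sub>n\<close> converge almost everywhere to a function \<open>u\<close>. The image of the measure
  with density \<open>w\<close> under \<open>u\<close> is Lebesgue measure, hence \<open>u\<close> is the coordinate of a nonsingular map,
  which together with \<open>w\<close> gives the limit operator (\<open>koopman_limit_weighted_comp\<close>). The same holds for the inverses.
  The two maps are inverse to each other almost everywhere, and they become bijections
  of \<open>M\<close> after replacement by the identity off an invariant conull set
  (\<open>AE_inverse_imp_gms_map\<close>).

  A countable family of functions of the coordinate generates L1. A weighted sum of the truncated
  distances of the operators, and of their inverses, at these functions is a complete metric for the
  topology.
  Raikov completeness follows from the same limit theorem, because cancelling isometries
  turns its hypotheses into Cauchy conditions on the operators.\<close>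

section \<open>Criteria for limits\<close>

lemma tendsto_if_subseq_tendsto:
  fixes a :: "nat \<Rightarrow> real"
  assumes "\<And>r::nat \<Rightarrow> nat. strict_mono r \<Longrightarrow> \<exists>q. strict_mono q \<and> (\<lambda>n. a (r (q n))) \<longlonglongrightarrow> l"
  shows "a \<longlonglongrightarrow> l"
proof (rule ccontr)
  assume "\<not> a \<longlonglongrightarrow> l"
  then obtain e where e: "e > 0" "\<exists>\<^sub>F n in sequentially. e \<le> dist (a n) l"
    by (auto simp: tendsto_iff frequently_def not_le)
  from e(2) have "infinite {n. e \<le> dist (a n) l}"
    unfolding cofinite_eq_sequentially[symmetric] frequently_cofinite .
  then obtain r :: "nat \<Rightarrow> nat" where r: "strict_mono r" "\<And>n. r n \<in> {n. e \<le> dist (a n) l}"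
    using infinite_enumerate by blast
  obtain q where "strict_mono q" "(\<lambda>n. a (r (q n))) \<longlonglongrightarrow> l" using assms[OF r(1)] by blast
  then have "\<forall>\<^sub>F n in sequentially. dist (a (r (q n))) l < e" using tendstoD e(1) by blast
  then show False using r(2) by (auto simp: eventually_sequentially not_le[symmetric])
qed

lemma limitin_topology_generated_byI:
  assumes "l \<in> \<Union>\<S>" and "\<And>V. V \<in> \<S> \<Longrightarrow> l \<in> V \<Longrightarrow> \<forall>\<^sub>F i in F. f i \<in> V"
  shows "limitin (topology_generated_by \<S>) f l F"
proof -
  have "l \<in> U \<longrightarrow> (\<forall>\<^sub>F i in F. f i \<in> U)" if "generate_topology_on \<S> U" for U
    using that
  proof induction
    case (Int a b)
    then show ?case by (auto intro: eventually_conj)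
  next
    case (UN K)
    show ?case
    proof
      assume "l \<in> \<Union> K"
      then obtain k where k: "k \<in> K" "l \<in> k" by blast
      then have "\<forall>\<^sub>F i in F. f i \<in> k" using UN.IH by blast
      then show "\<forall>\<^sub>F i in F. f i \<in> \<Union> K" by eventually_elim (use k in blast)
    qed
  qed (use assms in auto)
  then show ?thesis
    using assms(1) by (auto simp: limitin_def openin_topology_generated_by_iff)
qed

section \<open>The metric of L1\<close>

definition L1_dist :: "'a measure \<Rightarrow> ('a \<Rightarrow> real) \<Rightarrow> ('a \<Rightarrow> real) \<Rightarrow> real" where
  "L1_dist M f h = (\<integral>x. \<bar>f x - h x\<bar> \<partial>M)"

lemma L1_dist_nonneg [simp]: "0 \<le> L1_dist M f h"
  by (simp add: L1_dist_def)

lemma L1_dist_refl [simp]: "L1_dist M f f = 0"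
  by (simp add: L1_dist_def)

lemma L1_dist_commute: "L1_dist M f h = L1_dist M h f"
  by (simp add: L1_dist_def abs_minus_commute)

lemma L1_dist_cong_AE:
  assumes "f \<in> borel_measurable M" "f' \<in> borel_measurable M"
    "h \<in> borel_measurable M" "h' \<in> borel_measurable M"
    and "AE x in M. f x = f' x" "AE x in M. h x = h' x"
  shows "L1_dist M f h = L1_dist M f' h'"
  unfolding L1_dist_def
proof (rule integral_cong_AE)
  show "AE x in M. \<bar>f x - h x\<bar> = \<bar>f' x - h' x\<bar>"
    using assms(5,6) by eventually_elim simp
qed (use assms in measurable)

lemma L1_dist_triangle:
  assumes "integrable M f" "integrable M g" "integrable M h"
  shows "L1_dist M f h \<le> L1_dist M f g + L1_dist M g h"
proof -
  have "L1_dist M f h \<le> (\<integral>x. \<bar>f x - g x\<bar> + \<bar>g x - h x\<bar> \<partial>M)"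
    unfolding L1_dist_def by (rule integral_mono) (use assms in auto)
  then show ?thesis using assms by (simp add: L1_dist_def)
qed

lemma L1_dist_eq_0_iff:
  assumes "integrable M f" "integrable M h"
  shows "L1_dist M f h = 0 \<longleftrightarrow> (AE x in M. f x = h x)"
  unfolding L1_dist_def
  using integral_nonneg_eq_0_iff_AE[of M "\<lambda>x. \<bar>f x - h x\<bar>"] assms by simp

lemma L1_dist_lincomb:
  assumes "integrable M f" "integrable M g" "integrable M f'" "integrable M g'"
  shows "L1_dist M (\<lambda>x. a * f x + b * g x) (\<lambda>x. a * f' x + b * g' x)
    \<le> \<bar>a\<bar> * L1_dist M f f' + \<bar>b\<bar> * L1_dist M g g'"
proof -
  have "L1_dist M (\<lambda>x. a * f x + b * g x) (\<lambda>x. a * f' x + b * g' x)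
      \<le> (\<integral>x. \<bar>a\<bar> * \<bar>f x - f' x\<bar> + \<bar>b\<bar> * \<bar>g x - g' x\<bar> \<partial>M)"
    unfolding L1_dist_def
  proof (rule integral_mono)
    fix x
    have "a * f x + b * g x - (a * f' x + b * g' x) = a * (f x - f' x) + b * (g x - g' x)"
      by (simp add: algebra_simps)
    then show "\<bar>a * f x + b * g x - (a * f' x + b * g' x)\<bar>
        \<le> \<bar>a\<bar> * \<bar>f x - f' x\<bar> + \<bar>b\<bar> * \<bar>g x - g' x\<bar>"
      by (metis abs_mult abs_triangle_ineq)
  qed (use assms in auto)
  then show ?thesis using assms by (simp add: L1_dist_def)
qed

lemma abs_integral_diff_le_L1_dist:
  assumes "integrable M f" "integrable M h"
  shows "\<bar>(\<integral>x. f x \<partial>M) - (\<integral>x. h x \<partial>M)\<bar> \<le> L1_dist M f h"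
proof -
  have "(\<integral>x. f x \<partial>M) - (\<integral>x. h x \<partial>M) = (\<integral>x. f x - h x \<partial>M)"
    using assms by simp
  then show ?thesis
    unfolding L1_dist_def using integral_abs_bound[of M "\<lambda>x. f x - h x"] by simp
qed

lemma L1_dist_tendsto_trans:
  assumes "\<forall>\<^sub>F i in F. integrable M (f i)" "\<forall>\<^sub>F i in F. integrable M (g i)"
    "\<forall>\<^sub>F i in F. integrable M (h i)"
    and "((\<lambda>i. L1_dist M (f i) (g i)) \<longlongrightarrow> 0) F" "((\<lambda>i. L1_dist M (g i) (h i)) \<longlongrightarrow> 0) F"
  shows "((\<lambda>i. L1_dist M (f i) (h i)) \<longlongrightarrow> 0) F"
proof (rule tendsto_sandwich[OF _ _ tendsto_const])
  show "\<forall>\<^sub>F i in F. L1_dist M (f i) (h i) \<le> L1_dist M (f i) (g i) + L1_dist M (g i) (h i)"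
    using assms(1-3) by eventually_elim (rule L1_dist_triangle)
  show "((\<lambda>i. L1_dist M (f i) (g i) + L1_dist M (g i) (h i)) \<longlongrightarrow> 0) F"
    using tendsto_add[OF assms(4,5)] by simp
qed simp

lemma L1_dist_tendsto_AE_subseq:
  assumes "\<And>n. integrable M (s n)" "integrable M f"
    and "(\<lambda>n. L1_dist M (s n) f) \<longlonglongrightarrow> 0"
  obtains r :: "nat \<Rightarrow> nat" where "strict_mono r" "AE x in M. (\<lambda>n. s (r n) x) \<longlonglongrightarrow> f x"
proof -
  have "\<exists>r::nat\<Rightarrow>nat. strict_mono r \<and> (AE x in M. (\<lambda>n. s (r n) x - f x) \<longlonglongrightarrow> 0)"
    by (rule tendsto_L1_AE_subseq) (use assms in \<open>auto simp: L1_dist_def\<close>)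
  then obtain r :: "nat \<Rightarrow> nat" where r: "strict_mono r"
    "AE x in M. (\<lambda>n. s (r n) x - f x) \<longlonglongrightarrow> 0" by blast
  moreover have "AE x in M. (\<lambda>n. s (r n) x) \<longlonglongrightarrow> f x"
    using r(2) by eventually_elim (simp add: LIM_zero_iff)
  ultimately show ?thesis using that by blast
qed

lemma L1_limit_AE_unique:
  assumes "\<And>n. integrable M (s n)" "integrable M f"
    and "(\<lambda>n. L1_dist M (s n) f) \<longlonglongrightarrow> 0"
    and r: "strict_mono r" and "AE x in M. (\<lambda>n. s (r n) x) \<longlonglongrightarrow> h x"
  shows "AE x in M. f x = h x"
proof -
  have "(\<lambda>n. L1_dist M (s (r n)) f) \<longlonglongrightarrow> 0"
    using LIMSEQ_subseq_LIMSEQ[OF assms(3) r] by (simp add: o_def)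
  then obtain q :: "nat \<Rightarrow> nat" where q: "strict_mono q"
      and lim: "AE x in M. (\<lambda>n. s (r (q n)) x) \<longlonglongrightarrow> f x"
    using L1_dist_tendsto_AE_subseq[of M "\<lambda>n. s (r n)" f] assms(1,2) by blast
  from lim assms(5) show ?thesis
  proof eventually_elim
    fix x assume 1: "(\<lambda>n. s (r (q n)) x) \<longlonglongrightarrow> f x" and 2: "(\<lambda>n. s (r n) x) \<longlonglongrightarrow> h x"
    have "(\<lambda>n. s (r (q n)) x) \<longlonglongrightarrow> h x"
      using LIMSEQ_subseq_LIMSEQ[OF 2 q] by (simp add: o_def)
    with 1 show "f x = h x" by (rule LIMSEQ_unique)
  qed
qed

text \<open>An almost everywhere convergent subsequence provides the limit, and Fatou's lemma
  bounds the distance to it.\<close>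

lemma L1_complete:
  fixes s :: "nat \<Rightarrow> 'a \<Rightarrow> real"
  assumes int: "\<And>n. integrable M (s n)"
    and cauchy: "((\<lambda>(i, j). L1_dist M (s i) (s j)) \<longlongrightarrow> 0) (sequentially \<times>\<^sub>F sequentially)"
  obtains f where "integrable M f" "(\<lambda>n. L1_dist M (s n) f) \<longlonglongrightarrow> 0"
proof -
  have C: "\<exists>N. \<forall>i\<ge>N. \<forall>j\<ge>N. L1_dist M (s i) (s j) < e" if "e > 0" for e
  proof -
    have "\<forall>\<^sub>F p in sequentially \<times>\<^sub>F sequentially. case p of (i, j) \<Rightarrow> L1_dist M (s i) (s j) < e"
      using order_tendstoD(2)[OF cauchy that] by (simp add: case_prod_unfold)
    then obtain P Q where PQ: "eventually P sequentially" "eventually Q sequentially"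
      "\<And>i j. P i \<Longrightarrow> Q j \<Longrightarrow> L1_dist M (s i) (s j) < e"
      by (auto simp: eventually_prod_filter)
    then obtain N1 N2 where "\<And>i. i \<ge> N1 \<Longrightarrow> P i" "\<And>i. i \<ge> N2 \<Longrightarrow> Q i"
      by (auto simp: eventually_sequentially)
    then show ?thesis using PQ(3) by (intro exI[of _ "max N1 N2"]) auto
  qed
  obtain r where r: "strict_mono r" and Cr: "AE x in M. Cauchy (\<lambda>i. s (r i) x)"
    using cauchy_L1_AE_cauchy_subseq[of M s, OF int C[unfolded L1_dist_def, folded real_norm_def]]
    by blast
  define f where "f x = lim (\<lambda>i. s (r i) x)" for x
  have fm[measurable]: "f \<in> borel_measurable M"
    unfolding f_def using int by (intro borel_measurable_lim_metric) auto
  have conv: "AE x in M. (\<lambda>i. s (r i) x) \<longlonglongrightarrow> f x"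
    using Cr by eventually_elim (simp add: f_def Cauchy_convergent_iff convergent_LIMSEQ_iff)
  have sm[measurable]: "s n \<in> borel_measurable M" for n using int by auto
  have bound: "(\<integral>\<^sup>+x. ennreal \<bar>s n x - f x\<bar> \<partial>M) \<le> ennreal e"
    if N: "\<forall>i\<ge>N. \<forall>j\<ge>N. L1_dist M (s i) (s j) < e" and n: "n \<ge> N" for n N e
  proof -
    have "(\<integral>\<^sup>+x. ennreal \<bar>s n x - f x\<bar> \<partial>M)
        = (\<integral>\<^sup>+x. liminf (\<lambda>i. ennreal \<bar>s n x - s (r i) x\<bar>) \<partial>M)"
    proof (rule nn_integral_cong_AE)
      show "AE x in M. ennreal \<bar>s n x - f x\<bar> = liminf (\<lambda>i. ennreal \<bar>s n x - s (r i) x\<bar>)"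
        using conv
      proof eventually_elim
        fix x assume "(\<lambda>i. s (r i) x) \<longlonglongrightarrow> f x"
        then have "(\<lambda>i. ennreal \<bar>s n x - s (r i) x\<bar>) \<longlonglongrightarrow> ennreal \<bar>s n x - f x\<bar>"
          by (intro tendsto_intros)
        then show "ennreal \<bar>s n x - f x\<bar> = liminf (\<lambda>i. ennreal \<bar>s n x - s (r i) x\<bar>)"
          using lim_imp_Liminf sequentially_bot by metis
      qed
    qed
    also have "\<dots> \<le> liminf (\<lambda>i. \<integral>\<^sup>+x. ennreal \<bar>s n x - s (r i) x\<bar> \<partial>M)"
      by (rule nn_integral_liminf) measurable
    also have "\<dots> \<le> liminf (\<lambda>i. ennreal e)"
    proof (rule Liminf_mono)
      have "\<forall>\<^sub>F i in sequentially. i \<ge> N" by (rule eventually_ge_at_top)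
      then show "\<forall>\<^sub>F i in sequentially. (\<integral>\<^sup>+x. ennreal \<bar>s n x - s (r i) x\<bar> \<partial>M) \<le> ennreal e"
      proof eventually_elim
        fix i assume "N \<le> i"
        then have "N \<le> r i" using seq_suble[OF r, of i] by simp
        then have "L1_dist M (s n) (s (r i)) < e" using N n by blast
        moreover have "(\<integral>\<^sup>+x. ennreal \<bar>s n x - s (r i) x\<bar> \<partial>M) = ennreal (L1_dist M (s n) (s (r i)))"
          unfolding L1_dist_def using int by (intro nn_integral_eq_integral) auto
        ultimately show "(\<integral>\<^sup>+x. ennreal \<bar>s n x - s (r i) x\<bar> \<partial>M) \<le> ennreal e"
          by (simp add: ennreal_leI)
      qed
    qed
    also have "\<dots> = ennreal e" by (simp add: Liminf_const)
    finally show ?thesis .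
  qed
  obtain N1 where N1: "\<forall>i\<ge>N1. \<forall>j\<ge>N1. L1_dist M (s i) (s j) < 1" using C[of 1] by auto
  have "integrable M (\<lambda>x. s N1 x - f x)"
    using bound[OF N1, of N1] by (intro integrableI_bounded) (auto simp: le_less_trans)
  then have fint: "integrable M f"
    using Bochner_Integration.integrable_diff[OF int[of N1], of "\<lambda>x. s N1 x - f x"] by simp
  have "(\<lambda>n. L1_dist M (s n) f) \<longlonglongrightarrow> 0"
  proof (rule LIMSEQ_I)
    fix e :: real assume "e > 0"
    then obtain N where N: "\<forall>i\<ge>N. \<forall>j\<ge>N. L1_dist M (s i) (s j) < e / 2" using C[of "e/2"] by auto
    have "L1_dist M (s n) f < e" if "n \<ge> N" for n
    proof -
      have "ennreal (L1_dist M (s n) f) \<le> ennreal (e / 2)"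
        using bound[OF N that] int fint
        by (subst (asm) nn_integral_eq_integral) (auto simp: L1_dist_def)
      then show ?thesis using \<open>e > 0\<close> by (simp add: ennreal_le_iff)
    qed
    then show "\<exists>no. \<forall>n\<ge>no. norm (L1_dist M (s n) f - 0) < e" by auto
  qed
  with fint show ?thesis using that by blast
qed

lemma L1_dist_tendsto_dominated:
  fixes s :: "nat \<Rightarrow> 'a \<Rightarrow> real"
  assumes [measurable]: "f \<in> borel_measurable M" "\<And>n. s n \<in> borel_measurable M"
    and w: "integrable M w"
    and lim: "AE x in M. (\<lambda>n. s n x) \<longlonglongrightarrow> f x"
    and bound: "\<And>n. AE x in M. \<bar>s n x\<bar> \<le> w x"
  shows "(\<lambda>n. L1_dist M (s n) f) \<longlonglongrightarrow> 0"
proof -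
  have "AE x in M. \<forall>n. \<bar>s n x\<bar> \<le> w x" using bound by (simp add: AE_all_countable)
  with lim have f: "AE x in M. \<bar>f x\<bar> \<le> w x"
  proof eventually_elim
    fix x assume "(\<lambda>n. s n x) \<longlonglongrightarrow> f x" and b: "\<forall>n. \<bar>s n x\<bar> \<le> w x"
    then have "(\<lambda>n. \<bar>s n x\<bar>) \<longlonglongrightarrow> \<bar>f x\<bar>" by (intro tendsto_intros)
    then show "\<bar>f x\<bar> \<le> w x" by (rule LIMSEQ_le_const2) (use b in auto)
  qed
  have "(\<lambda>n. \<integral>x. \<bar>s n x - f x\<bar> \<partial>M) \<longlonglongrightarrow> (\<integral>x. 0 \<partial>M)"
  proof (rule integral_dominated_convergence)
    show "integrable M (\<lambda>x. 2 * w x)" using w by simp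
    show "AE x in M. (\<lambda>n. \<bar>s n x - f x\<bar>) \<longlonglongrightarrow> 0"
      using lim by eventually_elim (simp add: LIM_zero_iff tendsto_rabs_zero)
    show "AE x in M. norm \<bar>s n x - f x\<bar> \<le> 2 * w x" for n
      using f bound[of n] by eventually_elim auto
  qed measurable
  then show ?thesis by (simp add: L1_dist_def)
qed

section \<open>Closed subspaces of L1\<close>

text \<open>A subspace of L1 is given by a predicate that is only tested on integrable functions, so that no
  classes of functions are needed. Closure under limits includes changes on null sets.\<close>

definition L1_closed_subspace :: "'a measure \<Rightarrow> (('a \<Rightarrow> real) \<Rightarrow> bool) \<Rightarrow> bool" where
  "L1_closed_subspace M Q \<longleftrightarrow>
     (\<forall>f g a b. integrable M f \<longrightarrow> integrable M g \<longrightarrow> Q f \<longrightarrow> Q g \<longrightarrow> Q (\<lambda>x. a * f x + b * g x)) \<and>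
     (\<forall>F f. (\<forall>n::nat. integrable M (F n) \<and> Q (F n)) \<longrightarrow> integrable M f \<longrightarrow>
        (\<lambda>n. L1_dist M (F n) f) \<longlonglongrightarrow> 0 \<longrightarrow> Q f)"

lemma L1_closed_subspace_lincomb:
  assumes "L1_closed_subspace M Q" "integrable M f" "integrable M g" "Q f" "Q g"
  shows "Q (\<lambda>x. a * f x + b * g x)"
  using assms unfolding L1_closed_subspace_def by blast

lemma L1_closed_subspace_limit:
  assumes "L1_closed_subspace M Q" "\<And>n::nat. integrable M (F n)" "\<And>n. Q (F n)" "integrable M f"
    "(\<lambda>n. L1_dist M (F n) f) \<longlonglongrightarrow> 0"
  shows "Q f"
  using assms unfolding L1_closed_subspace_def by blast

text \<open>Indicators span the simple functions, which are dense in L1.\<close>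

lemma L1_closed_subspace_integrable:
  assumes Q: "L1_closed_subspace M Q" and base: "\<And>A. A \<in> sets M \<Longrightarrow> emeasure M A < \<infinity> \<Longrightarrow> Q (indicator A)"
    and "integrable M k"
  shows "Q k"
  using assms(3)
proof (induction rule: integrable_induct)
  case (base A c)
  then have "integrable M (indicator A :: 'a \<Rightarrow> real)" by simp
  from L1_closed_subspace_lincomb[OF Q this this, of c 0] assms(2) base
  show ?case by (simp add: mult.commute)
next
  case (add f g)
  then show ?case using L1_closed_subspace_lincomb[OF Q, of f g 1 1] by simp
next
  case (lim f s)
  show ?case
  proof (rule L1_closed_subspace_limit[OF Q])
    show "integrable M (s n)" "Q (s n)" "integrable M f" for n using lim by auto
    show "(\<lambda>n. L1_dist M (s n) f) \<longlonglongrightarrow> 0"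
    proof (rule L1_dist_tendsto_dominated)
      show "integrable M (\<lambda>x. 2 * norm (f x))" using lim by simp
    qed (use lim in auto)
  qed
qed

text \<open>Countably many continuous functions, whose limits for steep slopes are the indicators of the
  half lines with rational end points.\<close>

definition ramp :: "rat \<Rightarrow> nat \<Rightarrow> real \<Rightarrow> real" where
  "ramp q m x = max 0 (min 1 (real m * (x - of_rat q)))"

lemma ramp_abs_le: "\<bar>ramp q m x\<bar> \<le> 1"
  by (auto simp: ramp_def)

lemma continuous_on_ramp: "continuous_on UNIV (ramp q m)"
  unfolding ramp_def by (intro continuous_intros)

lemma ramp_measurable [measurable]: "ramp q m \<in> borel_measurable borel"
  by (rule borel_measurable_continuous_onI[OF continuous_on_ramp])

lemma ramp_tendsto_indicator: "(\<lambda>m. ramp q m x) \<longlonglongrightarrow> indicator {of_rat q<..} x"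
proof (cases "of_rat q < x")
  case True
  obtain N :: nat where N: "1 < real N * (x - of_rat q)"
    using reals_Archimedean3[of "x - of_rat q"] True by (metis diff_gt_0_iff_gt)
  have "\<forall>\<^sub>F m in sequentially. ramp q m x = 1"
    using eventually_ge_at_top[of N]
  proof eventually_elim
    fix m assume "N \<le> m"
    then have "real N * (x - of_rat q) \<le> real m * (x - of_rat q)"
      using True by (intro mult_right_mono) auto
    then show "ramp q m x = 1" using N by (simp add: ramp_def)
  qed
  then show ?thesis using True by (simp add: tendsto_eventually)
next
  case False
  then have "real m * (x - of_rat q) \<le> 0" for m
    by (intro mult_nonneg_nonpos) auto
  then have "ramp q m x = 0" for m
    unfolding ramp_def by (intro max.absorb1 min.coboundedI2)
  then have "ramp q m x = indicator {of_rat q<..} x" for m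
    using False by simp
  then show ?thesis by (simp only: tendsto_const)
qed

text \<open>The sets whose indicator satisfies \<open>P\<close> form a Dynkin system. It contains the half lines, as their
  indicators are limits of ramps, and half lines are stable under intersection and generate the Borel
  sets.\<close>

lemma bounded_pointwise_class_borel:
  fixes P :: "(real \<Rightarrow> real) \<Rightarrow> bool"
  assumes ramp: "\<And>q m. P (ramp q m)"
    and lincomb: "\<And>f g a b. P f \<Longrightarrow> P g \<Longrightarrow> P (\<lambda>x. a * f x + b * g x)"
    and limit: "\<And>F f C. (\<And>n::nat. P (F n)) \<Longrightarrow> (\<And>n x. \<bar>F n x\<bar> \<le> C) \<Longrightarrow>
      (\<And>x. (\<lambda>n. F n x) \<longlonglongrightarrow> f x) \<Longrightarrow> P f"
    and "B \<in> sets borel"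
  shows "P (indicator B)"
proof -
  have rat: "P (indicator {of_rat q<..})" for q
  proof (rule limit[where F = "ramp q" and C = 1])
    show "\<bar>ramp q n x\<bar> \<le> 1" for n x by (rule ramp_abs_le)
  qed (rule ramp, rule ramp_tendsto_indicator)
  have half: "P (indicator {a<..})" for a
  proof -
    have "\<exists>q. a < of_rat q \<and> of_rat q < a + 1 / real (Suc n)" for n
      using of_rat_dense[of a "a + 1 / real (Suc n)"] by auto
    then obtain q where q: "\<And>n. a < of_rat (q n)" "\<And>n. of_rat (q n) < a + 1 / real (Suc n)"
      by metis
    have "(\<lambda>n. a + 1 / real (Suc n)) \<longlonglongrightarrow> a + 0"
      by (rule tendsto_add[OF tendsto_const LIMSEQ_Suc[OF lim_1_over_n]])
    then have up: "(\<lambda>n. a + 1 / real (Suc n)) \<longlonglongrightarrow> a" by simp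
    have qlim: "(\<lambda>n. of_rat (q n)) \<longlonglongrightarrow> a"
      by (rule tendsto_sandwich[OF _ _ tendsto_const up])
         (intro always_eventually allI less_imp_le q)+
    show ?thesis
    proof (rule limit[where F = "\<lambda>n. indicator {of_rat (q n)<..}" and C = 1])
      show "P (indicator {of_rat (q n)<..})" for n by (rule rat)
      show "(\<lambda>n. indicator {of_rat (q n)<..} x :: real) \<longlonglongrightarrow> indicator {a<..} x" for x
      proof (cases "a < x")
        case True
        have "\<forall>\<^sub>F n in sequentially. of_rat (q n) < x"
          using order_tendstoD(2)[OF qlim True] .
        then have "\<forall>\<^sub>F n in sequentially. indicator {of_rat (q n)<..} x = (1::real)"
          by eventually_elim simp
        then show ?thesis using True by (simp add: tendsto_eventually)
      next
        case False
        then have "\<not> of_rat (q n) < x" for n using q(1)[of n] by simp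
        then show ?thesis using False by simp
      qed
    qed (simp add: indicator_def)
  qed
  have one: "P (\<lambda>_. 1)"
  proof (rule limit[where F = "\<lambda>n. indicator {- real n<..}" and C = 1])
    fix x :: real
    obtain N :: nat where N: "- x < real N" using reals_Archimedean2 by blast
    have "\<forall>\<^sub>F n in sequentially. indicator {- real n<..} x = (1::real)"
      using eventually_ge_at_top[of N] by eventually_elim (use N in \<open>auto simp: indicator_def\<close>)
    then show "(\<lambda>n. indicator {- real n<..} x :: real) \<longlonglongrightarrow> 1" by (rule tendsto_eventually)
  qed (auto simp: half indicator_def)
  have gen: "B \<in> sigma_sets UNIV (range greaterThan)"
    using assms(4) unfolding borel_Ioi by (subst (asm) sets_measure_of) auto
  have "Int_stable (range (greaterThan :: real \<Rightarrow> real set))"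
    unfolding Int_stable_def
  proof (intro ballI)
    fix A B :: "real set" assume "A \<in> range greaterThan" "B \<in> range greaterThan"
    then obtain a b where "A = {a<..}" "B = {b<..}" by blast
    then have "A \<inter> B = {max a b<..}" by auto
    then show "A \<inter> B \<in> range greaterThan" by blast
  qed
  then show ?thesis
    using _ gen
  proof (rule sigma_sets_induct_disjoint)
    show "P (indicator A)" if "A \<in> range greaterThan" for A using that half by auto
    have "(\<lambda>x. 0 * 1 + 0 * 1) = (indicator {} :: real \<Rightarrow> real)" by auto
    then show "P (indicator {})" using lincomb[OF one one, of 0 0] by simp
    show "P (indicator (UNIV - A))" if "P (indicator A)" for A
    proof -
      have "(\<lambda>x. 1 * 1 + (- 1) * indicator A x :: real) = indicator (UNIV - A)"
        by (auto simp: indicator_def)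
      then show ?thesis using lincomb[OF one that, of 1 "-1"] by simp
    qed
    show "P (indicator (\<Union>i. A i))"
      if disj: "disjoint_family A" and P: "\<And>i. P (indicator (A i))" for A :: "nat \<Rightarrow> real set"
    proof (rule limit[where F = "\<lambda>n x. \<Sum>i<n. indicator (A i) x" and C = 1])
      have *: "(\<Sum>i<n. indicator (A i) x) = (indicator (\<Union>i<n. A i) x :: real)" for n x
        by (rule indicator_UN_disjoint[symmetric])
           (use disj in \<open>auto simp: disjoint_family_on_def\<close>)
      show "P (\<lambda>x. \<Sum>i<n. indicator (A i) x)" for n
      proof (induction n)
        case 0
        show ?case using lincomb[OF one one, of 0 0] by simp
      next
        case (Suc n)
        show ?case using lincomb[OF Suc P[of n], of 1 1] by simp
      qed
      show "\<bar>\<Sum>i<n. indicator (A i) x\<bar> \<le> (1::real)" for n x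
        unfolding * by (simp add: indicator_def)
      show "(\<lambda>n. \<Sum>i<n. indicator (A i) x) \<longlonglongrightarrow> (indicator (\<Union>i. A i) x :: real)" for x
        unfolding * by (rule LIMSEQ_indicator_UN)
    qed
  qed auto
qed

text \<open>The class can be cut down to bounded Borel functions before the previous lemma is applied, so
  the closure conditions may be restricted to these. This admits equations between integrals
  as \<open>P\<close>, whose closure properties rest on integrability.\<close>

lemma bounded_borel_indicator_induct:
  fixes P :: "(real \<Rightarrow> real) \<Rightarrow> bool"
  assumes ramp: "\<And>q m. P (ramp q m)"
    and lincomb: "\<And>f g a b C D. f \<in> borel_measurable borel \<Longrightarrow> g \<in> borel_measurable borel \<Longrightarrow>
      (\<And>x. \<bar>f x\<bar> \<le> C) \<Longrightarrow> (\<And>x. \<bar>g x\<bar> \<le> D) \<Longrightarrow> P f \<Longrightarrow> P g \<Longrightarrow> P (\<lambda>x. a * f x + b * g x)"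
    and limit: "\<And>F f C. (\<And>n::nat. F n \<in> borel_measurable borel) \<Longrightarrow> f \<in> borel_measurable borel \<Longrightarrow>
      (\<And>n x. \<bar>F n x\<bar> \<le> C) \<Longrightarrow> (\<And>x. \<bar>f x\<bar> \<le> C) \<Longrightarrow> (\<And>x. (\<lambda>n. F n x) \<longlonglongrightarrow> f x) \<Longrightarrow>
      (\<And>n. P (F n)) \<Longrightarrow> P f"
    and "B \<in> sets borel"
  shows "P (indicator B)"
proof -
  define Q where "Q f \<longleftrightarrow> f \<in> borel_measurable borel \<and> (\<exists>C. \<forall>x. \<bar>f x\<bar> \<le> C) \<and> P f"
    for f :: "real \<Rightarrow> real"
  have "Q (indicator B)"
    using _ _ _ assms(4)
  proof (rule bounded_pointwise_class_borel)
    show "Q (ramp q m)" for q m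
      unfolding Q_def by (intro conjI exI[of _ 1] allI ramp ramp_abs_le ramp_measurable)
    show "Q (\<lambda>x. a * f x + b * g x)" if fg: "Q f" "Q g" for f g a b
    proof -
      obtain C D where C: "\<And>x. \<bar>f x\<bar> \<le> C" and D: "\<And>x. \<bar>g x\<bar> \<le> D"
        using fg by (auto simp: Q_def)
      have m: "f \<in> borel_measurable borel" "g \<in> borel_measurable borel" and P: "P f" "P g"
        using fg by (auto simp: Q_def)
      have bound: "\<bar>a * f x + b * g x\<bar> \<le> \<bar>a\<bar> * C + \<bar>b\<bar> * D" for x
        using abs_triangle_ineq[of "a * f x" "b * g x"] mult_left_mono[OF C[of x], of "\<bar>a\<bar>"]
          mult_left_mono[OF D[of x], of "\<bar>b\<bar>"] by (simp add: abs_mult)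
      show ?thesis
        unfolding Q_def
      proof (intro conjI exI allI)
        show "(\<lambda>x. a * f x + b * g x) \<in> borel_measurable borel" using m by measurable
      qed (rule bound, rule lincomb[OF m C D P])
    qed
    show "Q f" if F: "\<And>n::nat. Q (F n)" and C: "\<And>n x. \<bar>F n x\<bar> \<le> C"
      and lim: "\<And>x. (\<lambda>n. F n x) \<longlonglongrightarrow> f x" for F f C
    proof -
      have Fm: "F n \<in> borel_measurable borel" and P: "P (F n)" for n using F by (simp_all add: Q_def)
      have fm: "f \<in> borel_measurable borel"
        by (rule borel_measurable_LIMSEQ_real[OF lim Fm])
      have fC: "\<bar>f x\<bar> \<le> C" for x
        by (rule LIMSEQ_le_const2[OF tendsto_rabs[OF lim]]) (use C in auto)
      show ?thesis
        unfolding Q_def by (intro conjI exI[of _ C] allI fm fC limit[OF Fm fm C fC lim P])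
    qed
  qed
  then show ?thesis by (simp add: Q_def)
qed

section \<open>Weighted composition operators\<close>

definition weighted_comp :: "('a \<Rightarrow> 'a) \<Rightarrow> ('a \<Rightarrow> real) \<Rightarrow> ('a \<Rightarrow> real) \<Rightarrow> 'a \<Rightarrow> real" where
  "weighted_comp g w k = (\<lambda>x. k (g x) * w x)"

text \<open>For an invertible map \<open>g\<close> this says that \<open>w\<close> is its derivative. Nothing is said about an inverse
  of \<open>g\<close>, because a map that arises as a limit is only later seen to be invertible.\<close>

definition transfer_pair :: "'a measure \<Rightarrow> ('a \<Rightarrow> 'a) \<Rightarrow> ('a \<Rightarrow> real) \<Rightarrow> bool" where
  "transfer_pair M g w \<longleftrightarrow> g \<in> measurable M M \<and> w \<in> borel_measurable M \<and> (\<forall>x. 0 \<le> w x) \<and>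
     distr (density M (\<lambda>x. ennreal (w x))) M g = M"

definition nonsingular :: "'a measure \<Rightarrow> ('a \<Rightarrow> 'a) \<Rightarrow> bool" where
  "nonsingular M g \<longleftrightarrow>
     g \<in> measurable M M \<and> (\<forall>N\<in>null_sets M. g -` N \<inter> space M \<in> null_sets M)"

lemma transfer_pair_measurable:
  assumes "transfer_pair M g w"
  shows "g \<in> measurable M M" "w \<in> borel_measurable M"
  using assms by (auto simp: transfer_pair_def)

lemma transfer_pair_nn_integral:
  assumes T: "transfer_pair M g w" and [measurable]: "f \<in> borel_measurable M"
  shows "(\<integral>\<^sup>+x. f (g x) * ennreal (w x) \<partial>M) = (\<integral>\<^sup>+x. f x \<partial>M)"
proof -
  note [measurable] = transfer_pair_measurable[OF T]
  have "(\<integral>\<^sup>+x. f x \<partial>M) = (\<integral>\<^sup>+x. f x \<partial>distr (density M (\<lambda>x. ennreal (w x))) M g)"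
    using T by (simp add: transfer_pair_def)
  also have "\<dots> = (\<integral>\<^sup>+x. f (g x) \<partial>density M (\<lambda>x. ennreal (w x)))"
    by (rule nn_integral_distr) auto
  also have "\<dots> = (\<integral>\<^sup>+x. ennreal (w x) * f (g x) \<partial>M)"
    by (rule nn_integral_density) auto
  finally show ?thesis by (simp add: mult.commute)
qed

lemma transfer_pairI:
  assumes [measurable]: "g \<in> measurable M M" "w \<in> borel_measurable M" and "\<And>x. 0 \<le> w x"
    and *: "\<And>A. A \<in> sets M \<Longrightarrow> (\<integral>\<^sup>+x. indicator A (g x) * ennreal (w x) \<partial>M) = emeasure M A"
  shows "transfer_pair M g w"
  unfolding transfer_pair_def
proof (intro conjI allI measure_eqI)
  fix A assume "A \<in> sets (distr (density M (\<lambda>x. ennreal (w x))) M g)"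
  then have A[measurable]: "A \<in> sets M" by simp
  have "emeasure (distr (density M (\<lambda>x. ennreal (w x))) M g) A
      = (\<integral>\<^sup>+x. indicator A x \<partial>distr (density M (\<lambda>x. ennreal (w x))) M g)" by simp
  also have "\<dots> = (\<integral>\<^sup>+x. indicator A (g x) \<partial>density M (\<lambda>x. ennreal (w x)))"
    by (rule nn_integral_distr) auto
  also have "\<dots> = (\<integral>\<^sup>+x. ennreal (w x) * indicator A (g x) \<partial>M)"
    by (rule nn_integral_density) auto
  finally show "emeasure (distr (density M (\<lambda>x. ennreal (w x))) M g) A = emeasure M A"
    using *[OF A] by (simp add: mult.commute)
qed (use assms in auto)

lemma weighted_comp_integrable:
  assumes T: "transfer_pair M g w" and k: "integrable M k"
  shows "integrable M (weighted_comp g w k)"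
proof -
  note [measurable] = transfer_pair_measurable[OF T] borel_measurable_integrable[OF k]
  have "integrable (distr (density M (\<lambda>x. ennreal (w x))) M g) k"
    using T k by (simp add: transfer_pair_def)
  then have "integrable (density M (\<lambda>x. ennreal (w x))) (\<lambda>x. k (g x))"
    by (subst (asm) integrable_distr_eq) auto
  then have "integrable M (\<lambda>x. w x *\<^sub>R k (g x))"
    by (subst (asm) integrable_density) (use T in \<open>auto simp: transfer_pair_def\<close>)
  then show ?thesis by (simp add: weighted_comp_def[abs_def] mult.commute)
qed

lemma weighted_comp_integral:
  assumes T: "transfer_pair M g w" and k: "k \<in> borel_measurable M"
  shows "(\<integral>x. weighted_comp g w k x \<partial>M) = (\<integral>x. k x \<partial>M)"
proof -
  note [measurable] = transfer_pair_measurable[OF T] k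
  have "(\<integral>x. k x \<partial>M) = (\<integral>x. k x \<partial>distr (density M (\<lambda>x. ennreal (w x))) M g)"
    using T by (simp add: transfer_pair_def)
  also have "\<dots> = (\<integral>x. k (g x) \<partial>density M (\<lambda>x. ennreal (w x)))"
    by (rule integral_distr) auto
  also have "\<dots> = (\<integral>x. w x *\<^sub>R k (g x) \<partial>M)"
    by (rule integral_density) (use T in \<open>auto simp: transfer_pair_def\<close>)
  finally show ?thesis by (simp add: weighted_comp_def mult.commute)
qed

lemma weighted_comp_isometry:
  assumes T: "transfer_pair M g w" and k: "integrable M k" "integrable M k'"
  shows "L1_dist M (weighted_comp g w k) (weighted_comp g w k') = L1_dist M k k'"
proof -
  have "\<bar>weighted_comp g w k x - weighted_comp g w k' x\<bar> = weighted_comp g w (\<lambda>x. \<bar>k x - k' x\<bar>) x" for x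
    using T by (simp add: weighted_comp_def transfer_pair_def left_diff_distrib[symmetric] abs_mult)
  then show ?thesis
    unfolding L1_dist_def using weighted_comp_integral[OF T, of "\<lambda>x. \<bar>k x - k' x\<bar>"] k by simp
qed

lemma transfer_pair_compose:
  assumes g: "transfer_pair M g w" and h: "transfer_pair M h v"
  shows "transfer_pair M (g \<circ> h) (\<lambda>x. w (h x) * v x)"
proof (rule transfer_pairI)
  note [measurable] = transfer_pair_measurable[OF g] transfer_pair_measurable[OF h]
  show "g \<circ> h \<in> measurable M M" by measurable
  show "(\<lambda>x. w (h x) * v x) \<in> borel_measurable M" by measurable
  show "0 \<le> w (h x) * v x" for x using g h by (simp add: transfer_pair_def)
  fix A assume A[measurable]: "A \<in> sets M"
  have "(\<integral>\<^sup>+x. indicator A ((g \<circ> h) x) * ennreal (w (h x) * v x) \<partial>M)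
      = (\<integral>\<^sup>+x. (indicator A (g (h x)) * ennreal (w (h x))) * ennreal (v x) \<partial>M)"
    using g h by (simp add: transfer_pair_def ennreal_mult' mult.assoc)
  also have "\<dots> = (\<integral>\<^sup>+x. indicator A (g x) * ennreal (w x) \<partial>M)"
    by (rule transfer_pair_nn_integral[OF h]) measurable
  also have "\<dots> = (\<integral>\<^sup>+x. indicator A x \<partial>M)"
    by (rule transfer_pair_nn_integral[OF g]) measurable
  finally show "(\<integral>\<^sup>+x. indicator A ((g \<circ> h) x) * ennreal (w (h x) * v x) \<partial>M) = emeasure M A"
    by simp
qed

text \<open>The operators are isometric, so the images of an approximation of \<open>k\<close> approximate the images of
  \<open>k\<close> uniformly in \<open>i\<close>. It therefore suffices to check convergence on generators of L1.\<close>

lemma weighted_comp_limit_closed_subspace: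
  assumes s: "\<forall>\<^sub>F i in F. transfer_pair M (s i) (v i)" and t: "\<forall>\<^sub>F i in F. transfer_pair M (t i) (w i)"
  shows "L1_closed_subspace M
    (\<lambda>k. ((\<lambda>i. L1_dist M (weighted_comp (s i) (v i) k) (weighted_comp (t i) (w i) k)) \<longlongrightarrow> 0) F)"
proof -
  define D where "D i k = L1_dist M (weighted_comp (s i) (v i) k) (weighted_comp (t i) (w i) k)" for i k
  have "((\<lambda>i. D i (\<lambda>x. a * f x + b * g x)) \<longlongrightarrow> 0) F"
    if fg: "integrable M f" "integrable M g"
      and lim: "((\<lambda>i. D i f) \<longlongrightarrow> 0) F" "((\<lambda>i. D i g) \<longlongrightarrow> 0) F" for f g a b
  proof (rule tendsto_sandwich[OF _ _ tendsto_const])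
    show "\<forall>\<^sub>F i in F. D i (\<lambda>x. a * f x + b * g x) \<le> \<bar>a\<bar> * D i f + \<bar>b\<bar> * D i g"
      using s t
    proof eventually_elim
      fix i assume "transfer_pair M (s i) (v i)" "transfer_pair M (t i) (w i)"
      from L1_dist_lincomb[OF weighted_comp_integrable[OF this(1) fg(1)]
          weighted_comp_integrable[OF this(1) fg(2)] weighted_comp_integrable[OF this(2) fg(1)]
          weighted_comp_integrable[OF this(2) fg(2)], of a b]
      show "D i (\<lambda>x. a * f x + b * g x) \<le> \<bar>a\<bar> * D i f + \<bar>b\<bar> * D i g"
        by (simp add: D_def weighted_comp_def algebra_simps)
    qed
    show "((\<lambda>i. \<bar>a\<bar> * D i f + \<bar>b\<bar> * D i g) \<longlongrightarrow> 0) F"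
      using tendsto_add[OF tendsto_mult_left[OF lim(1), of "\<bar>a\<bar>"] tendsto_mult_left[OF lim(2), of "\<bar>b\<bar>"]]
      by simp
  qed (simp add: D_def)
  moreover have "((\<lambda>i. D i f) \<longlongrightarrow> 0) F"
    if G: "\<And>n::nat. integrable M (G n)" "\<And>n. ((\<lambda>i. D i (G n)) \<longlongrightarrow> 0) F"
      and f: "integrable M f" and lim: "(\<lambda>n. L1_dist M (G n) f) \<longlonglongrightarrow> 0" for G f
  proof (rule tendstoI)
    fix e :: real assume e: "e > 0"
    then have "\<forall>\<^sub>F n in sequentially. L1_dist M (G n) f < e / 3"
      using order_tendstoD(2)[OF lim, of "e/3"] by simp
    then obtain n where n: "L1_dist M (G n) f < e / 3" by (auto simp: eventually_sequentially)
    have "\<forall>\<^sub>F i in F. D i (G n) < e / 3" using order_tendstoD(2)[OF G(2), of "e/3"] e by simp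
    then show "\<forall>\<^sub>F i in F. dist (D i f) 0 < e"
      using s t
    proof eventually_elim
      fix i assume D: "D i (G n) < e / 3"
        and st: "transfer_pair M (s i) (v i)" "transfer_pair M (t i) (w i)"
      note int = weighted_comp_integrable[OF st(1)] weighted_comp_integrable[OF st(2)]
      have "D i f \<le> L1_dist M (weighted_comp (s i) (v i) f) (weighted_comp (s i) (v i) (G n))
          + (D i (G n) + L1_dist M (weighted_comp (t i) (w i) (G n)) (weighted_comp (t i) (w i) f))"
        unfolding D_def using f G(1)
        by (intro order_trans[OF L1_dist_triangle add_left_mono[OF L1_dist_triangle]] int) auto
      also have "\<dots> < e"
        using weighted_comp_isometry[OF st(1) f G(1)[of n]] weighted_comp_isometry[OF st(2) G(1)[of n] f]
          n D L1_dist_commute[of M f "G n"] by simp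
      finally show "dist (D i f) 0 < e" by (simp add: D_def)
    qed
  qed
  ultimately show ?thesis unfolding L1_closed_subspace_def D_def by blast
qed

section \<open>Nonsingular maps\<close>

lemma AE_E_null_set:
  assumes "AE x in M. P x"
  obtains N where "N \<in> null_sets M" "{x\<in>space M. \<not> P x} \<subseteq> N"
  using assms by (auto elim!: AE_E simp: null_sets_def)

lemma nonsingular_measurable: "nonsingular M g \<Longrightarrow> g \<in> measurable M M"
  by (simp add: nonsingular_def)

lemma nonsingular_AE:
  assumes g: "nonsingular M g" and P: "AE x in M. P x"
  shows "AE x in M. P (g x)"
proof -
  obtain N where N: "N \<in> null_sets M" "{x\<in>space M. \<not> P x} \<subseteq> N"
    using AE_E_null_set[OF P] by blast
  have "g -` N \<inter> space M \<in> null_sets M" using g N(1) by (simp add: nonsingular_def)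
  then show ?thesis
    by (rule AE_I') (use N(2) measurable_space[OF nonsingular_measurable[OF g]] in auto)
qed

lemma gms_nonsingular: "g \<in> gms_maps M \<Longrightarrow> nonsingular M g"
  by (auto simp: gms_maps_def nonsingular_def)

lemma gms_mapsI:
  assumes g: "nonsingular M g" and h: "nonsingular M h"
    and hg: "\<And>x. x \<in> space M \<Longrightarrow> h (g x) = x" and gh: "\<And>x. x \<in> space M \<Longrightarrow> g (h x) = x"
  shows "g \<in> gms_maps M" and "\<And>x. x \<in> space M \<Longrightarrow> inv_into (space M) g x = h x"
proof -
  note sp = measurable_space[OF nonsingular_measurable[OF g]]
    measurable_space[OF nonsingular_measurable[OF h]]
  have b: "bij_betw g (space M) (space M)"
    by (rule bij_betw_byWitness[where f' = h]) (use hg gh sp in auto)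
  show inv: "\<And>x. x \<in> space M \<Longrightarrow> inv_into (space M) g x = h x"
    using b gh sp by (metis bij_betw_inv_into_left)
  show "g \<in> gms_maps M"
    unfolding gms_maps_def
  proof (intro CollectI conjI ballI)
    show "inv_into (space M) g \<in> measurable M M"
      using nonsingular_measurable[OF h] inv by (simp cong: measurable_cong)
    fix N assume N: "N \<in> null_sets M"
    then have sub: "N \<subseteq> space M" using sets.sets_into_space null_setsD2 by metis
    have "g ` N = h -` N \<inter> space M" using sub hg gh sp by (force simp: image_iff)
    then show "g ` N \<in> null_sets M" using h N by (simp add: nonsingular_def)
    show "g -` N \<inter> space M \<in> null_sets M" using g N by (simp add: nonsingular_def)
  qed (use b g in \<open>auto simp: nonsingular_def\<close>)
qed

lemma gms_inv:
  assumes g: "g \<in> gms_maps M"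
  shows "inv_into (space M) g \<in> gms_maps M"
    and "\<And>x. x \<in> space M \<Longrightarrow> inv_into (space M) g (g x) = x"
    and "\<And>x. x \<in> space M \<Longrightarrow> g (inv_into (space M) g x) = x"
proof -
  let ?i = "inv_into (space M) g"
  have b: "bij_betw g (space M) (space M)" using g by (simp add: gms_maps_def)
  show l: "\<And>x. x \<in> space M \<Longrightarrow> ?i (g x) = x" by (rule bij_betw_inv_into_left[OF b])
  show r: "\<And>x. x \<in> space M \<Longrightarrow> g (?i x) = x" by (rule bij_betw_inv_into_right[OF b])
  have "nonsingular M ?i"
    unfolding nonsingular_def
  proof (intro conjI ballI)
    show "?i \<in> measurable M M" using g by (simp add: gms_maps_def)
    fix N assume N: "N \<in> null_sets M"
    then have "N \<subseteq> space M" using sets.sets_into_space null_setsD2 by metis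
    from gms_image_eq_vimage[OF g this] show "?i -` N \<inter> space M \<in> null_sets M"
      using g N by (simp add: gms_maps_def)
  qed
  then show "?i \<in> gms_maps M" using gms_nonsingular[OF g] r l by (rule gms_mapsI(1))
qed

lemma nonsingular_compose:
  assumes "nonsingular M g" "nonsingular M h"
  shows "nonsingular M (g \<circ> h)"
  unfolding nonsingular_def
proof (intro conjI ballI)
  note [measurable] = assms[THEN nonsingular_measurable]
  show "g \<circ> h \<in> measurable M M" by measurable
  fix N assume "N \<in> null_sets M"
  then have "h -` (g -` N \<inter> space M) \<inter> space M \<in> null_sets M"
    using assms unfolding nonsingular_def by blast
  moreover have "(g \<circ> h) -` N \<inter> space M = h -` (g -` N \<inter> space M) \<inter> space M"
    using measurable_space[OF nonsingular_measurable[OF assms(2)]] by auto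
  ultimately show "(g \<circ> h) -` N \<inter> space M \<in> null_sets M" by simp
qed

lemma nonsingular_id: "nonsingular M (\<lambda>x. x)"
  by (auto simp: nonsingular_def)

lemma gms_id: "(\<lambda>x. x) \<in> gms_maps M"
  by (rule gms_mapsI(1)[OF nonsingular_id nonsingular_id]) auto

lemma gms_compose:
  assumes "g \<in> gms_maps M" "h \<in> gms_maps M"
  shows "g \<circ> h \<in> gms_maps M"
proof (rule gms_mapsI(1))
  show "nonsingular M (g \<circ> h)" "nonsingular M (inv_into (space M) h \<circ> inv_into (space M) g)"
    by (intro nonsingular_compose gms_nonsingular gms_inv(1) assms)+
  note sp = assms[THEN gms_nonsingular, THEN nonsingular_measurable, THEN measurable_space]
    assms[THEN gms_inv(1), THEN gms_nonsingular, THEN nonsingular_measurable, THEN measurable_space]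
  show "(inv_into (space M) h \<circ> inv_into (space M) g) ((g \<circ> h) x) = x" if "x \<in> space M" for x
    using that sp assms by (simp add: gms_inv)
  show "(g \<circ> h) ((inv_into (space M) h \<circ> inv_into (space M) g) x) = x" if "x \<in> space M" for x
    using that sp assms by (simp add: gms_inv)
qed

text \<open>The two maps are kept on a conull set that is invariant under both, where they are mutually
  inverse bijections, and replaced by the identity on its complement.\<close>

lemma AE_inverse_imp_gms_map:
  assumes g: "nonsingular M g" and h: "nonsingular M h"
    and hg: "AE x in M. h (g x) = x" and gh: "AE x in M. g (h x) = x"
  obtains f where "f \<in> gms_maps M" "AE x in M. f x = g x"
proof -
  have "AE x in M. h (g x) = x \<and> g (h x) = x" using hg gh by eventually_elim simp
  then obtain N where N: "N \<in> null_sets M" "{x\<in>space M. \<not> (h (g x) = x \<and> g (h x) = x)} \<subseteq> N"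
    by (rule AE_E_null_set)
  \<comment> \<open>The set \<open>G n\<close> consists of the points that words of length at most \<open>n\<close> in \<open>g\<close> and \<open>h\<close> keep
    off \<open>N\<close>.\<close>
  define G where "G = rec_nat (space M - N) (\<lambda>_ A. {x\<in>A. g x \<in> A \<and> h x \<in> A})"
  have G0: "G 0 = space M - N" and GS: "G (Suc n) = {x\<in>G n. g x \<in> G n \<and> h x \<in> G n}" for n
    by (simp_all add: G_def)
  note [measurable] = nonsingular_measurable[OF g] nonsingular_measurable[OF h]
  have sub: "G n \<subseteq> space M" for n by (induction n) (auto simp: G0 GS)
  have Gm[measurable]: "G n \<in> sets M" for n
  proof (induction n)
    case 0 then show ?case using N(1) by (auto simp: G0)
  next
    case (Suc n)
    note [measurable] = Suc
    have "G (Suc n) = {x\<in>space M. x \<in> G n \<and> g x \<in> G n \<and> h x \<in> G n}"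
      using sub[of n] by (auto simp: GS)
    also have "\<dots> \<in> sets M" by measurable
    finally show ?case .
  qed
  have GAE: "AE x in M. x \<in> G n" for n
  proof (induction n)
    case 0
    show ?case using AE_not_in[OF N(1)] by (auto simp: G0)
  next
    case (Suc n)
    from Suc nonsingular_AE[OF g Suc] nonsingular_AE[OF h Suc]
    show ?case by eventually_elim (simp add: GS)
  qed
  define W where "W = (\<Inter>n. G n)"
  have Wm[measurable]: "W \<in> sets M" unfolding W_def by measurable
  have WAE: "AE x in M. x \<in> W" using GAE by (simp add: W_def AE_all_countable)
  have Wg: "g x \<in> W" and Wh: "h x \<in> W" if "x \<in> W" for x
  proof -
    have "x \<in> G (Suc n)" for n using that by (auto simp: W_def)
    then show "g x \<in> W" "h x \<in> W" by (auto simp: W_def GS)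
  qed
  have Wi: "h (g x) = x" "g (h x) = x" if "x \<in> W" for x
  proof -
    have "x \<in> G 0" using that by (auto simp: W_def)
    then show "h (g x) = x" "g (h x) = x" using N(2) by (auto simp: G0)
  qed
  have ns: "nonsingular M (\<lambda>x. if x \<in> W then k x else x)" if k: "nonsingular M k" for k
    unfolding nonsingular_def
  proof (intro conjI ballI)
    note [measurable] = nonsingular_measurable[OF k]
    show m: "(\<lambda>x. if x \<in> W then k x else x) \<in> measurable M M" by measurable
    fix A assume A: "A \<in> null_sets M"
    then have [measurable]: "A \<in> sets M" by auto
    show "(\<lambda>x. if x \<in> W then k x else x) -` A \<inter> space M \<in> null_sets M"
    proof (rule null_sets_subset)
      show "(k -` A \<inter> space M) \<union> A \<in> null_sets M" using k A by (auto simp: nonsingular_def)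
      show "(\<lambda>x. if x \<in> W then k x else x) -` A \<inter> space M \<in> sets M"
        by (rule measurable_sets[OF m]) simp
    qed (auto split: if_splits)
  qed
  show ?thesis
  proof (rule that)
    show "(\<lambda>x. if x \<in> W then g x else x) \<in> gms_maps M"
      by (rule gms_mapsI(1)[OF ns[OF g] ns[OF h]]) (auto simp: Wg Wh Wi)
    show "AE x in M. (if x \<in> W then g x else x) = g x"
      using WAE by eventually_elim simp
  qed
qed

section \<open>The Koopman operators of the group\<close>

text \<open>The operator that a nonsingular transformation induces on L1. It is isometric, sends \<open>1\<close> to the
  derivative, and reverses the order of compositions.\<close>

definition koopman :: "'a measure \<Rightarrow> ('a \<Rightarrow> 'a) \<Rightarrow> ('a \<Rightarrow> real) \<Rightarrow> 'a \<Rightarrow> real" where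
  "koopman M g = weighted_comp g (gms_deriv M g)"

lemma gms_absolutely_continuous:
  assumes "g \<in> gms_maps M"
  shows "absolutely_continuous M (distr M M (inv_into (space M) g))"
proof -
  have "N \<in> null_sets (distr M M (inv_into (space M) g))" if N: "N \<in> null_sets M" for N
  proof -
    have "N \<in> sets M" using N by auto
    moreover have "emeasure M (g ` N) = 0" using assms N by (auto simp: gms_maps_def)
    ultimately show ?thesis by (auto simp: null_sets_def emeasure_distr_inv_gms[OF assms])
  qed
  then show ?thesis by (auto simp: absolutely_continuous_def)
qed

lemma gms_transfer_pair:
  assumes "prob_space M" and g: "g \<in> gms_maps M"
  shows "transfer_pair M g (gms_deriv M g)"
proof -
  interpret prob_space M by fact
  let ?i = "inv_into (space M) g"
  note m = gms_nonsingular[OF g, THEN nonsingular_measurable]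
    gms_nonsingular[OF gms_inv(1)[OF g], THEN nonsingular_measurable]
  note [measurable] = m
  interpret N: prob_space "distr M M ?i" by (rule prob_space_distr) measurable
  have ac: "absolutely_continuous M (distr M M ?i)" by (rule gms_absolutely_continuous[OF g])
  have "AE x in M. RN_deriv M (distr M M ?i) x \<noteq> \<infinity>"
    by (rule RN_deriv_finite[OF N.sigma_finite_measure_axioms ac]) simp
  then have "AE x in M. ennreal (gms_deriv M g x) = RN_deriv M (distr M M ?i) x"
    by eventually_elim (simp add: gms_deriv_def less_top)
  then have "density M (\<lambda>x. ennreal (gms_deriv M g x)) = density M (RN_deriv M (distr M M ?i))"
    by (intro density_cong) auto
  also have "\<dots> = distr M M ?i" by (rule density_RN_deriv[OF ac]) simp
  finally have "distr (density M (\<lambda>x. ennreal (gms_deriv M g x))) M g = distr (distr M M ?i) M g"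
    by simp
  also have "\<dots> = distr M M (g \<circ> ?i)" by (rule distr_distr) measurable
  also have "\<dots> = distr M M (\<lambda>x. x)" by (rule distr_cong) (auto simp: gms_inv[OF g])
  also have "\<dots> = M" by (rule distr_id)
  finally show ?thesis by (auto simp: transfer_pair_def gms_deriv_def)
qed

text \<open>Transporting the equation that defines a transfer pair by the inverse of \<open>g\<close> shows that \<open>w\<close> is the
  density of the measure whose Radon-Nikodym derivative defines \<open>gms_deriv\<close>.\<close>

lemma gms_deriv_unique:
  assumes "prob_space M" and g: "g \<in> gms_maps M" and T: "transfer_pair M g w"
  shows "AE x in M. gms_deriv M g x = w x"
proof -
  interpret prob_space M by fact
  let ?i = "inv_into (space M) g"
  let ?D = "density M (\<lambda>x. ennreal (w x))"
  note m = gms_nonsingular[OF g, THEN nonsingular_measurable]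
    gms_nonsingular[OF gms_inv(1)[OF g], THEN nonsingular_measurable]
  note [measurable] = m transfer_pair_measurable[OF T]
  have "distr M M ?i = distr (distr ?D M g) M ?i" using T by (simp add: transfer_pair_def)
  also have "\<dots> = distr ?D M (?i \<circ> g)" by (rule distr_distr) measurable
  also have "\<dots> = distr ?D ?D (\<lambda>x. x)" by (rule distr_cong) (auto simp: gms_inv[OF g])
  also have "\<dots> = ?D" by (rule distr_id)
  finally have "?D = distr M M ?i" by simp
  then have "AE x in M. ennreal (w x) = RN_deriv M (distr M M ?i) x"
    by (intro RN_deriv_unique) auto
  then show ?thesis
  proof eventually_elim
    fix x assume "ennreal (w x) = RN_deriv M (distr M M ?i) x"
    moreover have "0 \<le> w x" using T by (simp add: transfer_pair_def)
    ultimately show "gms_deriv M g x = w x"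
      unfolding gms_deriv_def by (metis enn2real_ennreal)
  qed
qed

lemma gms_deriv_nonneg: "0 \<le> gms_deriv M g x"
  by (simp add: gms_deriv_def)

text \<open>The image of the zero set of the derivative is a null set, and \<open>g\<close> pulls null sets back to null
  sets.\<close>

lemma gms_deriv_pos:
  assumes "prob_space M" and g: "g \<in> gms_maps M"
  shows "AE x in M. 0 < gms_deriv M g x"
proof -
  let ?Z = "{x\<in>space M. gms_deriv M g x = 0}"
  have Z[measurable]: "?Z \<in> sets M" by measurable
  have gZ[measurable]: "g ` ?Z \<in> sets M" by (rule gms_image_sets[OF g Z])
  note T = gms_transfer_pair[OF assms]
  have "emeasure M (g ` ?Z) = (\<integral>\<^sup>+x. indicator (g ` ?Z) (g x) * ennreal (gms_deriv M g x) \<partial>M)"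
    by (subst transfer_pair_nn_integral[OF T]) auto
  also have "\<dots> = (\<integral>\<^sup>+x. 0 \<partial>M)"
  proof (rule nn_integral_cong)
    fix x assume x: "x \<in> space M"
    have "inj_on g (space M)" using g by (simp add: gms_maps_def bij_betw_def)
    then have "g x \<in> g ` ?Z \<longleftrightarrow> x \<in> ?Z" using x by (auto dest: inj_onD)
    then show "indicator (g ` ?Z) (g x) * ennreal (gms_deriv M g x) = 0"
      by (auto simp: indicator_def)
  qed
  finally have "g ` ?Z \<in> null_sets M" by (auto simp: null_sets_def)
  then have "g -` (g ` ?Z) \<inter> space M \<in> null_sets M" using g by (simp add: gms_maps_def)
  then show ?thesis
    by (rule AE_I') (use gms_deriv_nonneg[of M g] in \<open>auto simp: less_le\<close>)
qed

lemma gms_deriv_cong: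
  assumes "f \<in> gms_maps M" "g \<in> gms_maps M" "AE x in M. f x = g x"
  shows "gms_deriv M f = gms_deriv M g"
  unfolding gms_deriv_def distr_inv_gms_cong[OF assms] ..

lemma koopman_integrable:
  assumes "prob_space M" "g \<in> gms_maps M" "integrable M k"
  shows "integrable M (koopman M g k)"
  unfolding koopman_def by (rule weighted_comp_integrable[OF gms_transfer_pair]) fact+

lemma koopman_isometry:
  assumes "prob_space M" "g \<in> gms_maps M" "integrable M k" "integrable M k'"
  shows "L1_dist M (koopman M g k) (koopman M g k') = L1_dist M k k'"
  unfolding koopman_def by (rule weighted_comp_isometry[OF gms_transfer_pair]) fact+

lemma koopman_cong_AE:
  assumes "f \<in> gms_maps M" "g \<in> gms_maps M" "AE x in M. f x = g x"
  shows "AE x in M. koopman M f k x = koopman M g k x"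
  using assms(3) by eventually_elim (simp add: koopman_def weighted_comp_def gms_deriv_cong[OF assms])

lemma koopman_compose:
  assumes M: "prob_space M" and g: "g \<in> gms_maps M" and h: "h \<in> gms_maps M"
  shows "AE x in M. koopman M (g \<circ> h) k x = koopman M h (koopman M g k) x"
proof -
  have "AE x in M. gms_deriv M (g \<circ> h) x = gms_deriv M g (h x) * gms_deriv M h x"
    by (rule gms_deriv_unique[OF M gms_compose[OF g h]
          transfer_pair_compose[OF gms_transfer_pair[OF M g] gms_transfer_pair[OF M h]]])
  then show ?thesis
    by eventually_elim (simp add: koopman_def weighted_comp_def)
qed

lemma koopman_id:
  assumes M: "prob_space M"
  shows "AE x in M. koopman M (\<lambda>x. x) k x = k x"
proof -
  have "transfer_pair M (\<lambda>x. x) (\<lambda>_. 1)"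
    by (rule transfer_pairI) auto
  from gms_deriv_unique[OF M gms_id this] show ?thesis
    by eventually_elim (simp add: koopman_def weighted_comp_def)
qed

section \<open>The group of classes\<close>

definition gms_class :: "'a measure \<Rightarrow> ('a \<Rightarrow> 'a) \<Rightarrow> ('a \<Rightarrow> 'a) set" where
  "gms_class M g = ae_eq_rel M `` {g}"

definition gms_rep :: "('a \<Rightarrow> 'a) set \<Rightarrow> 'a \<Rightarrow> 'a" where
  "gms_rep X = (SOME g. g \<in> X)"

lemma equiv_ae_eq_rel: "equiv (gms_maps M) (ae_eq_rel M)"
proof (rule equivI)
  show "ae_eq_rel M \<subseteq> gms_maps M \<times> gms_maps M" by (auto simp: ae_eq_rel_def)
  show "refl_on (gms_maps M) (ae_eq_rel M)" by (auto simp: refl_on_def ae_eq_rel_def)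
  show "sym (ae_eq_rel M)"
  proof (rule symI)
    fix f g assume fg: "(f, g) \<in> ae_eq_rel M"
    then have "AE x in M. f x = g x" by (simp add: ae_eq_rel_def)
    then have "AE x in M. g x = f x" by eventually_elim simp
    with fg show "(g, f) \<in> ae_eq_rel M" by (simp add: ae_eq_rel_def)
  qed
  show "trans (ae_eq_rel M)"
  proof (rule transI)
    fix f g h assume fgh: "(f, g) \<in> ae_eq_rel M" "(g, h) \<in> ae_eq_rel M"
    then have "AE x in M. f x = g x" "AE x in M. g x = h x" by (simp_all add: ae_eq_rel_def)
    then have "AE x in M. f x = h x" by eventually_elim simp
    with fgh show "(f, h) \<in> ae_eq_rel M" by (simp add: ae_eq_rel_def)
  qed
qed

lemma gms_class_eq_iff:
  assumes "f \<in> gms_maps M" "g \<in> gms_maps M"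
  shows "gms_class M f = gms_class M g \<longleftrightarrow> (AE x in M. f x = g x)"
  unfolding gms_class_def
  using eq_equiv_class_iff[OF equiv_ae_eq_rel assms] assms by (simp add: ae_eq_rel_def)

lemma carrier_Gms: "carrier (Gms M) = gms_class M ` gms_maps M"
  by (auto simp: Gms_def quotient_def gms_class_def)

lemma gms_class_in_carrier: "g \<in> gms_maps M \<Longrightarrow> gms_class M g \<in> carrier (Gms M)"
  by (simp add: carrier_Gms)

lemma gms_rep:
  assumes "X \<in> carrier (Gms M)"
  shows "gms_rep X \<in> gms_maps M" and "gms_class M (gms_rep X) = X"
proof -
  obtain g where g: "g \<in> gms_maps M" "X = gms_class M g" using assms by (auto simp: carrier_Gms)
  then have "g \<in> X" by (auto simp: gms_class_def ae_eq_rel_def)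
  then have r: "gms_rep X \<in> X" unfolding gms_rep_def by (rule someI[where P = "\<lambda>g. g \<in> X"])
  then show *: "gms_rep X \<in> gms_maps M" using g by (auto simp: gms_class_def ae_eq_rel_def)
  have "AE x in M. g x = gms_rep X x" using r g by (auto simp: gms_class_def ae_eq_rel_def)
  then show "gms_class M (gms_rep X) = X" using gms_class_eq_iff[OF g(1) *] g(2) by simp
qed

lemma gms_rep_class:
  assumes "g \<in> gms_maps M"
  shows "AE x in M. gms_rep (gms_class M g) x = g x"
  using gms_rep[OF gms_class_in_carrier[OF assms]] gms_class_eq_iff[OF _ assms] by blast

lemma gms_mult_class:
  assumes f: "f \<in> gms_maps M" and g: "g \<in> gms_maps M"
  shows "gms_class M f \<otimes>\<^bsub>Gms M\<^esub> gms_class M g = gms_class M (f \<circ> g)"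
proof -
  have "h \<in> gms_mult M (gms_class M f) (gms_class M g) \<longleftrightarrow> h \<in> gms_class M (f \<circ> g)" for h
  proof
    assume "h \<in> gms_mult M (gms_class M f) (gms_class M g)"
    then obtain f' g' where h: "h \<in> gms_maps M" "AE x in M. h x = f' (g' x)"
      and g': "g' \<in> gms_maps M"
      and ae: "AE x in M. f x = f' x" "AE x in M. g x = g' x"
      by (auto simp: gms_mult_def gms_class_def ae_eq_rel_def)
    from h(2) nonsingular_AE[OF gms_nonsingular[OF g'] ae(1)] ae(2)
    have "AE x in M. (f \<circ> g) x = h x" by eventually_elim simp
    then show "h \<in> gms_class M (f \<circ> g)"
      using h(1) gms_compose[OF f g] by (simp add: gms_class_def ae_eq_rel_def)
  next
    assume h: "h \<in> gms_class M (f \<circ> g)"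
    then have "AE x in M. (f \<circ> g) x = h x" by (simp add: gms_class_def ae_eq_rel_def)
    then have "AE x in M. h x = f (g x)" by eventually_elim simp
    moreover have "h \<in> gms_maps M" using h by (simp add: gms_class_def ae_eq_rel_def)
    ultimately show "h \<in> gms_mult M (gms_class M f) (gms_class M g)"
      using f g by (auto simp: gms_mult_def gms_class_def ae_eq_rel_def)
  qed
  then show ?thesis by (auto simp: Gms_def)
qed

lemma one_Gms: "\<one>\<^bsub>Gms M\<^esub> = gms_class M (\<lambda>x. x)"
  by (simp add: Gms_def gms_class_def)

lemma gms_class_inv_mult:
  assumes g: "g \<in> gms_maps M"
  shows "gms_class M (inv_into (space M) g) \<otimes>\<^bsub>Gms M\<^esub> gms_class M g = \<one>\<^bsub>Gms M\<^esub>"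
  unfolding gms_mult_class[OF gms_inv(1)[OF g] g] one_Gms
  using gms_class_eq_iff[OF gms_compose[OF gms_inv(1)[OF g] g] gms_id] gms_inv(2)[OF g] by simp

lemma group_Gms: "group (Gms M)"
proof (rule groupI)
  show "\<one>\<^bsub>Gms M\<^esub> \<in> carrier (Gms M)" by (simp add: one_Gms carrier_Gms gms_id)
  fix X assume "X \<in> carrier (Gms M)"
  then obtain f where f: "f \<in> gms_maps M" "X = gms_class M f" by (auto simp: carrier_Gms)
  show "\<one>\<^bsub>Gms M\<^esub> \<otimes>\<^bsub>Gms M\<^esub> X = X"
    using f by (simp add: one_Gms gms_mult_class gms_id o_def)
  show "\<exists>Y\<in>carrier (Gms M). Y \<otimes>\<^bsub>Gms M\<^esub> X = \<one>\<^bsub>Gms M\<^esub>"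
    using gms_class_inv_mult[OF f(1)] gms_class_in_carrier[OF gms_inv(1)[OF f(1)]] f(2) by blast
  fix Y assume "Y \<in> carrier (Gms M)"
  then obtain g where g: "g \<in> gms_maps M" "Y = gms_class M g" by (auto simp: carrier_Gms)
  show "X \<otimes>\<^bsub>Gms M\<^esub> Y \<in> carrier (Gms M)"
    using f g by (simp add: gms_mult_class gms_class_in_carrier gms_compose)
  fix Z assume "Z \<in> carrier (Gms M)"
  then obtain h where h: "h \<in> gms_maps M" "Z = gms_class M h" by (auto simp: carrier_Gms)
  show "X \<otimes>\<^bsub>Gms M\<^esub> Y \<otimes>\<^bsub>Gms M\<^esub> Z = X \<otimes>\<^bsub>Gms M\<^esub> (Y \<otimes>\<^bsub>Gms M\<^esub> Z)"
    using f g h by (simp add: gms_mult_class gms_compose o_assoc)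
qed

text \<open>Classes act through a chosen representative; another one changes the image of a function on a null set
  only.\<close>

definition class_koopman :: "'a measure \<Rightarrow> ('a \<Rightarrow> 'a) set \<Rightarrow> ('a \<Rightarrow> real) \<Rightarrow> 'a \<Rightarrow> real" where
  "class_koopman M X = koopman M (gms_rep X)"

abbreviation koopman_dist :: "'a measure \<Rightarrow> ('a \<Rightarrow> 'a) set \<Rightarrow> ('a \<Rightarrow> 'a) set \<Rightarrow> ('a \<Rightarrow> real) \<Rightarrow> real" where
  "koopman_dist M X Y k \<equiv> L1_dist M (class_koopman M X k) (class_koopman M Y k)"

lemma AE_class_koopman:
  assumes "g \<in> gms_maps M"
  shows "AE x in M. class_koopman M (gms_class M g) k x = koopman M g k x"
  unfolding class_koopman_def
  by (rule koopman_cong_AE[OF gms_rep(1)[OF gms_class_in_carrier[OF assms]] assms gms_rep_class[OF assms]])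

context prob_space begin

lemma class_koopman_integrable:
  assumes "X \<in> carrier (Gms M)" "integrable M k"
  shows "integrable M (class_koopman M X k)"
  unfolding class_koopman_def using koopman_integrable[OF prob_space_axioms gms_rep(1)] assms by blast

lemma class_koopman_isometry:
  assumes "X \<in> carrier (Gms M)" "integrable M k" "integrable M k'"
  shows "L1_dist M (class_koopman M X k) (class_koopman M X k') = L1_dist M k k'"
  unfolding class_koopman_def using koopman_isometry[OF prob_space_axioms gms_rep(1)] assms by blast

lemma class_koopman_mult:
  assumes X: "X \<in> carrier (Gms M)" and Y: "Y \<in> carrier (Gms M)"
  shows "AE x in M. class_koopman M (X \<otimes>\<^bsub>Gms M\<^esub> Y) k x = class_koopman M Y (class_koopman M X k) x"
proof -
  have "X \<otimes>\<^bsub>Gms M\<^esub> Y = gms_class M (gms_rep X \<circ> gms_rep Y)"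
    using gms_mult_class[OF gms_rep(1)[OF X] gms_rep(1)[OF Y]] gms_rep(2)[OF X] gms_rep(2)[OF Y] by simp
  with AE_class_koopman[OF gms_compose[OF gms_rep(1)[OF X] gms_rep(1)[OF Y]], of k]
    koopman_compose[OF prob_space_axioms gms_rep(1)[OF X] gms_rep(1)[OF Y], of k]
  show ?thesis by (auto simp: class_koopman_def)
qed

lemma class_koopman_one: "AE x in M. class_koopman M \<one>\<^bsub>Gms M\<^esub> k x = k x"
  using AE_class_koopman[OF gms_id, of M k] koopman_id[OF prob_space_axioms, of k]
  unfolding one_Gms by eventually_elim simp

lemma koopman_dist_mult_le:
  assumes X: "X \<in> carrier (Gms M)" "X' \<in> carrier (Gms M)"
    and Y: "Y \<in> carrier (Gms M)" "Y' \<in> carrier (Gms M)" and k: "integrable M k"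
  shows "koopman_dist M (X' \<otimes>\<^bsub>Gms M\<^esub> Y') (X \<otimes>\<^bsub>Gms M\<^esub> Y) k
    \<le> koopman_dist M X' X k
      + koopman_dist M Y' Y (class_koopman M X k)"
proof -
  interpret G: group "Gms M" by (rule group_Gms)
  note u = class_koopman_integrable[OF X(1) k] and u' = class_koopman_integrable[OF X(2) k]
  note K = class_koopman_integrable
  have "koopman_dist M (X' \<otimes>\<^bsub>Gms M\<^esub> Y') (X \<otimes>\<^bsub>Gms M\<^esub> Y) k
      = L1_dist M (class_koopman M Y' (class_koopman M X' k)) (class_koopman M Y (class_koopman M X k))"
    by (rule L1_dist_cong_AE[OF _ _ _ _ class_koopman_mult[OF X(2) Y(2)] class_koopman_mult[OF X(1) Y(1)]])
       (intro borel_measurable_integrable K G.m_closed X Y k u u')+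
  also have "\<dots> \<le> L1_dist M (class_koopman M Y' (class_koopman M X' k)) (class_koopman M Y' (class_koopman M X k))
      + koopman_dist M Y' Y (class_koopman M X k)"
    by (rule L1_dist_triangle[OF K[OF Y(2) u'] K[OF Y(2) u] K[OF Y(1) u]])
  finally show ?thesis unfolding class_koopman_isometry[OF Y(2) u' u] .
qed

text \<open>Apply the isometric operator of \<open>Y\<close> to both sides and cancel operators of inverse elements. The
  vector on the right does not depend on \<open>Y\<close>, so inversion is continuous at \<open>X\<close>.\<close>

lemma L1_dist_class_koopman_inv:
  assumes X: "X \<in> carrier (Gms M)" and Y: "Y \<in> carrier (Gms M)" and k: "integrable M k"
  shows "koopman_dist M (inv\<^bsub>Gms M\<^esub> Y) (inv\<^bsub>Gms M\<^esub> X) k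
    = koopman_dist M X Y (class_koopman M (inv\<^bsub>Gms M\<^esub> X) k)"
proof -
  interpret G: group "Gms M" by (rule group_Gms)
  have inv_cancel: "AE x in M. class_koopman M Z (class_koopman M (inv\<^bsub>Gms M\<^esub> Z) k) x = k x"
    if Z: "Z \<in> carrier (Gms M)" for Z
    using class_koopman_mult[OF G.inv_closed[OF Z] Z, of k] class_koopman_one[of k] Z
    by (simp add: G.l_inv) (elim AE_mp, auto)
  let ?u = "class_koopman M (inv\<^bsub>Gms M\<^esub> X) k" and ?v = "class_koopman M (inv\<^bsub>Gms M\<^esub> Y) k"
  have int: "integrable M ?u" "integrable M ?v" using X Y k by (auto intro: class_koopman_integrable)
  have "L1_dist M ?v ?u = L1_dist M (class_koopman M Y ?v) (class_koopman M Y ?u)"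
    by (rule class_koopman_isometry[symmetric, OF Y int(2,1)])
  also have "\<dots> = koopman_dist M X Y ?u"
  proof (rule L1_dist_cong_AE)
    show "AE x in M. class_koopman M Y ?v x = class_koopman M X ?u x"
      using inv_cancel[OF X] inv_cancel[OF Y] by eventually_elim simp
  qed (use int X Y in \<open>auto intro!: borel_measurable_integrable class_koopman_integrable\<close>)
  finally show ?thesis .
qed

section \<open>Integrals against the distributions of derivatives\<close>

lemma kappa_support:
  assumes g: "g \<in> gms_maps M" and A[measurable]: "A \<in> sets M" and B[measurable]: "B \<in> sets M"
  shows "{x\<in>A. g x \<in> B \<and> 0 < gms_deriv M g x} \<in> sets M"
    and "gms_deriv M g \<in> measurable (restrict_space M {x\<in>A. g x \<in> B \<and> 0 < gms_deriv M g x})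
      (restrict_space borel {0<..})"
proof -
  note [measurable] = nonsingular_measurable[OF gms_nonsingular[OF g]]
  have "{x\<in>A. g x \<in> B \<and> 0 < gms_deriv M g x}
      = {x\<in>space M. x \<in> A \<and> g x \<in> B \<and> 0 < gms_deriv M g x}"
    using sets.sets_into_space[OF A] by auto
  also have "\<dots> \<in> sets M" by measurable
  finally show "{x\<in>A. g x \<in> B \<and> 0 < gms_deriv M g x} \<in> sets M" .
  show "gms_deriv M g \<in> measurable (restrict_space M {x\<in>A. g x \<in> B \<and> 0 < gms_deriv M g x})
      (restrict_space borel {0<..})"
    by (rule measurable_restrict_space3) auto
qed

lemma kappa_map_eq_distr:
  assumes g: "g \<in> gms_maps M" and A: "A \<in> sets M" and B: "B \<in> sets M"
  shows "kappa_map M g A B =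
    distr (restrict_space M {x\<in>A. g x \<in> B \<and> 0 < gms_deriv M g x})
      (restrict_space borel {0<..}) (gms_deriv M g)"
    (is "_ = distr (restrict_space M ?S) ?R _")
proof (rule measure_eqI)
  note S = kappa_support(1)[OF g A B] and m = kappa_support(2)[OF g A B]
  have sub: "?S \<subseteq> space M" using sets.sets_into_space[OF A] by auto
  fix E assume "E \<in> sets (kappa_map M g A B)"
  then have E: "E \<in> sets ?R" by simp
  then have E': "E \<subseteq> {0<..}" by (auto simp: sets_restrict_space)
  have "emeasure (distr (restrict_space M ?S) ?R (gms_deriv M g)) E
      = emeasure (restrict_space M ?S) (gms_deriv M g -` E \<inter> space (restrict_space M ?S))"
    by (rule emeasure_distr[OF m E])
  also have "\<dots> = emeasure M (gms_deriv M g -` E \<inter> space (restrict_space M ?S))"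
    by (rule emeasure_restrict_space) (use S in \<open>auto simp: space_restrict_space\<close>)
  also have "gms_deriv M g -` E \<inter> space (restrict_space M ?S)
      = {x \<in> A \<inter> (g -` B \<inter> space M). gms_deriv M g x \<in> E}"
    using E' sub by (auto simp: space_restrict_space)
  finally show "emeasure (kappa_map M g A B) E
      = emeasure (distr (restrict_space M ?S) ?R (gms_deriv M g)) E"
    using emeasure_kappa_map[OF g A B E] by simp
qed simp

text \<open>The factor \<open>indicator {0<..}\<close> makes the integrand measurable, whatever the values of
  the test function outside its domain.\<close>

lemma
  fixes \<phi> :: "real \<Rightarrow> real"
  assumes g: "g \<in> gms_maps M" and A: "A \<in> sets M" and B: "B \<in> sets M"
    and \<phi>: "continuous_on {0<..} \<phi>"
  shows integral_kappa_map: "(\<integral>t. \<phi> t \<partial>kappa_map M g A B) =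
      (\<integral>x. indicator A x * indicator B (g x) *
        (indicator {0<..} (gms_deriv M g x) * \<phi> (gms_deriv M g x)) \<partial>M)"
    and integral_density_kappa_map: "(\<integral>t. \<phi> t \<partial>density (kappa_map M g A B) ennreal) =
      (\<integral>x. indicator A x * (indicator {0<..} (gms_deriv M g x) * \<phi> (gms_deriv M g x)) *
        koopman M g (indicator B) x \<partial>M)"
proof -
  note [measurable] = A B nonsingular_measurable[OF gms_nonsingular[OF g]]
  let ?S = "{x\<in>A. g x \<in> B \<and> 0 < gms_deriv M g x}"
  let ?R = "restrict_space borel {0::real<..}"
  note S = kappa_support(1)[OF g A B] and m = kappa_support(2)[OF g A B]
  have *: "(\<integral>t. \<psi> t \<partial>kappa_map M g A B) = (\<integral>x. indicator ?S x * \<psi> (gms_deriv M g x) \<partial>M)"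
    if \<psi>: "\<psi> \<in> borel_measurable ?R" for \<psi> :: "real \<Rightarrow> real"
  proof -
    have "(\<integral>t. \<psi> t \<partial>kappa_map M g A B) = (\<integral>x. \<psi> (gms_deriv M g x) \<partial>restrict_space M ?S)"
      unfolding kappa_map_eq_distr[OF g A B] by (rule integral_distr[OF m \<psi>])
    also have "\<dots> = (\<integral>x. indicator ?S x *\<^sub>R \<psi> (gms_deriv M g x) \<partial>M)"
      by (rule integral_restrict_space) (use S in simp)
    finally show ?thesis by simp
  qed
  have \<phi>m: "\<phi> \<in> borel_measurable ?R" by (rule borel_measurable_continuous_on_restrict[OF \<phi>])
  have im: "(\<lambda>t::real. t) \<in> borel_measurable ?R" by (rule measurable_restrict_space1) simp
  show "(\<integral>t. \<phi> t \<partial>kappa_map M g A B) =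
      (\<integral>x. indicator A x * indicator B (g x) *
        (indicator {0<..} (gms_deriv M g x) * \<phi> (gms_deriv M g x)) \<partial>M)"
    unfolding *[OF \<phi>m] by (rule Bochner_Integration.integral_cong) (auto simp: indicator_def)
  have km: "measurable (kappa_map M g A B) borel = borel_measurable ?R"
    by (rule measurable_cong_sets) auto
  have "(\<integral>t. \<phi> t \<partial>density (kappa_map M g A B) ennreal) = (\<integral>t. t *\<^sub>R \<phi> t \<partial>kappa_map M g A B)"
  proof (rule integral_density)
    have "space (kappa_map M g A B) = {0<..}"
      using sets_eq_imp_space_eq[OF sets_kappa_map] by (simp add: space_restrict_space)
    then show "AE t in kappa_map M g A B. 0 \<le> t" by (intro AE_I2) auto
  qed (use \<phi>m im km in auto)
  also have "\<dots> = (\<integral>t. t * \<phi> t \<partial>kappa_map M g A B)" by simp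
  also have "\<dots> = (\<integral>x. indicator ?S x * (gms_deriv M g x * \<phi> (gms_deriv M g x)) \<partial>M)"
    by (rule *) (use \<phi>m im in measurable)
  also have "\<dots> = (\<integral>x. indicator A x * (indicator {0<..} (gms_deriv M g x) * \<phi> (gms_deriv M g x)) *
        koopman M g (indicator B) x \<partial>M)"
    by (rule Bochner_Integration.integral_cong)
       (auto simp: indicator_def koopman_def weighted_comp_def)
  finally show "(\<integral>t. \<phi> t \<partial>density (kappa_map M g A B) ennreal) =
      (\<integral>x. indicator A x * (indicator {0<..} (gms_deriv M g x) * \<phi> (gms_deriv M g x)) *
        koopman M g (indicator B) x \<partial>M)" .
qed

lemma kappa_map_finite_measure:
  assumes g: "g \<in> gms_maps M" and A: "A \<in> sets M" and B: "B \<in> sets M"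
  shows "kappa_map M g A B \<in> finite_measures_on {0<..}"
    and "density (kappa_map M g A B) ennreal \<in> finite_measures_on {0<..}"
proof -
  note [measurable] = A B nonsingular_measurable[OF gms_nonsingular[OF g]]
  let ?S = "{x\<in>A. g x \<in> B \<and> 0 < gms_deriv M g x}"
  let ?R = "restrict_space borel {0::real<..}"
  note S = kappa_support(1)[OF g A B] and m = kappa_support(2)[OF g A B]
  have space: "space (kappa_map M g A B) = {0<..}"
    using sets_eq_imp_space_eq[OF sets_kappa_map] by (simp add: space_restrict_space)
  have top: "{0<..} \<in> sets ?R" by (auto simp: sets_restrict_space)
  have "emeasure (kappa_map M g A B) {0<..} \<noteq> \<infinity>"
    unfolding emeasure_kappa_map[OF g A B top] by simp
  then show "kappa_map M g A B \<in> finite_measures_on {0<..}"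
    by (auto simp: finite_measures_on_def space intro!: finite_measureI)
  have km: "measurable (kappa_map M g A B) borel = borel_measurable ?R"
    by (rule measurable_cong_sets) auto
  have em: "ennreal \<in> borel_measurable ?R" by (rule measurable_restrict_space1) simp
  have "emeasure (density (kappa_map M g A B) ennreal) {0<..} = (\<integral>\<^sup>+t. ennreal t \<partial>kappa_map M g A B)"
    using em top km space
    by (subst emeasure_density) (auto intro!: nn_integral_cong simp: space)
  also have "\<dots> = (\<integral>\<^sup>+x. ennreal (gms_deriv M g x) \<partial>restrict_space M ?S)"
    unfolding kappa_map_eq_distr[OF g A B] by (rule nn_integral_distr[OF m]) (simp add: em)
  also have "\<dots> = (\<integral>\<^sup>+x. ennreal (gms_deriv M g x) * indicator ?S x \<partial>M)"
    by (rule nn_integral_restrict_space) (use S in simp)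
  also have "\<dots> \<le> (\<integral>\<^sup>+x. 1 * ennreal (gms_deriv M g x) \<partial>M)"
    by (rule nn_integral_mono) (auto simp: indicator_def)
  also have "\<dots> = (\<integral>\<^sup>+x. 1 \<partial>M)"
    by (rule transfer_pair_nn_integral[OF gms_transfer_pair[OF prob_space_axioms g]]) simp
  also have "\<dots> = 1" by (simp add: emeasure_space_1)
  finally have "emeasure (density (kappa_map M g A B) ennreal) {0<..} \<le> 1" .
  also have "1 < (\<infinity>::ennreal)" by simp
  finally have "emeasure (density (kappa_map M g A B) ennreal) {0<..} \<noteq> \<infinity>"
    by (rule less_imp_neq)
  then have "finite_measure (density (kappa_map M g A B) ennreal)"
    by (intro finite_measureI) (simp only: space_density space not_False_eq_True)
  then show "density (kappa_map M g A B) ennreal \<in> finite_measures_on {0<..}"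
    by (simp only: finite_measures_on_def mem_Collect_eq space_density space sets_density sets_kappa_map simp_thms)
qed

section \<open>The topology is the strong operator topology\<close>

lemma openin_Gms_topology_integral_kappa:
  fixes \<phi> :: "real \<Rightarrow> real"
  assumes A: "A \<in> sets M" and B: "B \<in> sets M"
    and \<phi>: "continuous_on {0<..} \<phi>" "bounded (\<phi> ` {0<..})" and "open U"
  shows "openin (Gms_topology M) {X\<in>carrier (Gms M). (\<integral>t. \<phi> t \<partial>kappa M X A B) \<in> U}"
proof -
  let ?W = "{N \<in> finite_measures_on {0<..}. (\<integral>t. \<phi> t \<partial>N) \<in> U}"
  have "openin (weak_topology_on {0<..}) ?W"
    unfolding weak_topology_on_def
    by (rule topology_generated_by_Basis, rule CollectI, rule exI[of _ \<phi>], rule exI[of _ U])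
       (simp add: assms)
  then have "openin (Gms_topology M) {X\<in>carrier (Gms M). kappa M X A B \<in> ?W}"
    unfolding Gms_topology_def
    by (intro topology_generated_by_Basis UnI1 CollectI exI[of _ A] exI[of _ B] exI[of _ ?W] conjI refl A B)
  also have "{X\<in>carrier (Gms M). kappa M X A B \<in> ?W}
      = {X\<in>carrier (Gms M). (\<integral>t. \<phi> t \<partial>kappa M X A B) \<in> U}"
    using kappa_map_finite_measure(1)[OF gms_rep(1) A B] by (auto simp: kappa_def gms_rep_def)
  finally show ?thesis .
qed

lemma topspace_weak_topology [simp]: "topspace (weak_topology_on X) = finite_measures_on X"
proof
  show "topspace (weak_topology_on X) \<subseteq> finite_measures_on X"
    unfolding weak_topology_on_def topology_generated_by_topspace by (rule Union_least) auto
  have "openin (weak_topology_on X) {N \<in> finite_measures_on X. (\<integral>t. 0 \<partial>N) \<in> (UNIV :: real set)}"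
    unfolding weak_topology_on_def
    by (rule topology_generated_by_Basis, rule CollectI, rule exI[of _ "\<lambda>_. 0"], rule exI[of _ UNIV])
       (simp add: image_constant_conv)
  from openin_subset[OF this] show "finite_measures_on X \<subseteq> topspace (weak_topology_on X)" by simp
qed

lemma topspace_Gms_topology [simp]: "topspace (Gms_topology M) = carrier (Gms M)"
proof
  have "openin (Gms_topology M) {X\<in>carrier (Gms M). (\<integral>t. (\<lambda>_. 0) t \<partial>kappa M X {} {}) \<in> (UNIV :: real set)}"
    by (rule openin_Gms_topology_integral_kappa[of "{}" "{}" "\<lambda>_. 0" UNIV])
       (simp_all add: image_constant_conv)
  from openin_subset[OF this] show "carrier (Gms M) \<subseteq> topspace (Gms_topology M)" by simp
  show "topspace (Gms_topology M) \<subseteq> carrier (Gms M)"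
    unfolding Gms_topology_def topology_generated_by_topspace by (rule Union_least) auto
qed

lemma limitin_Gms_in_carrier:
  assumes "limitin (Gms_topology M) s X F"
  shows "X \<in> carrier (Gms M)" "\<forall>\<^sub>F i in F. s i \<in> carrier (Gms M)"
proof -
  have X: "X \<in> topspace (Gms_topology M)" by (rule limitin_topspace[OF assms])
  then show "X \<in> carrier (Gms M)" by simp
  show "\<forall>\<^sub>F i in F. s i \<in> carrier (Gms M)"
    using limitinD[OF assms openin_topspace X] by simp
qed

lemma limitin_Gms_integral_kappa:
  fixes \<phi> :: "real \<Rightarrow> real"
  assumes lim: "limitin (Gms_topology M) s X F"
    and "A \<in> sets M" "B \<in> sets M" "continuous_on {0<..} \<phi>" "bounded (\<phi> ` {0<..})"
  shows "((\<lambda>i. \<integral>t. \<phi> t \<partial>kappa M (s i) A B) \<longlongrightarrow> (\<integral>t. \<phi> t \<partial>kappa M X A B)) F"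
proof (rule topological_tendstoI)
  fix U assume U: "open U" "(\<integral>t. \<phi> t \<partial>kappa M X A B) \<in> U"
  have "\<forall>\<^sub>F i in F. s i \<in> {X\<in>carrier (Gms M). (\<integral>t. \<phi> t \<partial>kappa M X A B) \<in> U}"
    by (rule limitinD[OF lim openin_Gms_topology_integral_kappa[OF assms(2-5) U(1)]])
       (use U limitin_Gms_in_carrier[OF lim] in simp)
  then show "\<forall>\<^sub>F i in F. (\<integral>t. \<phi> t \<partial>kappa M (s i) A B) \<in> U" by eventually_elim simp
qed

lemma integrable_indicator_event: "B \<in> sets M \<Longrightarrow> integrable M (indicator B :: 'a \<Rightarrow> real)"
  by (rule integrable_real_indicator) (simp_all add: less_top[symmetric])

text \<open>Nonnegative functions of equal integral satisfy
  \<open>\<integral>\<bar>a - b\<bar> = 2 * (\<integral>b - \<integral>min a b)\<close>. When \<open>a\<close> is the image of the indicator of \<open>B\<close> and \<open>b\<close> is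
  replaced by a step function, the last integral is a sum of integrals of the bounded continuous
  functions \<open>\<lambda>t. min t y\<close> against the measures \<open>\<kappa>\<close>.\<close>

lemma limitin_Gms_imp_koopman_indicator:
  assumes lim: "limitin (Gms_topology M) s X F" and B[measurable]: "B \<in> sets M"
  shows "((\<lambda>i. koopman_dist M (s i) X (indicator B))
    \<longlongrightarrow> 0) F"
proof -
  note X = limitin_Gms_in_carrier(1)[OF lim] and s = limitin_Gms_in_carrier(2)[OF lim]
  define a where "a Y = class_koopman M Y (indicator B)" for Y
  have a0: "0 \<le> a Y x" for Y x
    by (simp add: a_def class_koopman_def koopman_def weighted_comp_def gms_deriv_nonneg)
  have iB: "integrable M (indicator B :: 'a \<Rightarrow> real)" by (rule integrable_indicator_event[OF B])
  have ai: "integrable M (a Y)" if "Y \<in> carrier (Gms M)" for Y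
    unfolding a_def by (rule class_koopman_integrable[OF that iB])
  have aint: "(\<integral>x. a Y x \<partial>M) = measure M B" if Y: "Y \<in> carrier (Gms M)" for Y
    unfolding a_def class_koopman_def koopman_def
    by (subst weighted_comp_integral[OF gms_transfer_pair[OF prob_space_axioms gms_rep(1)[OF Y]]]) auto
  define \<Phi> where "\<Phi> Y f = (\<integral>x. min (a Y x) (f x) \<partial>M)" for Y f
  have min_le: "\<bar>\<Phi> Y f - \<Phi> Y f'\<bar> \<le> L1_dist M f f'"
    if "Y \<in> carrier (Gms M)" "integrable M f" "integrable M f'" for Y f f'
  proof -
    have "\<bar>\<Phi> Y f - \<Phi> Y f'\<bar> \<le> L1_dist M (\<lambda>x. min (a Y x) (f x)) (\<lambda>x. min (a Y x) (f' x))"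
      unfolding \<Phi>_def by (rule abs_integral_diff_le_L1_dist) (use that ai in auto)
    also have "\<dots> \<le> L1_dist M f f'"
      unfolding L1_dist_def by (rule integral_mono) (use that ai in auto)
    finally show ?thesis .
  qed
  have step: "((\<lambda>i. \<Phi> (s i) f) \<longlongrightarrow> \<Phi> X f) F" if f: "simple_function M f" "\<And>x. 0 \<le> f x" for f
  proof -
    have fin: "finite (f ` space M)" using f(1) by (simp add: simple_function_def)
    define A where "A y = f -` {y} \<inter> space M" for y
    have Am[measurable]: "A y \<in> sets M" for y
      unfolding A_def by (rule simple_functionD(2)[OF f(1)])
    have y0: "0 \<le> y" if "y \<in> f ` space M" for y using that f(2) by auto
    have cont: "continuous_on {0<..} (\<lambda>t. min t y)" for y :: real by (intro continuous_intros)
    have bdd: "bounded ((\<lambda>t. min t y) ` {0<..})" if "0 \<le> y" for y :: real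
      by (rule boundedI[of _ y]) (use that in auto)
    have \<Phi>_eq: "\<Phi> Y f = (\<Sum>y\<in>f ` space M. \<integral>t. min t y \<partial>kappa M Y (A y) B)"
      if Y: "Y \<in> carrier (Gms M)" for Y
    proof -
      let ?h = "gms_rep Y"
      note h = gms_rep(1)[OF Y]
      have "\<Phi> Y f = (\<integral>x. (\<Sum>y\<in>f ` space M. indicator (A y) x * min (a Y x) y) \<partial>M)"
        unfolding \<Phi>_def
      proof (rule Bochner_Integration.integral_cong)
        fix x assume x: "x \<in> space M"
        have "(\<Sum>y\<in>f ` space M. indicator (A y) x * min (a Y x) y)
            = (\<Sum>y\<in>f ` space M. if y = f x then min (a Y x) (f x) else 0)"
          by (rule sum.cong) (use x in \<open>auto simp: A_def indicator_def\<close>)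
        also have "\<dots> = min (a Y x) (f x)" using fin x by simp
        finally show "min (a Y x) (f x) = (\<Sum>y\<in>f ` space M. indicator (A y) x * min (a Y x) y)" ..
      qed simp
      also have "\<dots> = (\<Sum>y\<in>f ` space M. \<integral>x. indicator (A y) x * min (a Y x) y \<partial>M)"
      proof (rule Bochner_Integration.integral_sum)
        have "integrable M (\<lambda>x. min (a Y x) y)" for y using ai[OF Y] by simp
        from integrable_mult_indicator[OF Am this]
        show "integrable M (\<lambda>x. indicator (A y) x * min (a Y x) y)" for y by simp
      qed
      also have "\<dots> = (\<Sum>y\<in>f ` space M. \<integral>t. min t y \<partial>kappa M Y (A y) B)"
      proof (rule sum.cong)
        fix y assume "y \<in> f ` space M"
        then have "0 \<le> y" by (rule y0)
        have "(\<integral>t. min t y \<partial>kappa M Y (A y) B) = (\<integral>x. indicator (A y) x * indicator B (?h x) *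
            (indicator {0<..} (gms_deriv M ?h x) * min (gms_deriv M ?h x) y) \<partial>M)"
          using integral_kappa_map[OF h Am B cont] by (simp add: kappa_def gms_rep_def)
        also have "\<dots> = (\<integral>x. indicator (A y) x * min (a Y x) y \<partial>M)"
          by (rule Bochner_Integration.integral_cong)
             (use \<open>0 \<le> y\<close> gms_deriv_nonneg[of M ?h] in \<open>auto simp: indicator_def a_def class_koopman_def
                koopman_def weighted_comp_def not_less intro: antisym\<close>)
        finally show "(\<integral>x. indicator (A y) x * min (a Y x) y \<partial>M) = (\<integral>t. min t y \<partial>kappa M Y (A y) B)" ..
      qed simp
      finally show ?thesis .
    qed
    have "((\<lambda>i. \<Sum>y\<in>f ` space M. \<integral>t. min t y \<partial>kappa M (s i) (A y) B) \<longlongrightarrow> \<Phi> X f) F"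
      unfolding \<Phi>_eq[OF X]
      by (intro tendsto_sum limitin_Gms_integral_kappa[OF lim Am B cont bdd] y0)
    then show ?thesis
      by (rule Lim_transform_eventually) (use s in \<open>eventually_elim, simp add: \<Phi>_eq\<close>)
  qed
  have "((\<lambda>i. \<Phi> (s i) (a X)) \<longlongrightarrow> \<Phi> X (a X)) F"
  proof (rule tendstoI)
    fix e :: real assume e: "e > 0"
    obtain u where u: "\<And>n::nat. simple_function M (u n)"
      "\<And>x. x \<in> space M \<Longrightarrow> (\<lambda>n. u n x) \<longlonglongrightarrow> a X x"
      "\<And>n x. x \<in> space M \<Longrightarrow> dist (u n x) 0 \<le> 2 * dist (a X x) 0"
      using borel_measurable_implies_sequence_metric[OF borel_measurable_integrable[OF ai[OF X]], of 0]
      by blast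
    define f where "f n x = \<bar>u n x\<bar>" for n x
    have f: "simple_function M (f n)" "0 \<le> f n x" for n x
      using simple_function_compose1[OF u(1), of abs n] by (simp_all add: f_def[abs_def])
    have fl: "(\<lambda>n. f n x) \<longlonglongrightarrow> a X x" and fb: "\<bar>f n x\<bar> \<le> 2 * a X x" if "x \<in> space M" for n x
    proof -
      have "(\<lambda>n. f n x) \<longlonglongrightarrow> \<bar>a X x\<bar>" unfolding f_def by (rule tendsto_rabs[OF u(2)[OF that]])
      then show "(\<lambda>n. f n x) \<longlonglongrightarrow> a X x" using a0[of X x] by simp
      show "\<bar>f n x\<bar> \<le> 2 * a X x" using u(3)[OF that, of n] a0[of X x] by (simp add: f_def)
    qed
    have dom: "integrable M (\<lambda>x. 2 * a X x)" using ai[OF X] by simp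
    have fi: "integrable M (f n)" for n
    proof (rule Bochner_Integration.integrable_bound[OF dom])
      show "f n \<in> borel_measurable M" by (rule borel_measurable_simple_function[OF f(1)])
      show "AE x in M. norm (f n x) \<le> norm (2 * a X x)"
        by (intro AE_I2) (use fb a0 in force)
    qed
    have "(\<lambda>n. L1_dist M (f n) (a X)) \<longlonglongrightarrow> 0"
      by (rule L1_dist_tendsto_dominated[OF _ _ dom]) (use fl fb ai[OF X] fi in auto)
    then have "\<forall>\<^sub>F n in sequentially. L1_dist M (f n) (a X) < e / 3"
      using order_tendstoD(2)[of _ 0 sequentially "e/3"] e by simp
    then obtain n where n: "L1_dist M (f n) (a X) < e / 3" by (auto simp: eventually_sequentially)
    have "\<forall>\<^sub>F i in F. dist (\<Phi> (s i) (f n)) (\<Phi> X (f n)) < e / 3"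
      using tendstoD[OF step[OF f], of "e/3"] e by simp
    then show "\<forall>\<^sub>F i in F. dist (\<Phi> (s i) (a X)) (\<Phi> X (a X)) < e"
      using s
    proof eventually_elim
      fix i assume d: "dist (\<Phi> (s i) (f n)) (\<Phi> X (f n)) < e / 3" and i: "s i \<in> carrier (Gms M)"
      note m = min_le[OF i fi[of n] ai[OF X]] min_le[OF X fi[of n] ai[OF X]]
      show "dist (\<Phi> (s i) (a X)) (\<Phi> X (a X)) < e"
        using d m n unfolding dist_real_def by (simp only: abs_le_iff abs_less_iff) linarith
    qed
  qed
  moreover have "\<Phi> X (a X) = measure M B" using aint[OF X] by (simp add: \<Phi>_def)
  ultimately have lim0: "((\<lambda>i. 2 * (measure M B - \<Phi> (s i) (a X))) \<longlongrightarrow> 2 * (measure M B - measure M B)) F"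
    by (intro tendsto_intros) simp
  have dist: "2 * (measure M B - \<Phi> Y (a X)) = L1_dist M (a Y) (a X)" if Y: "Y \<in> carrier (Gms M)" for Y
  proof -
    have "L1_dist M (a Y) (a X) = (\<integral>x. a Y x + a X x - 2 * min (a Y x) (a X x) \<partial>M)"
      unfolding L1_dist_def by (rule Bochner_Integration.integral_cong) auto
    also have "\<dots> = (\<integral>x. a Y x \<partial>M) + (\<integral>x. a X x \<partial>M) - 2 * \<Phi> Y (a X)"
      using ai[OF X] ai[OF Y] by (simp add: \<Phi>_def)
    finally show ?thesis using aint[OF X] aint[OF Y] by simp
  qed
  have "((\<lambda>i. L1_dist M (a (s i)) (a X)) \<longlongrightarrow> 2 * (measure M B - measure M B)) F"
    by (rule Lim_transform_eventually[OF lim0 eventually_mono[OF s dist]])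
  then show ?thesis by (simp add: a_def)
qed

lemma limitin_Gms_imp_koopman:
  assumes lim: "limitin (Gms_topology M) s X F" and k: "integrable M k"
  shows "((\<lambda>i. koopman_dist M (s i) X k) \<longlongrightarrow> 0) F"
proof -
  note X = limitin_Gms_in_carrier(1)[OF lim] and s = limitin_Gms_in_carrier(2)[OF lim]
  have T: "\<forall>\<^sub>F i in F. transfer_pair M (gms_rep (s i)) (gms_deriv M (gms_rep (s i)))"
    using s by eventually_elim (rule gms_transfer_pair[OF prob_space_axioms gms_rep(1)])
  have T': "\<forall>\<^sub>F i in F. transfer_pair M (gms_rep X) (gms_deriv M (gms_rep X))"
    by (intro always_eventually allI gms_transfer_pair[OF prob_space_axioms gms_rep(1)[OF X]])
  show ?thesis
    using limitin_Gms_imp_koopman_indicator[OF lim]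
      L1_closed_subspace_integrable[OF weighted_comp_limit_closed_subspace[OF T T'] _ k]
    by (simp add: class_koopman_def koopman_def)
qed

lemma integral_tendsto_bounded_mult_L1:
  fixes p :: "nat \<Rightarrow> 'a \<Rightarrow> real"
  assumes u: "\<And>n. integrable M (u n)" "integrable M u'" "(\<lambda>n. L1_dist M (u n) u') \<longlonglongrightarrow> 0"
    and [measurable]: "\<And>n. p n \<in> borel_measurable M" "p' \<in> borel_measurable M"
    and p: "\<And>n x. \<bar>p n x\<bar> \<le> C" "AE x in M. (\<lambda>n. p n x) \<longlonglongrightarrow> p' x"
  shows "(\<lambda>n. \<integral>x. p n x * u n x \<partial>M) \<longlonglongrightarrow> (\<integral>x. p' x * u' x \<partial>M)"
proof -
  have [measurable]: "u n \<in> borel_measurable M" "u' \<in> borel_measurable M" for n using u by auto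
  have C: "0 \<le> C" using p(1)[of 0 undefined] by linarith
  have bd: "\<bar>p n x * v x\<bar> \<le> C * \<bar>v x\<bar>" for n x and v :: "'a \<Rightarrow> real"
    using p(1)[of n x] by (simp add: abs_mult mult_right_mono)
  have int: "integrable M (\<lambda>x. p n x * v x)" if "integrable M v" for n v
    by (rule Bochner_Integration.integrable_bound[of _ "\<lambda>x. C * \<bar>v x\<bar>"])
       (use that bd[of n _ v] C in \<open>auto simp: abs_mult\<close>)
  have dom: "(\<lambda>n. \<integral>x. p n x * u' x \<partial>M) \<longlonglongrightarrow> (\<integral>x. p' x * u' x \<partial>M)"
  proof (rule integral_dominated_convergence)
    show "integrable M (\<lambda>x. C * \<bar>u' x\<bar>)" using u by simp
    show "AE x in M. (\<lambda>n. p n x * u' x) \<longlonglongrightarrow> p' x * u' x"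
      using p(2) by eventually_elim (intro tendsto_intros)
  qed (use bd in auto)
  have "(\<lambda>n. (\<integral>x. p n x * u n x \<partial>M) - (\<integral>x. p n x * u' x \<partial>M)) \<longlonglongrightarrow> 0"
  proof (rule tendsto_rabs_zero_cancel, rule tendsto_sandwich[OF _ _ tendsto_const])
    show "(\<lambda>n. C * L1_dist M (u n) u') \<longlonglongrightarrow> 0" using tendsto_mult_right_zero[OF u(3)] .
    have "\<bar>(\<integral>x. p n x * u n x \<partial>M) - (\<integral>x. p n x * u' x \<partial>M)\<bar> \<le> C * L1_dist M (u n) u'" for n
    proof -
      have "\<bar>(\<integral>x. p n x * u n x \<partial>M) - (\<integral>x. p n x * u' x \<partial>M)\<bar>
          \<le> L1_dist M (\<lambda>x. p n x * u n x) (\<lambda>x. p n x * u' x)"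
        by (rule abs_integral_diff_le_L1_dist) (use int u in auto)
      also have "\<dots> \<le> (\<integral>x. C * \<bar>u n x - u' x\<bar> \<partial>M)"
        unfolding L1_dist_def
        by (rule integral_mono) (use int u bd[of n _ "\<lambda>x. u n x - u' x"] in \<open>auto simp: right_diff_distrib\<close>)
      finally show ?thesis using u by (simp add: L1_dist_def)
    qed
    then show "\<forall>\<^sub>F n in sequentially. \<bar>(\<integral>x. p n x * u n x \<partial>M) - (\<integral>x. p n x * u' x \<partial>M)\<bar>
        \<le> C * L1_dist M (u n) u'" by simp
  qed simp
  from tendsto_add[OF this dom] show ?thesis by simp
qed

text \<open>Along a subsequence the derivatives and the images of the indicator of \<open>B\<close> converge almost
  everywhere. As derivatives are positive, their quotients converge as well.\<close>

lemma koopman_convergence_imp_integral_kappa: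
  fixes s :: "nat \<Rightarrow> ('a \<Rightarrow> 'a) set" and \<phi> :: "real \<Rightarrow> real"
  assumes s: "\<And>n. s n \<in> carrier (Gms M)" and X: "X \<in> carrier (Gms M)"
    and conv: "\<And>k. integrable M k \<Longrightarrow>
      (\<lambda>n. koopman_dist M (s n) X k) \<longlonglongrightarrow> 0"
    and A[measurable]: "A \<in> sets M" and B[measurable]: "B \<in> sets M"
    and \<phi>: "continuous_on {0<..} \<phi>" "bounded (\<phi> ` {0<..})"
  shows "(\<lambda>n. \<integral>t. \<phi> t \<partial>kappa M (s n) A B) \<longlonglongrightarrow> (\<integral>t. \<phi> t \<partial>kappa M X A B)"
    and "(\<lambda>n. \<integral>t. \<phi> t \<partial>density (kappa M (s n) A B) ennreal)
      \<longlonglongrightarrow> (\<integral>t. \<phi> t \<partial>density (kappa M X A B) ennreal)"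
proof -
  obtain C where C: "\<And>t. t > 0 \<Longrightarrow> \<bar>\<phi> t\<bar> \<le> C"
    using \<phi>(2) by (auto simp: bounded_iff)
  have C0: "0 \<le> C" using C[of 1] by linarith
  define \<psi> where "\<psi> t = indicator {0<..} t * \<phi> t" for t
  have \<psi>m[measurable]: "\<psi> \<in> borel_measurable borel"
    using borel_measurable_continuous_on_indicator[OF _ \<phi>(1)] by (simp add: \<psi>_def[abs_def])
  have \<psi>b: "\<bar>\<psi> t\<bar> \<le> C" for t using C[of t] C0 by (auto simp: \<psi>_def indicator_def)
  have \<psi>c: "(\<lambda>n. \<psi> (t n)) \<longlonglongrightarrow> \<psi> l" if t: "t \<longlonglongrightarrow> l" and l: "0 < l" for t l
  proof -
    have "continuous (at l) \<phi>" using \<phi>(1) l by (simp add: continuous_on_eq_continuous_at)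
    then have "(\<lambda>n. \<phi> (t n)) \<longlonglongrightarrow> \<phi> l" using t isCont_tendsto_compose by blast
    then have "(\<lambda>n. \<phi> (t n)) \<longlonglongrightarrow> \<psi> l" using l by (simp add: \<psi>_def)
    then show ?thesis
      by (rule Lim_transform_eventually)
         (use order_tendstoD(1)[OF t l] in \<open>eventually_elim, simp add: \<psi>_def\<close>)
  qed
  let ?h = "\<lambda>n. gms_rep (s n)" and ?g = "gms_rep X"
  let ?d = "\<lambda>n. gms_deriv M (?h n)" and ?d' = "gms_deriv M ?g"
  note h = gms_rep(1)[OF s] and g = gms_rep(1)[OF X]
  have [measurable]: "?h n \<in> measurable M M" "?g \<in> measurable M M" for n
    by (rule nonsingular_measurable[OF gms_nonsingular[OF h]]
        nonsingular_measurable[OF gms_nonsingular[OF g]])+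
  have iB: "integrable M (indicator B :: 'a \<Rightarrow> real)" and i1: "integrable M (\<lambda>_. 1 :: real)"
    using integrable_indicator_event[OF B] by auto
  note ki = class_koopman_integrable[OF s] class_koopman_integrable[OF X]
  have sub: "\<exists>q. strict_mono q \<and> (AE x in M. (\<lambda>n. ?d (r (q n)) x) \<longlonglongrightarrow> ?d' x \<and>
      (\<lambda>n. indicator B (?h (r (q n)) x) :: real) \<longlonglongrightarrow> indicator B (?g x) \<and> 0 < ?d' x)"
    if r: "strict_mono r" for r :: "nat \<Rightarrow> nat"
  proof -
    have c: "(\<lambda>n. koopman_dist M (s (p n)) X k) \<longlonglongrightarrow> 0"
      if "integrable M k" "strict_mono p" for k and p :: "nat \<Rightarrow> nat"
      using LIMSEQ_subseq_LIMSEQ[OF conv[OF that(1)] that(2)] by (simp add: o_def)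
    obtain q1 :: "nat \<Rightarrow> nat" where q1: "strict_mono q1"
      "AE x in M. (\<lambda>n. class_koopman M (s (r (q1 n))) (\<lambda>_. 1) x) \<longlonglongrightarrow> class_koopman M X (\<lambda>_. 1) x"
      using L1_dist_tendsto_AE_subseq[OF ki(1)[OF i1] ki(2)[OF i1] c[OF i1 r]] by blast
    have rq1: "strict_mono (\<lambda>n. r (q1 n))" using r q1(1) by (simp add: strict_mono_def)
    obtain q2 :: "nat \<Rightarrow> nat" where q2: "strict_mono q2"
      "AE x in M. (\<lambda>n. class_koopman M (s (r (q1 (q2 n)))) (indicator B) x)
        \<longlonglongrightarrow> class_koopman M X (indicator B) x"
      using L1_dist_tendsto_AE_subseq[OF ki(1)[OF iB] ki(2)[OF iB] c[OF iB rq1]] by blast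
    have "AE x in M. (\<lambda>n. ?d (r (q1 (q2 n))) x) \<longlonglongrightarrow> ?d' x \<and>
      (\<lambda>n. indicator B (?h (r (q1 (q2 n))) x) :: real) \<longlonglongrightarrow> indicator B (?g x) \<and> 0 < ?d' x"
      using q1(2) q2(2) gms_deriv_pos[OF prob_space_axioms g]
    proof eventually_elim
      fix x assume 1: "(\<lambda>n. class_koopman M (s (r (q1 n))) (\<lambda>_. 1) x) \<longlonglongrightarrow> class_koopman M X (\<lambda>_. 1) x"
        and 2: "(\<lambda>n. class_koopman M (s (r (q1 (q2 n)))) (indicator B) x)
          \<longlonglongrightarrow> class_koopman M X (indicator B) x"
        and pos: "0 < ?d' x"
      have d: "(\<lambda>n. ?d (r (q1 (q2 n))) x) \<longlonglongrightarrow> ?d' x"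
        using LIMSEQ_subseq_LIMSEQ[OF 1 q2(1)]
        by (simp add: o_def class_koopman_def koopman_def weighted_comp_def)
      have "(\<lambda>n. indicator B (?h (r (q1 (q2 n))) x) * ?d (r (q1 (q2 n))) x / ?d (r (q1 (q2 n))) x :: real)
          \<longlonglongrightarrow> indicator B (?g x) * ?d' x / ?d' x"
        using tendsto_divide[OF 2 d] pos by (simp add: class_koopman_def koopman_def weighted_comp_def)
      then have "(\<lambda>n. indicator B (?h (r (q1 (q2 n))) x) * ?d (r (q1 (q2 n))) x / ?d (r (q1 (q2 n))) x :: real)
          \<longlonglongrightarrow> indicator B (?g x)" using pos by simp
      then have "(\<lambda>n. indicator B (?h (r (q1 (q2 n))) x) :: real) \<longlonglongrightarrow> indicator B (?g x)"
        by (rule Lim_transform_eventually)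
           (use order_tendstoD(1)[OF d pos] in \<open>eventually_elim, simp\<close>)
      with d pos show "(\<lambda>n. ?d (r (q1 (q2 n))) x) \<longlonglongrightarrow> ?d' x \<and>
        (\<lambda>n. indicator B (?h (r (q1 (q2 n))) x) :: real) \<longlonglongrightarrow> indicator B (?g x) \<and> 0 < ?d' x" by blast
    qed
    moreover have "strict_mono (\<lambda>n. q1 (q2 n))" using q1(1) q2(1) by (simp add: strict_mono_def)
    ultimately show ?thesis by blast
  qed
  show "(\<lambda>n. \<integral>t. \<phi> t \<partial>kappa M (s n) A B) \<longlonglongrightarrow> (\<integral>t. \<phi> t \<partial>kappa M X A B)"
  proof (rule tendsto_if_subseq_tendsto)
    fix r :: "nat \<Rightarrow> nat" assume "strict_mono r"
    from sub[OF this] obtain q :: "nat \<Rightarrow> nat" where q: "strict_mono q"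
      "AE x in M. (\<lambda>n. ?d (r (q n)) x) \<longlonglongrightarrow> ?d' x \<and>
        (\<lambda>n. indicator B (?h (r (q n)) x) :: real) \<longlonglongrightarrow> indicator B (?g x) \<and> 0 < ?d' x" by blast
    have eq: "(\<integral>t. \<phi> t \<partial>kappa M Y A B) = (\<integral>x. (indicator A x * indicator B (gms_rep Y x) *
        \<psi> (gms_deriv M (gms_rep Y) x)) * 1 \<partial>M)" if "Y \<in> carrier (Gms M)" for Y
      using integral_kappa_map[OF gms_rep(1)[OF that] A B \<phi>(1)] by (simp add: kappa_def gms_rep_def \<psi>_def)
    have "(\<lambda>n. \<integral>x. (indicator A x * indicator B (?h (r (q n)) x) * \<psi> (?d (r (q n)) x)) * 1 \<partial>M)
        \<longlonglongrightarrow> (\<integral>x. (indicator A x * indicator B (?g x) * \<psi> (?d' x)) * 1 \<partial>M)"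
    proof (rule integral_tendsto_bounded_mult_L1)
      show "\<bar>indicator A x * indicator B (?h (r (q n)) x) * \<psi> (?d (r (q n)) x)\<bar> \<le> C" for n x
        using \<psi>b C0 by (auto simp: indicator_def)
      show "AE x in M. (\<lambda>n. indicator A x * indicator B (?h (r (q n)) x) * \<psi> (?d (r (q n)) x))
          \<longlonglongrightarrow> indicator A x * indicator B (?g x) * \<psi> (?d' x)"
        using q(2) by eventually_elim (intro tendsto_intros \<psi>c; simp)
    qed auto
    then show "\<exists>q. strict_mono q \<and> (\<lambda>n. \<integral>t. \<phi> t \<partial>kappa M (s (r (q n))) A B) \<longlonglongrightarrow> (\<integral>t. \<phi> t \<partial>kappa M X A B)"
      using q(1) by (auto simp: eq[OF s] eq[OF X])
  qed
  show "(\<lambda>n. \<integral>t. \<phi> t \<partial>density (kappa M (s n) A B) ennreal)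
      \<longlonglongrightarrow> (\<integral>t. \<phi> t \<partial>density (kappa M X A B) ennreal)"
  proof (rule tendsto_if_subseq_tendsto)
    fix r :: "nat \<Rightarrow> nat" assume r: "strict_mono r"
    from sub[OF this] obtain q :: "nat \<Rightarrow> nat" where q: "strict_mono q"
      "AE x in M. (\<lambda>n. ?d (r (q n)) x) \<longlonglongrightarrow> ?d' x \<and>
        (\<lambda>n. indicator B (?h (r (q n)) x) :: real) \<longlonglongrightarrow> indicator B (?g x) \<and> 0 < ?d' x" by blast
    have eq: "(\<integral>t. \<phi> t \<partial>density (kappa M Y A B) ennreal) =
        (\<integral>x. (indicator A x * \<psi> (gms_deriv M (gms_rep Y) x)) * class_koopman M Y (indicator B) x \<partial>M)"
      if "Y \<in> carrier (Gms M)" for Y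
      using integral_density_kappa_map[OF gms_rep(1)[OF that] A B \<phi>(1)]
      by (simp add: kappa_def gms_rep_def \<psi>_def class_koopman_def)
    have rq: "strict_mono (\<lambda>n. r (q n))" using r q(1) by (simp add: strict_mono_def)
    have "(\<lambda>n. \<integral>x. (indicator A x * \<psi> (?d (r (q n)) x)) * class_koopman M (s (r (q n))) (indicator B) x \<partial>M)
        \<longlonglongrightarrow> (\<integral>x. (indicator A x * \<psi> (?d' x)) * class_koopman M X (indicator B) x \<partial>M)"
    proof (rule integral_tendsto_bounded_mult_L1)
      show "\<bar>indicator A x * \<psi> (?d (r (q n)) x)\<bar> \<le> C" for n x
        using \<psi>b C0 by (auto simp: indicator_def)
      show "AE x in M. (\<lambda>n. indicator A x * \<psi> (?d (r (q n)) x)) \<longlonglongrightarrow> indicator A x * \<psi> (?d' x)"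
        using q(2) by eventually_elim (intro tendsto_intros \<psi>c; simp)
      show "(\<lambda>n. koopman_dist M (s (r (q n))) X (indicator B))
          \<longlonglongrightarrow> 0"
        using LIMSEQ_subseq_LIMSEQ[OF conv[OF iB] rq] by (simp add: o_def)
    qed (auto intro: ki iB)
    then show "\<exists>q. strict_mono q \<and> (\<lambda>n. \<integral>t. \<phi> t \<partial>density (kappa M (s (r (q n))) A B) ennreal)
        \<longlonglongrightarrow> (\<integral>t. \<phi> t \<partial>density (kappa M X A B) ennreal)"
      using q(1) by (auto simp: eq[OF s] eq[OF X])
  qed
qed

lemma koopman_convergence_imp_limitin_Gms:
  fixes s :: "nat \<Rightarrow> ('a \<Rightarrow> 'a) set"
  assumes s: "\<And>n. s n \<in> carrier (Gms M)" and X: "X \<in> carrier (Gms M)"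
    and conv: "\<And>k. integrable M k \<Longrightarrow>
      (\<lambda>n. koopman_dist M (s n) X k) \<longlonglongrightarrow> 0"
  shows "limitin (Gms_topology M) s X sequentially"
proof -
  have weak: "limitin (weak_topology_on {0<..}) N N' sequentially"
    if N: "\<And>n. N n \<in> finite_measures_on {0<..}" "N' \<in> finite_measures_on {0<..}"
      and c: "\<And>\<phi>::real \<Rightarrow> real. continuous_on {0<..} \<phi> \<Longrightarrow> bounded (\<phi> ` {0<..}) \<Longrightarrow>
        (\<lambda>n. \<integral>t. \<phi> t \<partial>N n) \<longlonglongrightarrow> (\<integral>t. \<phi> t \<partial>N')" for N :: "nat \<Rightarrow> real measure" and N'
    unfolding weak_topology_on_def
  proof (rule limitin_topology_generated_byI)
    show "N' \<in> \<Union> {{N \<in> finite_measures_on {0<..}. (\<integral>t. \<phi> t \<partial>N) \<in> U} | (\<phi>::real \<Rightarrow> real) U.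
        continuous_on {0<..} \<phi> \<and> bounded (\<phi> ` {0<..}) \<and> open U}"
    proof -
      have "N' \<in> topspace (weak_topology_on {0<..})" using N(2) by simp
      then show ?thesis unfolding weak_topology_on_def topology_generated_by_topspace .
    qed
    fix V assume "V \<in> {{N \<in> finite_measures_on {0<..}. (\<integral>t. \<phi> t \<partial>N) \<in> U} | (\<phi>::real \<Rightarrow> real) U.
        continuous_on {0<..} \<phi> \<and> bounded (\<phi> ` {0<..}) \<and> open U}" "N' \<in> V"
    then obtain \<phi> :: "real \<Rightarrow> real" and U where
      V: "V = {N \<in> finite_measures_on {0<..}. (\<integral>t. \<phi> t \<partial>N) \<in> U}"
      and \<phi>: "continuous_on {0<..} \<phi>" "bounded (\<phi> ` {0<..})" and U: "open U" by blast
    then have "\<forall>\<^sub>F n in sequentially. (\<integral>t. \<phi> t \<partial>N n) \<in> U"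
      using topological_tendstoD[OF c[OF \<phi>] U] \<open>N' \<in> V\<close> by simp
    then show "\<forall>\<^sub>F n in sequentially. N n \<in> V" using N(1) by (simp add: V)
  qed
  have fin: "kappa M Y A B \<in> finite_measures_on {0<..}"
    "density (kappa M Y A B) ennreal \<in> finite_measures_on {0<..}"
    if "Y \<in> carrier (Gms M)" "A \<in> sets M" "B \<in> sets M" for Y A B
    using kappa_map_finite_measure[OF gms_rep(1)] that by (auto simp: kappa_def gms_rep_def)
  show ?thesis
    unfolding Gms_topology_def
  proof (rule limitin_topology_generated_byI, goal_cases)
    case 1
    have "X \<in> topspace (Gms_topology M)" using X by simp
    then show ?case unfolding Gms_topology_def topology_generated_by_topspace .
  next
    case (2 V)
    then obtain A B W where AB: "A \<in> sets M" "B \<in> sets M"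
      and W: "openin (weak_topology_on {0<..}) W"
      and V: "V = {X\<in>carrier (Gms M). kappa M X A B \<in> W} \<or>
        V = {X\<in>carrier (Gms M). density (kappa M X A B) ennreal \<in> W}"
      by (elim UnE CollectE exE conjE) blast+
    note I = koopman_convergence_imp_integral_kappa[OF s X conv AB]
    have l1: "limitin (weak_topology_on {0<..}) (\<lambda>n. kappa M (s n) A B) (kappa M X A B) sequentially"
      by (rule weak) (use fin s X AB I in auto)
    have l2: "limitin (weak_topology_on {0<..}) (\<lambda>n. density (kappa M (s n) A B) ennreal)
        (density (kappa M X A B) ennreal) sequentially"
      by (rule weak) (use fin s X AB I in auto)
    show ?case
      using V limitinD[OF l1 W] limitinD[OF l2 W] s 2(2) by auto
  qed
qed

end

section \<open>Spaces with a coordinate\<close>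

text \<open>What is used of an isomorphism mod 0 with the unit interval, regarded as a real function on \<open>M\<close>. Its
  inverse is only present in \<open>coord_realize\<close>, which lifts a real function that pulls null sets back to
  null sets to a map of \<open>M\<close>.\<close>

locale coordinatized_space = prob_space M for M :: "'a measure" +
  fixes coord :: "'a \<Rightarrow> real"
  assumes coord_measurable [measurable]: "coord \<in> borel_measurable M"
    and coord_range: "\<And>x. x \<in> space M \<Longrightarrow> 0 \<le> coord x \<and> coord x \<le> 1"
    and coord_inj: "\<exists>N\<in>null_sets M. inj_on coord (space M - N)"
    and coord_sets: "\<And>A. A \<in> sets M \<Longrightarrow> \<exists>B\<in>sets borel. AE x in M. x \<in> A \<longleftrightarrow> coord x \<in> B"
    and coord_realize: "\<And>u. u \<in> borel_measurable M \<Longrightarrow>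
      (\<And>B. B \<in> sets borel \<Longrightarrow> AE x in M. coord x \<notin> B \<Longrightarrow> AE x in M. u x \<notin> B) \<Longrightarrow>
      \<exists>g. nonsingular M g \<and> (AE x in M. coord (g x) = u x)"
begin

lemma AE_eqI_coord:
  assumes f: "nonsingular M f" and g: "nonsingular M g" and eq: "AE x in M. coord (f x) = coord (g x)"
  shows "AE x in M. f x = g x"
proof -
  obtain N where N: "N \<in> null_sets M" and inj: "inj_on coord (space M - N)" using coord_inj by blast
  from eq nonsingular_AE[OF f AE_not_in[OF N]] nonsingular_AE[OF g AE_not_in[OF N]] AE_space[of M]
  show ?thesis
  proof eventually_elim
    fix x assume "coord (f x) = coord (g x)" "f x \<notin> N" "g x \<notin> N" "x \<in> space M"
    then show "f x = g x"
      using inj measurable_space[OF nonsingular_measurable[OF f], of x]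
        measurable_space[OF nonsingular_measurable[OF g], of x] by (auto dest: inj_onD)
  qed
qed

lemma integrable_coord: "integrable M coord"
  by (rule integrable_const_bound[where B = 1]) (use coord_range in \<open>auto intro!: AE_I2\<close>)

lemma integrable_bounded_coord:
  fixes f :: "real \<Rightarrow> real"
  assumes "f \<in> borel_measurable borel" "\<And>x. \<bar>f x\<bar> \<le> C"
  shows "integrable M (\<lambda>x. f (coord x))"
  by (rule integrable_const_bound[where B = C]) (use assms in auto)

text \<open>The ramps of the coordinate form a countable family that generates L1. Being continuous in the
  coordinate, they also behave well under almost everywhere convergence of coordinates.\<close>

lemma L1_closed_subspace_ramps:
  assumes Q: "L1_closed_subspace M Q" and ramp: "\<And>q m. Q (\<lambda>x. ramp q m (coord x))"
    and k: "integrable M k"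
  shows "Q k"
proof -
  have P: "Q (\<lambda>x. indicator B (coord x))" if "B \<in> sets borel" for B
    using _ _ _ that
  proof (rule bounded_borel_indicator_induct[where P = "\<lambda>f. Q (\<lambda>x. f (coord x))"])
    show "Q (\<lambda>x. ramp q m (coord x))" for q m by (rule ramp)
  next
    fix f g :: "real \<Rightarrow> real" and a b C D :: real
    assume m: "f \<in> borel_measurable borel" "g \<in> borel_measurable borel"
      and C: "\<And>x. \<bar>f x\<bar> \<le> C" and D: "\<And>x. \<bar>g x\<bar> \<le> D"
      and fg: "Q (\<lambda>x. f (coord x))" "Q (\<lambda>x. g (coord x))"
    show "Q (\<lambda>x. a * f (coord x) + b * g (coord x))"
      by (rule L1_closed_subspace_lincomb[OF Q, OF integrable_bounded_coord[OF m(1) C]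
            integrable_bounded_coord[OF m(2) D] fg])
  next
    fix F :: "nat \<Rightarrow> real \<Rightarrow> real" and f C
    assume Fm[measurable]: "\<And>n. F n \<in> borel_measurable borel" and fm[measurable]: "f \<in> borel_measurable borel"
      and C: "\<And>n x. \<bar>F n x\<bar> \<le> C" and fC: "\<And>x. \<bar>f x\<bar> \<le> C"
      and lim: "\<And>x. (\<lambda>n. F n x) \<longlonglongrightarrow> f x" and F: "\<And>n. Q (\<lambda>x. F n (coord x))"
    show "Q (\<lambda>x. f (coord x))"
    proof (rule L1_closed_subspace_limit[OF Q, OF integrable_bounded_coord[OF Fm C] F
          integrable_bounded_coord[OF fm fC]])
      show "(\<lambda>n. L1_dist M (\<lambda>x. F n (coord x)) (\<lambda>x. f (coord x))) \<longlonglongrightarrow> 0"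
        by (rule L1_dist_tendsto_dominated[where w = "\<lambda>_. C"]) (use lim C in auto)
    qed
  qed
  show ?thesis
    using Q _ k
  proof (rule L1_closed_subspace_integrable)
    fix A assume A[measurable]: "A \<in> sets M"
    then obtain B where B[measurable]: "B \<in> sets borel" and AB: "AE x in M. x \<in> A \<longleftrightarrow> coord x \<in> B"
      using coord_sets by blast
    have iB: "integrable M (\<lambda>x. indicator B (coord x) :: real)"
      by (rule integrable_bounded_coord[of _ 1]) (auto simp: indicator_def)
    have "L1_dist M (\<lambda>x. indicator B (coord x)) (indicator A) = 0"
    proof (rule iffD2[OF L1_dist_eq_0_iff[OF iB integrable_indicator_event[OF A]]])
      from AB show "AE x in M. indicator B (coord x) = (indicator A x :: real)"
      proof eventually_elim
        fix x assume "x \<in> A \<longleftrightarrow> coord x \<in> B"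
        then show "indicator B (coord x) = (indicator A x :: real)" by (cases "x \<in> A") simp_all
      qed
    qed
    then have lim: "(\<lambda>n::nat. L1_dist M (\<lambda>x. indicator B (coord x)) (indicator A)) \<longlonglongrightarrow> 0" by simp
    show "Q (indicator A)"
    proof (rule L1_closed_subspace_limit[OF Q iB _ integrable_indicator_event[OF A] lim])
      show "Q (\<lambda>x. indicator B (coord x))" by (rule P[OF B])
    qed
  qed
qed

section \<open>Limits of Koopman operators\<close>

text \<open>Let \<open>w\<close> be the limit of the derivatives of \<open>s n\<close> and let \<open>u\<close> be that of a subsequence of \<open>coord \<circ> s n\<close>.
  The limit operator sends \<open>\<psi> \<circ> coord\<close> to \<open>(\<psi> \<circ> u) * w\<close> for continuous \<open>\<psi>\<close>, so the image of
  the measure with density \<open>w\<close> under \<open>u\<close> is the distribution of the coordinate. Hence \<open>u\<close> is the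
  coordinate of a map \<open>g\<close>. As \<open>k1\<close> is sent to \<open>1\<close> by the limit operator,
  \<open>w\<close> does not vanish on a set of positive measure.\<close>

lemma koopman_limit_weighted_comp:
  assumes s: "\<And>n::nat. s n \<in> gms_maps M"
    and cauchy: "\<And>k. integrable M k \<Longrightarrow>
      ((\<lambda>(i, j). L1_dist M (koopman M (s i) k) (koopman M (s j) k)) \<longlongrightarrow> 0) (sequentially \<times>\<^sub>F sequentially)"
    and k1: "integrable M k1" "(\<lambda>n. L1_dist M (koopman M (s n) k1) (\<lambda>_. 1)) \<longlonglongrightarrow> 0"
  obtains g w where "transfer_pair M g w" "nonsingular M g" "AE x in M. 0 < w x"
    "\<And>k. integrable M k \<Longrightarrow> (\<lambda>n. L1_dist M (koopman M (s n) k) (weighted_comp g w k)) \<longlonglongrightarrow> 0"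
proof -
  note ki = koopman_integrable[OF prob_space_axioms s]
  have sm[measurable]: "s n \<in> measurable M M" for n
    by (rule nonsingular_measurable[OF gms_nonsingular[OF s]])
  have ex: "\<exists>v. integrable M v \<and> (\<lambda>n. L1_dist M (koopman M (s n) k) v) \<longlonglongrightarrow> 0" if "integrable M k" for k
    using L1_complete[of M "\<lambda>n. koopman M (s n) k", OF ki[OF that] cauchy[OF that]] by blast
  define V where "V k = (SOME v. integrable M v \<and> (\<lambda>n. L1_dist M (koopman M (s n) k) v) \<longlonglongrightarrow> 0)" for k
  have V: "integrable M (V k)" "(\<lambda>n. L1_dist M (koopman M (s n) k) (V k)) \<longlonglongrightarrow> 0"
    if "integrable M k" for k
    using someI_ex[OF ex[OF that]] unfolding V_def by auto
  have i1: "integrable M (\<lambda>_. 1::real)" by simp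
  note ic = integrable_coord
  define d where "d n = gms_deriv M (s n)" for n
  have dm[measurable]: "d n \<in> borel_measurable M" for n by (simp add: d_def)
  have d0: "0 \<le> d n x" for n x by (simp add: d_def gms_deriv_nonneg)
  have koop: "koopman M (s n) k x = k (s n x) * d n x" for n k x
    by (simp add: koopman_def weighted_comp_def d_def)
  obtain r1 :: "nat \<Rightarrow> nat" where r1: "strict_mono r1"
    "AE x in M. (\<lambda>n. koopman M (s (r1 n)) (\<lambda>_. 1) x) \<longlonglongrightarrow> V (\<lambda>_. 1) x"
    using L1_dist_tendsto_AE_subseq[OF ki[OF i1] V(1)[OF i1] V(2)[OF i1]] by blast
  have "(\<lambda>n. L1_dist M (koopman M (s (r1 n)) coord) (V coord)) \<longlonglongrightarrow> 0"
    using LIMSEQ_subseq_LIMSEQ[OF V(2)[OF ic] r1(1)] by (simp add: o_def)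
  then obtain r2 :: "nat \<Rightarrow> nat" where r2: "strict_mono r2"
    "AE x in M. (\<lambda>n. koopman M (s (r1 (r2 n))) coord x) \<longlonglongrightarrow> V coord x"
    using L1_dist_tendsto_AE_subseq[OF ki[OF ic] V(1)[OF ic]] by blast
  define r where "r n = r1 (r2 n)" for n
  have r: "strict_mono r" using r1(1) r2(1) by (simp add: strict_mono_def r_def)
  define w where "w x = max 0 (V (\<lambda>_. 1) x)" for x
  have wm[measurable]: "w \<in> borel_measurable M" unfolding w_def using V(1)[OF i1] by measurable
  have w0: "0 \<le> w x" for x by (simp add: w_def)
  have dlim: "AE x in M. (\<lambda>n. d (r n) x) \<longlonglongrightarrow> w x \<and> w x = V (\<lambda>_. 1) x"
    using r1(2)
  proof eventually_elim
    fix x assume "(\<lambda>n. koopman M (s (r1 n)) (\<lambda>_. 1) x) \<longlonglongrightarrow> V (\<lambda>_. 1) x"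
    from LIMSEQ_subseq_LIMSEQ[OF this r2(1)] have 1: "(\<lambda>n. d (r n) x) \<longlonglongrightarrow> V (\<lambda>_. 1) x"
      by (simp add: o_def koop r_def)
    then have "0 \<le> V (\<lambda>_. 1) x" by (rule LIMSEQ_le_const) (use d0 in auto)
    with 1 show "(\<lambda>n. d (r n) x) \<longlonglongrightarrow> w x \<and> w x = V (\<lambda>_. 1) x" by (simp add: w_def)
  qed
  have wi: "integrable M w"
    unfolding w_def using V(1)[OF i1] by auto
  have Vw: "(\<lambda>n. L1_dist M (d n) w) \<longlonglongrightarrow> 0"
  proof -
    have "L1_dist M (koopman M (s n) (\<lambda>_. 1)) (V (\<lambda>_. 1)) = L1_dist M (d n) w" for n
      by (rule L1_dist_cong_AE)
         (use V(1)[OF i1] dlim in \<open>auto simp: koop[abs_def] elim: AE_mp\<close>)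
    then show ?thesis using V(2)[OF i1] by simp
  qed

  define Z where "Z = {x\<in>space M. w x = 0}"
  have Zm[measurable]: "Z \<in> sets M" unfolding Z_def by measurable
  \<comment> \<open>The image of \<open>k1\<close> is close to \<open>1\<close> on \<open>Z\<close>, while the image of its truncation \<open>c m\<close> is at most
    \<open>m\<close> times the derivative and hence close to \<open>0\<close> there.\<close>
  have "measure M Z \<le> 0"
  proof (rule LIMSEQ_le_const)
    define c where "c m x = max (- real m) (min (real m) (k1 x))" for m x
    have [measurable]: "k1 \<in> borel_measurable M" using k1 by auto
    have cb: "\<bar>c m x\<bar> \<le> real m" "\<bar>c m x\<bar> \<le> \<bar>k1 x\<bar>" for m x by (auto simp: c_def)
    have cm[measurable]: "c m \<in> borel_measurable M" for m unfolding c_def[abs_def] by measurable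
    have ci: "integrable M (c m)" for m
      by (rule Bochner_Integration.integrable_bound[OF k1(1)]) (use cb in auto)
    have "(\<lambda>m. L1_dist M (c m) k1) \<longlonglongrightarrow> 0"
    proof (rule L1_dist_tendsto_dominated[where w = "\<lambda>x. \<bar>k1 x\<bar>"])
      show "AE x in M. (\<lambda>m. c m x) \<longlonglongrightarrow> k1 x"
      proof (intro AE_I2 tendsto_eventually)
        fix x
        obtain N :: nat where "\<bar>k1 x\<bar> \<le> real N" using real_arch_simple by blast
        then show "\<forall>\<^sub>F m in sequentially. c m x = k1 x"
          unfolding eventually_sequentially by (intro exI[of _ N]) (auto simp: c_def)
      qed
    qed (use k1 cb in auto)
    then show "(\<lambda>m. L1_dist M (c m) k1) \<longlonglongrightarrow> 0" .
    have "measure M Z \<le> L1_dist M (c m) k1" for m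
    proof (rule LIMSEQ_le_const)
      have iZ: "integrable M (\<lambda>x. indicator Z x * f x)" if "integrable M f" for f :: "'a \<Rightarrow> real"
        using integrable_mult_indicator[OF Zm that] by simp
      let ?b = "\<lambda>n. real m * L1_dist M (d n) w + L1_dist M (c m) k1 + L1_dist M (koopman M (s n) k1) (\<lambda>_. 1)"
      have "?b \<longlonglongrightarrow> real m * 0 + L1_dist M (c m) k1 + 0"
        by (intro tendsto_add tendsto_mult tendsto_const Vw k1(2))
      then show "?b \<longlonglongrightarrow> L1_dist M (c m) k1" by simp
      have "measure M Z \<le> ?b n" for n
      proof -
        have di: "integrable M (d n)"
          using ki[OF i1, of n] by (simp add: koop[abs_def])
        have "measure M Z = (\<integral>x. indicator Z x \<partial>M)" by simp
        also have "\<dots> \<le> (\<integral>x. real m * \<bar>d n x - w x\<bar>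
            + \<bar>koopman M (s n) (c m) x - koopman M (s n) k1 x\<bar> + \<bar>koopman M (s n) k1 x - 1\<bar> \<partial>M)"
        proof (rule integral_mono)
          show "integrable M (indicator Z :: 'a \<Rightarrow> real)" by (rule integrable_indicator_event[OF Zm])
          show "integrable M (\<lambda>x. real m * \<bar>d n x - w x\<bar>
            + \<bar>koopman M (s n) (c m) x - koopman M (s n) k1 x\<bar> + \<bar>koopman M (s n) k1 x - 1\<bar>)"
            using di wi ki[OF ci] ki[OF k1(1)] by auto
          fix x assume "x \<in> space M"
          have "\<bar>koopman M (s n) (c m) x\<bar> \<le> real m * d n x"
            using cb(1)[of m "s n x"] d0[of n x] by (simp add: koop abs_mult mult_right_mono)
          then show "indicator Z x \<le> real m * \<bar>d n x - w x\<bar>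
            + \<bar>koopman M (s n) (c m) x - koopman M (s n) k1 x\<bar> + \<bar>koopman M (s n) k1 x - 1\<bar>"
            using d0[of n x] by (cases "x \<in> Z") (auto simp: Z_def)
        qed
        also have "\<dots> = ?b n"
          using di wi ki[OF ci] ki[OF k1(1)]
            koopman_isometry[OF prob_space_axioms s ci k1(1), symmetric]
          by (simp add: L1_dist_def)
        finally show ?thesis .
      qed
      then show "\<exists>N. \<forall>n\<ge>N. measure M Z \<le> ?b n" by blast
    qed
    then show "\<exists>N. \<forall>m\<ge>N. measure M Z \<le> L1_dist M (c m) k1" by blast
  qed
  then have "measure M Z = 0" using measure_nonneg[of M Z] by simp
  then have "Z \<in> null_sets M" using Zm by (simp add: null_sets_def emeasure_eq_measure)
  from AE_not_in[OF this] AE_space have wpos: "AE x in M. 0 < w x"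
    by eventually_elim (use w0 in \<open>auto simp: Z_def less_le\<close>)

  define u where "u x = V coord x / w x" for x
  have um[measurable]: "u \<in> borel_measurable M"
    unfolding u_def[abs_def] using V(1)[OF ic] by measurable
  have ulim: "AE x in M. (\<lambda>n. coord (s (r n) x)) \<longlonglongrightarrow> u x"
    using dlim r2(2) wpos
  proof eventually_elim
    fix x assume 1: "(\<lambda>n. d (r n) x) \<longlonglongrightarrow> w x \<and> w x = V (\<lambda>_. 1) x"
      and 2: "(\<lambda>n. koopman M (s (r1 (r2 n))) coord x) \<longlonglongrightarrow> V coord x"
      and pos: "0 < w x"
    have "(\<lambda>n. coord (s (r n) x) * d (r n) x / d (r n) x) \<longlonglongrightarrow> V coord x / w x"
      using tendsto_divide[OF 2 conjunct1[OF 1]] pos unfolding koop r_def by simp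
    then show "(\<lambda>n. coord (s (r n) x)) \<longlonglongrightarrow> u x"
      unfolding u_def
    proof (rule Lim_transform_eventually)
      have "\<forall>\<^sub>F n in sequentially. 0 < d (r n) x" using order_tendstoD(1) 1 pos by blast
      then show "\<forall>\<^sub>F n in sequentially. coord (s (r n) x) * d (r n) x / d (r n) x = coord (s (r n) x)"
        by eventually_elim simp
    qed
  qed
  have bdd_int: "integrable M (\<lambda>x. f (u x) * w x)"
    if [measurable]: "f \<in> borel_measurable borel" and "\<And>x. \<bar>f x\<bar> \<le> C" for f :: "real \<Rightarrow> real" and C
  proof (rule Bochner_Integration.integrable_bound)
    show "integrable M (\<lambda>x. C * w x)" using wi by simp
    show "AE x in M. norm (f (u x) * w x) \<le> norm (C * w x)"
      by (intro AE_I2)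
        (use that(2) w0 in \<open>auto simp: abs_mult intro!: mult_right_mono intro: order_trans[OF _ abs_ge_self]\<close>)
  qed measurable
  have ramp_lim: "(\<lambda>n. L1_dist M (koopman M (s n) (\<lambda>x. ramp q m (coord x))) (\<lambda>x. ramp q m (u x) * w x)) \<longlonglongrightarrow> 0"
    for q m
  proof -
    let ?k = "\<lambda>x. ramp q m (coord x)"
    have k: "integrable M ?k" by (rule integrable_bounded_coord[OF ramp_measurable ramp_abs_le])
    have "AE x in M. V ?k x = ramp q m (u x) * w x"
    proof (rule L1_limit_AE_unique[OF ki[OF k] V(1)[OF k] V(2)[OF k] r])
      show "AE x in M. (\<lambda>n. koopman M (s (r n)) ?k x) \<longlonglongrightarrow> ramp q m (u x) * w x"
        using ulim dlim
      proof eventually_elim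
        fix x assume 1: "(\<lambda>n. coord (s (r n) x)) \<longlonglongrightarrow> u x"
          and 2: "(\<lambda>n. d (r n) x) \<longlonglongrightarrow> w x \<and> w x = V (\<lambda>_. 1) x"
        have "isCont (ramp q m) (u x)"
          using continuous_on_ramp by (simp add: continuous_on_eq_continuous_at)
        from tendsto_mult[OF isCont_tendsto_compose[OF this 1] conjunct1[OF 2]]
        show "(\<lambda>n. koopman M (s (r n)) ?k x) \<longlonglongrightarrow> ramp q m (u x) * w x" by (simp add: koop)
      qed
    qed
    then have "L1_dist M (koopman M (s n) ?k) (V ?k)
        = L1_dist M (koopman M (s n) ?k) (\<lambda>x. ramp q m (u x) * w x)" for n
      using ki[OF k] V(1)[OF k] by (intro L1_dist_cong_AE) auto
    then show ?thesis using V(2)[OF k] by simp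
  qed
  \<comment> \<open>The operators preserve integrals, so the image of the measure with density \<open>w\<close> under \<open>u\<close>
    and the distribution of the coordinate agree on ramps, and hence on Borel sets.\<close>
  have push: "(\<integral>x. indicator B (u x) * w x \<partial>M) = (\<integral>x. indicator B (coord x) \<partial>M)"
    if B: "B \<in> sets borel" for B
    using _ _ _ B
  proof (rule bounded_borel_indicator_induct[where
        P = "\<lambda>f. (\<integral>x. f (u x) * w x \<partial>M) = (\<integral>x. f (coord x) \<partial>M)"])
    fix q m
    let ?k = "\<lambda>x. ramp q m (coord x)"
    have k: "integrable M ?k" by (rule integrable_bounded_coord[OF ramp_measurable ramp_abs_le])
    have "\<bar>(\<integral>x. ?k x \<partial>M) - (\<integral>x. ramp q m (u x) * w x \<partial>M)\<bar>
        \<le> L1_dist M (koopman M (s n) ?k) (\<lambda>x. ramp q m (u x) * w x)" for n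
    proof -
      have "(\<integral>x. koopman M (s n) ?k x \<partial>M) = (\<integral>x. ?k x \<partial>M)"
        unfolding koopman_def
        by (rule weighted_comp_integral[OF gms_transfer_pair[OF prob_space_axioms s]]) measurable
      then show ?thesis
        using abs_integral_diff_le_L1_dist[OF ki[OF k] bdd_int[OF ramp_measurable ramp_abs_le], of n q m]
        by simp
    qed
    then have "\<bar>(\<integral>x. ?k x \<partial>M) - (\<integral>x. ramp q m (u x) * w x \<partial>M)\<bar> \<le> 0"
      by (intro LIMSEQ_le_const[OF ramp_lim[of q m]]) auto
    then show "(\<integral>x. ramp q m (u x) * w x \<partial>M) = (\<integral>x. ?k x \<partial>M)" by simp
  next
    fix f g :: "real \<Rightarrow> real" and a b C D :: real
    assume m: "f \<in> borel_measurable borel" "g \<in> borel_measurable borel"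
      and C: "\<And>x. \<bar>f x\<bar> \<le> C" and D: "\<And>x. \<bar>g x\<bar> \<le> D"
      and fg: "(\<integral>x. f (u x) * w x \<partial>M) = (\<integral>x. f (coord x) \<partial>M)"
        "(\<integral>x. g (u x) * w x \<partial>M) = (\<integral>x. g (coord x) \<partial>M)"
    have "(\<integral>x. (a * f (u x) + b * g (u x)) * w x \<partial>M)
        = (\<integral>x. a * (f (u x) * w x) + b * (g (u x) * w x) \<partial>M)"
      by (rule Bochner_Integration.integral_cong) (auto simp: algebra_simps)
    also have "\<dots> = a * (\<integral>x. f (u x) * w x \<partial>M) + b * (\<integral>x. g (u x) * w x \<partial>M)"
      using bdd_int[OF m(1) C] bdd_int[OF m(2) D] by simp
    also have "\<dots> = (\<integral>x. a * f (coord x) + b * g (coord x) \<partial>M)"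
      using fg integrable_bounded_coord[OF m(1) C] integrable_bounded_coord[OF m(2) D] by simp
    finally show "(\<integral>x. (a * f (u x) + b * g (u x)) * w x \<partial>M)
        = (\<integral>x. a * f (coord x) + b * g (coord x) \<partial>M)" .
  next
    fix F :: "nat \<Rightarrow> real \<Rightarrow> real" and f C
    assume Fm[measurable]: "\<And>n. F n \<in> borel_measurable borel" and fm[measurable]: "f \<in> borel_measurable borel"
      and C: "\<And>n x. \<bar>F n x\<bar> \<le> C" and lim: "\<And>x. (\<lambda>n. F n x) \<longlonglongrightarrow> f x"
      and F: "\<And>n. (\<integral>x. F n (u x) * w x \<partial>M) = (\<integral>x. F n (coord x) \<partial>M)"
    have l1: "(\<lambda>n. \<integral>x. F n (u x) * w x \<partial>M) \<longlonglongrightarrow> (\<integral>x. f (u x) * w x \<partial>M)"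
      by (rule integral_tendsto_bounded_mult_L1[OF wi wi, where C = C]) (use C lim in auto)
    have "(\<lambda>n. \<integral>x. F n (coord x) * 1 \<partial>M) \<longlonglongrightarrow> (\<integral>x. f (coord x) * 1 \<partial>M)"
      by (rule integral_tendsto_bounded_mult_L1[OF i1 i1, where C = C]) (use C lim in auto)
    then have l2: "(\<lambda>n. \<integral>x. F n (u x) * w x \<partial>M) \<longlonglongrightarrow> (\<integral>x. f (coord x) \<partial>M)" by (simp add: F)
    show "(\<integral>x. f (u x) * w x \<partial>M) = (\<integral>x. f (coord x) \<partial>M)" by (rule LIMSEQ_unique[OF l1 l2])
  qed
  have ind_abs: "\<bar>indicator B x :: real\<bar> \<le> 1" for B :: "real set" and x by (simp add: indicator_def)
  have "AE x in M. u x \<notin> B" if B[measurable]: "B \<in> sets borel" and nB: "AE x in M. coord x \<notin> B" for B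
  proof -
    have "(\<integral>x. indicator B (coord x) \<partial>M) = (\<integral>x. (0::real) \<partial>M)"
      by (rule integral_cong_AE) (use nB in auto)
    then have "(\<integral>x. indicator B (u x) * w x \<partial>M) = 0" using push[OF B] by simp
    then have "AE x in M. indicator B (u x) * w x = 0"
      by (subst (asm) integral_nonneg_eq_0_iff_AE)
         (use w0 bdd_int[of "indicator B" 1] ind_abs in auto)
    with wpos show ?thesis by eventually_elim (auto simp: indicator_def)
  qed
  then obtain g where g: "nonsingular M g" "AE x in M. coord (g x) = u x"
    using coord_realize[OF um] by blast
  note [measurable] = nonsingular_measurable[OF g(1)]
  have T: "transfer_pair M g w"
  proof (rule transfer_pairI)
    fix A assume A[measurable]: "A \<in> sets M"
    then obtain B where B[measurable]: "B \<in> sets borel" and AB: "AE x in M. x \<in> A \<longleftrightarrow> coord x \<in> B"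
      using coord_sets by blast
    have "(\<integral>\<^sup>+x. indicator A (g x) * ennreal (w x) \<partial>M) = (\<integral>\<^sup>+x. ennreal (indicator B (u x) * w x) \<partial>M)"
    proof (rule nn_integral_cong_AE)
      from nonsingular_AE[OF g(1) AB] g(2)
      show "AE x in M. indicator A (g x) * ennreal (w x) = ennreal (indicator B (u x) * w x)"
        by eventually_elim (auto simp: indicator_def)
    qed
    also have "\<dots> = ennreal (\<integral>x. indicator B (u x) * w x \<partial>M)"
      by (rule nn_integral_eq_integral) (use w0 bdd_int[of "indicator B" 1] ind_abs in auto)
    also have "\<dots> = ennreal (\<integral>x. indicator A x \<partial>M)"
    proof -
      have "(\<integral>x. indicator B (coord x) \<partial>M) = (\<integral>x. indicator A x \<partial>M :: real)"
        by (rule integral_cong_AE) (use AB in \<open>auto simp: indicator_def\<close>)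
      then show ?thesis using push[OF B] by simp
    qed
    also have "\<dots> = emeasure M A" by (simp add: emeasure_eq_measure)
    finally show "(\<integral>\<^sup>+x. indicator A (g x) * ennreal (w x) \<partial>M) = emeasure M A" .
  qed (use w0 in auto)
  have "(\<lambda>n. L1_dist M (koopman M (s n) k) (weighted_comp g w k)) \<longlonglongrightarrow> 0" if k: "integrable M k" for k
  proof -
    have "L1_closed_subspace M (\<lambda>k. (\<lambda>n. L1_dist M (koopman M (s n) k) (weighted_comp g w k)) \<longlonglongrightarrow> 0)"
      unfolding koopman_def
      by (rule weighted_comp_limit_closed_subspace)
         (auto intro!: always_eventually gms_transfer_pair[OF prob_space_axioms s] T)
    then show ?thesis
      using _ k
    proof (rule L1_closed_subspace_ramps)
      fix q m
      let ?k = "\<lambda>x. ramp q m (coord x)"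
      have k: "integrable M ?k" by (rule integrable_bounded_coord[OF ramp_measurable ramp_abs_le])
      have "L1_dist M (koopman M (s n) ?k) (weighted_comp g w ?k)
          = L1_dist M (koopman M (s n) ?k) (\<lambda>x. ramp q m (u x) * w x)" for n
      proof (rule L1_dist_cong_AE)
        show "AE x in M. weighted_comp g w ?k x = ramp q m (u x) * w x"
          using g(2) by eventually_elim (simp add: weighted_comp_def)
      qed (use ki[OF k] in \<open>auto simp: weighted_comp_def\<close>)
      then show "(\<lambda>n. L1_dist M (koopman M (s n) ?k) (weighted_comp g w ?k)) \<longlonglongrightarrow> 0"
        using ramp_lim by simp
    qed
  qed
  with T g(1) wpos show ?thesis using that by blast
qed

text \<open>The limits of \<open>s n\<close> and of the inverses \<open>t n\<close> come from maps \<open>g\<close> and \<open>h\<close>. The composition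
  of the limit operators fixes \<open>1\<close> and the coordinate, so \<open>h \<circ> g\<close> preserves the coordinate almost
  everywhere.\<close>

lemma koopman_limit_inverse:
  assumes s: "\<And>n::nat. s n \<in> gms_maps M" and t: "\<And>n. t n \<in> gms_maps M"
    and st: "\<And>n k. AE x in M. koopman M (s n) (koopman M (t n) k) x = k x"
    and g: "transfer_pair M g w" "nonsingular M g"
    and h: "transfer_pair M h v" "nonsingular M h"
    and sg: "\<And>k. integrable M k \<Longrightarrow> (\<lambda>n. L1_dist M (koopman M (s n) k) (weighted_comp g w k)) \<longlonglongrightarrow> 0"
    and th: "\<And>k. integrable M k \<Longrightarrow> (\<lambda>n. L1_dist M (koopman M (t n) k) (weighted_comp h v k)) \<longlonglongrightarrow> 0"
  shows "AE x in M. h (g x) = x"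
proof -
  note ks = koopman_integrable[OF prob_space_axioms s] and kt = koopman_integrable[OF prob_space_axioms t]
    and wg = weighted_comp_integrable[OF g(1)] and wh = weighted_comp_integrable[OF h(1)]
  have key: "AE x in M. k x = weighted_comp g w (weighted_comp h v k) x" if k: "integrable M k" for k
  proof -
    let ?a = "weighted_comp h v k"
    have "(\<lambda>n. L1_dist M k (koopman M (s n) ?a)) \<longlonglongrightarrow> 0"
    proof -
      have "L1_dist M (koopman M (t n) k) ?a = L1_dist M k (koopman M (s n) ?a)" for n
      proof -
        have "L1_dist M (koopman M (t n) k) ?a
            = L1_dist M (koopman M (s n) (koopman M (t n) k)) (koopman M (s n) ?a)"
          by (rule koopman_isometry[symmetric, OF prob_space_axioms s kt[OF k] wh[OF k]])
        also have "\<dots> = L1_dist M k (koopman M (s n) ?a)"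
          by (rule L1_dist_cong_AE) (use st k in \<open>auto intro!: borel_measurable_integrable ks kt wh\<close>)
        finally show ?thesis .
      qed
      then show ?thesis using th[OF k] by simp
    qed
    from L1_dist_tendsto_trans[OF _ _ _ this sg[OF wh[OF k]]]
    have "(\<lambda>n::nat. L1_dist M k (weighted_comp g w ?a)) \<longlonglongrightarrow> 0"
      using k ks[OF wh[OF k]] wg[OF wh[OF k]] by simp
    then have "L1_dist M k (weighted_comp g w ?a) = 0" by (simp add: LIMSEQ_const_iff)
    then show ?thesis using L1_dist_eq_0_iff[OF k wg[OF wh[OF k]]] by simp
  qed
  have i1: "integrable M (\<lambda>_. 1::real)" by simp
  note ic = integrable_coord
  have "AE x in M. coord ((h \<circ> g) x) = coord x"
    using key[OF i1] key[OF ic]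
    by eventually_elim (simp add: weighted_comp_def mult.assoc)
  then have "AE x in M. (h \<circ> g) x = x"
    by (rule AE_eqI_coord[OF nonsingular_compose[OF h(2) g(2)] nonsingular_id])
  then show ?thesis by simp
qed

text \<open>The limit of the inverse operators at \<open>1\<close> is a function that the limit operator sends to \<open>1\<close>, as
  required for the limits to be given by maps. These maps are inverse to each other almost
  everywhere, and a bijection is obtained by changing one of them on a null set.\<close>

lemma koopman_Cauchy_imp_limit:
  assumes s: "\<And>n::nat. s n \<in> gms_maps M" and t: "\<And>n. t n \<in> gms_maps M"
    and st: "\<And>n k. AE x in M. koopman M (s n) (koopman M (t n) k) x = k x"
    and ts: "\<And>n k. AE x in M. koopman M (t n) (koopman M (s n) k) x = k x"
    and cs: "\<And>k. integrable M k \<Longrightarrow>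
      ((\<lambda>(i, j). L1_dist M (koopman M (s i) k) (koopman M (s j) k)) \<longlongrightarrow> 0) (sequentially \<times>\<^sub>F sequentially)"
    and ct: "\<And>k. integrable M k \<Longrightarrow>
      ((\<lambda>(i, j). L1_dist M (koopman M (t i) k) (koopman M (t j) k)) \<longlongrightarrow> 0) (sequentially \<times>\<^sub>F sequentially)"
  obtains f where "f \<in> gms_maps M"
    "\<And>k. integrable M k \<Longrightarrow> (\<lambda>n. L1_dist M (koopman M (s n) k) (koopman M f k)) \<longlonglongrightarrow> 0"
proof -
  note M = prob_space_axioms
  have i1: "integrable M (\<lambda>_. 1::real)" by simp
  have onto: "\<exists>k1. integrable M k1 \<and> (\<lambda>n. L1_dist M (koopman M (s n) k1) (\<lambda>_. 1)) \<longlonglongrightarrow> 0"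
    if s: "\<And>n::nat. s n \<in> gms_maps M" and t: "\<And>n. t n \<in> gms_maps M"
      and st: "\<And>n k. AE x in M. koopman M (s n) (koopman M (t n) k) x = k x"
      and ct: "((\<lambda>(i, j). L1_dist M (koopman M (t i) (\<lambda>_. 1)) (koopman M (t j) (\<lambda>_. 1))) \<longlongrightarrow> 0)
        (sequentially \<times>\<^sub>F sequentially)" for s t
  proof -
    note ki = koopman_integrable[OF M t i1]
    obtain v where v: "integrable M v" "(\<lambda>n. L1_dist M (koopman M (t n) (\<lambda>_. 1)) v) \<longlonglongrightarrow> 0"
      using L1_complete[of M "\<lambda>n. koopman M (t n) (\<lambda>_. 1)", OF ki ct] by blast
    have "L1_dist M (koopman M (t n) (\<lambda>_. 1)) v = L1_dist M (koopman M (s n) v) (\<lambda>_. 1)" for n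
    proof -
      have "L1_dist M v (koopman M (t n) (\<lambda>_. 1))
          = L1_dist M (koopman M (s n) v) (koopman M (s n) (koopman M (t n) (\<lambda>_. 1)))"
        by (rule koopman_isometry[symmetric, OF M s v(1) ki])
      also have "\<dots> = L1_dist M (koopman M (s n) v) (\<lambda>_. 1)"
        by (rule L1_dist_cong_AE)
           (use st v ki in \<open>auto intro!: borel_measurable_integrable koopman_integrable[OF M s]\<close>)
      finally show ?thesis by (simp add: L1_dist_commute)
    qed
    then show ?thesis using v by auto
  qed
  obtain k1 where k1: "integrable M k1" "(\<lambda>n. L1_dist M (koopman M (s n) k1) (\<lambda>_. 1)) \<longlonglongrightarrow> 0"
    using onto[OF s t st ct[OF i1]] by blast
  obtain k2 where k2: "integrable M k2" "(\<lambda>n. L1_dist M (koopman M (t n) k2) (\<lambda>_. 1)) \<longlonglongrightarrow> 0"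
    using onto[OF t s ts cs[OF i1]] by blast
  obtain g w where g: "transfer_pair M g w" "nonsingular M g"
    and sg: "\<And>k. integrable M k \<Longrightarrow> (\<lambda>n. L1_dist M (koopman M (s n) k) (weighted_comp g w k)) \<longlonglongrightarrow> 0"
    using koopman_limit_weighted_comp[OF s cs k1] by blast
  obtain h v where h: "transfer_pair M h v" "nonsingular M h"
    and th: "\<And>k. integrable M k \<Longrightarrow> (\<lambda>n. L1_dist M (koopman M (t n) k) (weighted_comp h v k)) \<longlonglongrightarrow> 0"
    using koopman_limit_weighted_comp[OF t ct k2] by blast
  have "AE x in M. h (g x) = x" by (rule koopman_limit_inverse[OF s t st g h sg th])
  moreover have "AE x in M. g (h x) = x" by (rule koopman_limit_inverse[OF t s ts h g th sg])
  ultimately obtain f where f: "f \<in> gms_maps M" "AE x in M. f x = g x"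
    using AE_inverse_imp_gms_map[OF g(2) h(2)] by blast
  have "transfer_pair M f w"
  proof (rule transfer_pairI)
    show "f \<in> measurable M M" by (rule nonsingular_measurable[OF gms_nonsingular[OF f(1)]])
    show "w \<in> borel_measurable M" "0 \<le> w x" for x using g(1) by (auto simp: transfer_pair_def)
    fix A assume A: "A \<in> sets M"
    have "(\<integral>\<^sup>+x. indicator A (f x) * ennreal (w x) \<partial>M) = (\<integral>\<^sup>+x. indicator A (g x) * ennreal (w x) \<partial>M)"
      by (rule nn_integral_cong_AE) (use f(2) in \<open>eventually_elim, simp\<close>)
    also have "\<dots> = emeasure M A"
      using transfer_pair_nn_integral[OF g(1), of "indicator A"] A by simp
    finally show "(\<integral>\<^sup>+x. indicator A (f x) * ennreal (w x) \<partial>M) = emeasure M A" .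
  qed
  from gms_deriv_unique[OF M f(1) this] have "AE x in M. gms_deriv M f x = w x" .
  with f(2) have eq: "AE x in M. weighted_comp g w k x = koopman M f k x" for k
    by eventually_elim (simp add: koopman_def weighted_comp_def)
  have "(\<lambda>n. L1_dist M (koopman M (s n) k) (koopman M f k)) \<longlonglongrightarrow> 0" if k: "integrable M k" for k
  proof -
    have "L1_dist M (koopman M (s n) k) (weighted_comp g w k)
        = L1_dist M (koopman M (s n) k) (koopman M f k)" for n
      by (rule L1_dist_cong_AE)
         (use eq k in \<open>auto intro!: borel_measurable_integrable koopman_integrable[OF M] s f
            weighted_comp_integrable[OF g(1)]\<close>)
    then show ?thesis using sg[OF k] by simp
  qed
  with f(1) show ?thesis using that by blast
qed

lemma class_koopman_Cauchy_imp_limit: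
  fixes s :: "nat \<Rightarrow> ('a \<Rightarrow> 'a) set"
  assumes s: "\<And>n. s n \<in> carrier (Gms M)"
    and cs: "\<And>k. integrable M k \<Longrightarrow>
      ((\<lambda>(i, j). koopman_dist M (s i) (s j) k) \<longlongrightarrow> 0)
        (sequentially \<times>\<^sub>F sequentially)"
    and ct: "\<And>k. integrable M k \<Longrightarrow>
      ((\<lambda>(i, j). koopman_dist M (inv\<^bsub>Gms M\<^esub> s i) (inv\<^bsub>Gms M\<^esub> s j) k)
        \<longlongrightarrow> 0) (sequentially \<times>\<^sub>F sequentially)"
  obtains X where "X \<in> carrier (Gms M)"
    "\<And>k. integrable M k \<Longrightarrow> (\<lambda>n. koopman_dist M (s n) X k) \<longlonglongrightarrow> 0"
proof -
  interpret G: group "Gms M" by (rule group_Gms)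
  note t = G.inv_closed[OF s]
  have st: "AE x in M. class_koopman M (s n) (class_koopman M (inv\<^bsub>Gms M\<^esub> s n) k) x = k x" for n k
    using class_koopman_mult[OF t[of n] s[of n], of k] class_koopman_one[of k]
    unfolding G.l_inv[OF s] by eventually_elim simp
  have ts: "AE x in M. class_koopman M (inv\<^bsub>Gms M\<^esub> s n) (class_koopman M (s n) k) x = k x" for n k
    using class_koopman_mult[OF s[of n] t[of n], of k] class_koopman_one[of k]
    unfolding G.r_inv[OF s] by eventually_elim simp
  obtain f where f: "f \<in> gms_maps M"
    "\<And>k. integrable M k \<Longrightarrow> (\<lambda>n. L1_dist M (koopman M (gms_rep (s n)) k) (koopman M f k)) \<longlonglongrightarrow> 0"
    using koopman_Cauchy_imp_limit[of "\<lambda>n. gms_rep (s n)" "\<lambda>n. gms_rep (inv\<^bsub>Gms M\<^esub> s n)",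
        OF gms_rep(1)[OF s] gms_rep(1)[OF t] st[unfolded class_koopman_def] ts[unfolded class_koopman_def]
          cs[unfolded class_koopman_def] ct[unfolded class_koopman_def]] by blast
  have X: "gms_class M f \<in> carrier (Gms M)" by (rule gms_class_in_carrier[OF f(1)])
  have "L1_dist M (koopman M (gms_rep (s n)) k) (koopman M f k)
      = koopman_dist M (s n) (gms_class M f) k"
    if k: "integrable M k" for n k
  proof (rule L1_dist_cong_AE)
    show "AE x in M. koopman M f k x = class_koopman M (gms_class M f) k x"
      using AE_class_koopman[OF f(1), of k] by eventually_elim simp
  qed (use k f(1) s X in \<open>auto simp: class_koopman_def intro!: borel_measurable_integrable
      koopman_integrable[OF prob_space_axioms] gms_rep(1)\<close>)
  then show ?thesis using that[OF X] f(2) by simp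
qed

section \<open>A complete metric\<close>

definition test_fun :: "nat \<Rightarrow> 'a \<Rightarrow> real" where
  "test_fun n x = (case from_nat n :: rat \<times> nat of (q, m) \<Rightarrow> ramp q m (coord x))"

lemma test_fun_integrable: "integrable M (test_fun n)"
  by (cases "from_nat n :: rat \<times> nat")
     (auto simp: test_fun_def[abs_def] intro: integrable_bounded_coord[OF ramp_measurable ramp_abs_le])

lemma L1_closed_subspace_test_fun:
  assumes "L1_closed_subspace M Q" "\<And>n. Q (test_fun n)" "integrable M k"
  shows "Q k"
  using assms(1) _ assms(3)
proof (rule L1_closed_subspace_ramps)
  show "Q (\<lambda>x. ramp q m (coord x))" for q m
    using assms(2)[of "to_nat (q, m)"] by (simp add: test_fun_def[abs_def])
qed

lemma class_koopman_tendsto_from_test_fun: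
  assumes s: "\<forall>\<^sub>F i in F. s i \<in> carrier (Gms M)" and t: "\<forall>\<^sub>F i in F. t i \<in> carrier (Gms M)"
    and lim: "\<And>n. ((\<lambda>i. koopman_dist M (s i) (t i) (test_fun n))
      \<longlongrightarrow> 0) F"
    and k: "integrable M k"
  shows "((\<lambda>i. koopman_dist M (s i) (t i) k) \<longlongrightarrow> 0) F"
proof -
  have T: "\<forall>\<^sub>F i in F. transfer_pair M (gms_rep (s i)) (gms_deriv M (gms_rep (s i)))"
    if "\<forall>\<^sub>F i in F. s i \<in> carrier (Gms M)" for s
    using that by eventually_elim (rule gms_transfer_pair[OF prob_space_axioms gms_rep(1)])
  show ?thesis
    using L1_closed_subspace_test_fun[OF weighted_comp_limit_closed_subspace[OF T[OF s] T[OF t]] _ k] lim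
    by (simp add: class_koopman_def koopman_def)
qed

text \<open>Distances are truncated at \<open>1\<close> so that the series converges for arbitrary arguments, as the axioms
  of a metric space ask for nonnegativity and symmetry outside of the carrier as well.\<close>

definition gap :: "('a \<Rightarrow> 'a) set \<Rightarrow> ('a \<Rightarrow> 'a) set \<Rightarrow> real" where
  "gap X Y = (\<Sum>n. (1/2) ^ n *
    min 1 (koopman_dist M X Y (test_fun n)))"

lemma summable_gap: "summable (\<lambda>n. (1/2) ^ n * min 1 (L1_dist M (f n) (g n)))"
  by (rule summable_comparison_test'[OF summable_geometric[of "1/2::real"], of 0])
     (auto simp: abs_mult intro: mult_left_le)

lemma gap_nonneg: "0 \<le> gap X Y"
  unfolding gap_def by (rule suminf_nonneg[OF summable_gap]) simp

lemma gap_commute: "gap X Y = gap Y X"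
  by (simp add: gap_def L1_dist_commute)

lemma gap_triangle:
  assumes "X \<in> carrier (Gms M)" "Y \<in> carrier (Gms M)" "Z \<in> carrier (Gms M)"
  shows "gap X Z \<le> gap X Y + gap Y Z"
proof -
  let ?d = "\<lambda>X Y n. koopman_dist M X Y (test_fun n)"
  have "gap X Z \<le> (\<Sum>n. (1/2) ^ n * min 1 (?d X Y n) + (1/2) ^ n * min 1 (?d Y Z n))"
    unfolding gap_def
  proof (rule suminf_le[OF _ summable_gap summable_add[OF summable_gap summable_gap]])
    fix n
    have "?d X Z n \<le> ?d X Y n + ?d Y Z n"
      by (rule L1_dist_triangle) (use assms in \<open>auto intro: class_koopman_integrable test_fun_integrable\<close>)
    then have "min 1 (?d X Z n) \<le> min 1 (?d X Y n) + min 1 (?d Y Z n)"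
      using L1_dist_nonneg by (smt (verit))
    then show "(1/2) ^ n * min 1 (?d X Z n) \<le> (1/2) ^ n * min 1 (?d X Y n) + (1/2) ^ n * min 1 (?d Y Z n)"
      by (simp add: distrib_left[symmetric])
  qed
  also have "\<dots> = gap X Y + gap Y Z"
    unfolding gap_def by (rule suminf_add[symmetric, OF summable_gap summable_gap])
  finally show ?thesis .
qed

lemma gap_tendsto_iff:
  assumes s: "\<forall>\<^sub>F i in F. s i \<in> carrier (Gms M)" and t: "\<forall>\<^sub>F i in F. t i \<in> carrier (Gms M)"
  shows "((\<lambda>i. gap (s i) (t i)) \<longlongrightarrow> 0) F \<longleftrightarrow> (\<forall>k. integrable M k \<longrightarrow>
    ((\<lambda>i. koopman_dist M (s i) (t i) k) \<longlongrightarrow> 0) F)"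
proof
  let ?d = "\<lambda>n i. koopman_dist M (s i) (t i) (test_fun n)"
  show "((\<lambda>i. gap (s i) (t i)) \<longlongrightarrow> 0) F"
    if lim: "\<forall>k. integrable M k \<longrightarrow>
      ((\<lambda>i. koopman_dist M (s i) (t i) k) \<longlongrightarrow> 0) F"
  proof (cases "F = bot")
    case False
    have "((\<lambda>i. \<Sum>n. (1/2) ^ n * min 1 (?d n i)) \<longlongrightarrow> (\<Sum>n. 0::real)) F"
    proof (rule tannerys_theorem[THEN conjunct2, THEN conjunct2])
      show "((\<lambda>i. (1/2) ^ n * min 1 (?d n i)) \<longlongrightarrow> 0) F" for n
      proof -
        have "((\<lambda>i. (1/2) ^ n * min 1 (?d n i)) \<longlongrightarrow> (1/2) ^ n * min 1 0) F"
          using lim test_fun_integrable by (intro tendsto_intros) blast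
        then show ?thesis by simp
      qed
      show "\<forall>\<^sub>F (n, i) in at_top \<times>\<^sub>F F. norm ((1/2) ^ n * min 1 (?d n i)) \<le> (1/2) ^ n"
        by (rule always_eventually) (auto simp: abs_mult intro: mult_left_le)
      show "summable (\<lambda>n. (1/2::real) ^ n)" by (rule summable_geometric) simp
    qed fact
    then show ?thesis by (simp add: gap_def)
  qed simp
  show "\<forall>k. integrable M k \<longrightarrow>
      ((\<lambda>i. koopman_dist M (s i) (t i) k) \<longlongrightarrow> 0) F"
    if lim: "((\<lambda>i. gap (s i) (t i)) \<longlongrightarrow> 0) F"
  proof (intro allI impI, rule class_koopman_tendsto_from_test_fun[OF s t])
    fix n
    have m: "((\<lambda>i. min 1 (?d n i)) \<longlongrightarrow> 0) F"
    proof (rule tendsto_sandwich[OF _ _ tendsto_const])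
      have "(1/2) ^ n * min 1 (?d n i) \<le> gap (s i) (t i)" for i
        unfolding gap_def
        using sum_le_suminf[OF summable_gap[of "\<lambda>n. class_koopman M (s i) (test_fun n)"
              "\<lambda>n. class_koopman M (t i) (test_fun n)"], of "{n}"] by simp
      then have "min 1 (?d n i) \<le> 2 ^ n * gap (s i) (t i)" for i
        by (simp add: field_simps)
      then show "\<forall>\<^sub>F i in F. min 1 (?d n i) \<le> 2 ^ n * gap (s i) (t i)" by simp
      show "((\<lambda>i. 2 ^ n * gap (s i) (t i)) \<longlongrightarrow> 0) F" using tendsto_mult_right_zero[OF lim] .
    qed simp
    show "(?d n \<longlongrightarrow> 0) F"
    proof (rule Lim_transform_eventually[OF m])
      have "\<forall>\<^sub>F i in F. min 1 (?d n i) < 1" using order_tendstoD(2)[OF m, of 1] by simp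
      then show "\<forall>\<^sub>F i in F. min 1 (?d n i) = ?d n i" by eventually_elim simp
    qed
  qed
qed

lemma gap_eq_0_imp_eq:
  assumes X: "X \<in> carrier (Gms M)" and Y: "Y \<in> carrier (Gms M)" and "gap X Y = 0"
  shows "X = Y"
proof -
  let ?g = "gms_rep X" and ?h = "gms_rep Y"
  have "AE x in M. class_koopman M X k x = class_koopman M Y k x" if k: "integrable M k" for k
  proof -
    have "(\<lambda>n::nat. koopman_dist M X Y k) \<longlonglongrightarrow> 0"
      using gap_tendsto_iff[of "\<lambda>_. X" sequentially "\<lambda>_. Y"] X Y assms(3) k by simp
    then have "koopman_dist M X Y k = 0"
      by (simp add: LIMSEQ_const_iff)
    then show ?thesis using L1_dist_eq_0_iff class_koopman_integrable X Y k by blast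
  qed
  then have "AE x in M. class_koopman M X coord x = class_koopman M Y coord x"
    "AE x in M. class_koopman M X (\<lambda>_. 1) x = class_koopman M Y (\<lambda>_. 1) x"
    using integrable_coord by auto
  then have "AE x in M. coord (?g x) = coord (?h x)"
    using gms_deriv_pos[OF prob_space_axioms gms_rep(1)[OF X]]
    by eventually_elim (simp add: class_koopman_def koopman_def weighted_comp_def)
  then have "AE x in M. ?g x = ?h x"
    by (intro AE_eqI_coord gms_nonsingular gms_rep(1) X Y)
  then have "gms_class M ?g = gms_class M ?h"
    unfolding gms_class_eq_iff[OF gms_rep(1)[OF X] gms_rep(1)[OF Y]] .
  then show "X = Y" unfolding gms_rep(2)[OF X] gms_rep(2)[OF Y] .
qed

text \<open>The second summand is needed for completeness: a strong limit of invertible isometries may fail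
  to be invertible unless the inverses converge, too.\<close>

definition gms_dist :: "('a \<Rightarrow> 'a) set \<Rightarrow> ('a \<Rightarrow> 'a) set \<Rightarrow> real" where
  "gms_dist X Y = gap X Y + gap (inv\<^bsub>Gms M\<^esub> X) (inv\<^bsub>Gms M\<^esub> Y)"

lemma Metric_space_gms_dist: "Metric_space (carrier (Gms M)) gms_dist"
proof
  interpret G: group "Gms M" by (rule group_Gms)
  show "0 \<le> gms_dist X Y" "gms_dist X Y = gms_dist Y X" for X Y
    by (simp_all add: gms_dist_def gap_nonneg gap_commute)
  fix X Y assume XY: "X \<in> carrier (Gms M)" "Y \<in> carrier (Gms M)"
  show "gms_dist X Y = 0 \<longleftrightarrow> X = Y"
  proof
    assume "gms_dist X Y = 0"
    then have "gap X Y = 0"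
      using gap_nonneg[of X Y] gap_nonneg[of "inv\<^bsub>Gms M\<^esub> X" "inv\<^bsub>Gms M\<^esub> Y"]
      by (simp add: gms_dist_def)
    then show "X = Y" by (rule gap_eq_0_imp_eq[OF XY])
  qed (simp add: gms_dist_def gap_def)
  fix Z assume Z: "Z \<in> carrier (Gms M)"
  show "gms_dist X Z \<le> gms_dist X Y + gms_dist Y Z"
    using gap_triangle[OF XY Z] gap_triangle[OF XY[THEN G.inv_closed] G.inv_closed[OF Z]]
    by (simp add: gms_dist_def)
qed

interpretation GM: Metric_space "carrier (Gms M)" gms_dist
  by (rule Metric_space_gms_dist)

lemma class_koopman_tendsto_inv:
  assumes s: "\<forall>\<^sub>F i in F. s i \<in> carrier (Gms M)" and X: "X \<in> carrier (Gms M)"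
    and lim: "\<And>k. integrable M k \<Longrightarrow>
      ((\<lambda>i. koopman_dist M (s i) X k) \<longlongrightarrow> 0) F"
    and k: "integrable M k"
  shows "((\<lambda>i. koopman_dist M (inv\<^bsub>Gms M\<^esub> s i) (inv\<^bsub>Gms M\<^esub> X) k) \<longlongrightarrow> 0) F"
proof -
  interpret G: group "Gms M" by (rule group_Gms)
  let ?k = "class_koopman M (inv\<^bsub>Gms M\<^esub> X) k"
  have "integrable M ?k" by (rule class_koopman_integrable[OF G.inv_closed[OF X] k])
  from lim[OF this] show ?thesis
  proof (rule Lim_transform_eventually)
    show "\<forall>\<^sub>F i in F. koopman_dist M (s i) X ?k
        = koopman_dist M (inv\<^bsub>Gms M\<^esub> s i) (inv\<^bsub>Gms M\<^esub> X) k"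
      using s
    proof eventually_elim
      fix i assume i: "s i \<in> carrier (Gms M)"
      show "koopman_dist M (s i) X ?k
        = koopman_dist M (inv\<^bsub>Gms M\<^esub> s i) (inv\<^bsub>Gms M\<^esub> X) k"
        unfolding L1_dist_class_koopman_inv[OF X i k] by (rule L1_dist_commute)
    qed
  qed
qed

text \<open>The inverses converge as soon as the operators do, so the second summand of the metric does not
  affect the topology.\<close>

lemma limitin_mtopology_iff:
  "limitin GM.mtopology s X F \<longleftrightarrow> X \<in> carrier (Gms M) \<and> (\<forall>\<^sub>F i in F. s i \<in> carrier (Gms M)) \<and>
    (\<forall>k. integrable M k \<longrightarrow>
      ((\<lambda>i. koopman_dist M (s i) X k) \<longlongrightarrow> 0) F)"
proof -
  interpret G: group "Gms M" by (rule group_Gms)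
  have "((\<lambda>i. gms_dist (s i) X) \<longlongrightarrow> 0) F \<longleftrightarrow> (\<forall>k. integrable M k \<longrightarrow>
      ((\<lambda>i. koopman_dist M (s i) X k) \<longlongrightarrow> 0) F)"
    if X: "X \<in> carrier (Gms M)" and s: "\<forall>\<^sub>F i in F. s i \<in> carrier (Gms M)"
  proof -
    have X': "\<forall>\<^sub>F i in F. X \<in> carrier (Gms M)" using X by simp
    note iff = gap_tendsto_iff[OF s X']
    have inv: "\<forall>\<^sub>F i in F. inv\<^bsub>Gms M\<^esub> s i \<in> carrier (Gms M)"
      using s by eventually_elim (rule G.inv_closed)
    have inv': "\<forall>\<^sub>F i in F. inv\<^bsub>Gms M\<^esub> X \<in> carrier (Gms M)" using X by simp
    note iff' = gap_tendsto_iff[OF inv inv']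
    show ?thesis
    proof
      assume "((\<lambda>i. gms_dist (s i) X) \<longlongrightarrow> 0) F"
      then have "((\<lambda>i. gap (s i) X) \<longlongrightarrow> 0) F"
        by (rule tendsto_sandwich[OF _ _ tendsto_const, rotated 2])
           (simp_all add: gms_dist_def gap_nonneg)
      then show "\<forall>k. integrable M k \<longrightarrow>
          ((\<lambda>i. koopman_dist M (s i) X k) \<longlongrightarrow> 0) F"
        using iff by blast
    next
      assume lim: "\<forall>k. integrable M k \<longrightarrow>
          ((\<lambda>i. koopman_dist M (s i) X k) \<longlongrightarrow> 0) F"
      have "((\<lambda>i. gap (inv\<^bsub>Gms M\<^esub> s i) (inv\<^bsub>Gms M\<^esub> X)) \<longlongrightarrow> 0) F"
        using iff' class_koopman_tendsto_inv[OF s X] lim by blast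
      moreover have "((\<lambda>i. gap (s i) X) \<longlongrightarrow> 0) F" using iff lim by blast
      ultimately show "((\<lambda>i. gms_dist (s i) X) \<longlongrightarrow> 0) F"
        unfolding gms_dist_def using tendsto_add[of _ 0 F _ 0] by fastforce
    qed
  qed
  then show ?thesis unfolding GM.limitin_metric_dist_null by blast
qed

text \<open>For one inclusion, convergence along the neighbourhood filter of a point implies convergence of the
  operators. For the other one sequences suffice, because the topology of the metric is first
  countable.\<close>

lemma mtopology_eq_Gms_topology: "GM.mtopology = Gms_topology M"
  unfolding topology_eq
proof (intro allI iffI)
  fix U assume U: "openin GM.mtopology U"
  have "\<exists>V. openin (Gms_topology M) V \<and> X \<in> V \<and> V \<subseteq> U" if X: "X \<in> U" for X
  proof -
    have XC: "X \<in> carrier (Gms M)" using openin_subset[OF U] X by auto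
    have "\<forall>\<^sub>F Y in nhdsin (Gms_topology M) X. Y \<in> V"
      if "openin (Gms_topology M) V" "X \<in> V" for V
      unfolding eventually_nhdsin using that by blast
    then have lim: "limitin (Gms_topology M) (\<lambda>Y. Y) X (nhdsin (Gms_topology M) X)"
      using XC by (simp add: limitin_def)
    have "limitin GM.mtopology (\<lambda>Y. Y) X (nhdsin (Gms_topology M) X)"
      unfolding limitin_mtopology_iff
      using limitin_Gms_in_carrier[OF lim] limitin_Gms_imp_koopman[OF lim] by blast
    from limitinD[OF this U X] show ?thesis
      unfolding eventually_nhdsin using XC by auto
  qed
  then show "openin (Gms_topology M) U"
    by (subst openin_subopen) blast
next
  fix U assume U: "openin (Gms_topology M) U"
  show "openin GM.mtopology U"
    unfolding GM.openin_mtopology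
  proof (intro conjI allI impI)
    show sub: "U \<subseteq> carrier (Gms M)" using openin_subset[OF U] by simp
    fix X assume X: "X \<in> U"
    show "\<exists>r>0. GM.mball X r \<subseteq> U"
    proof (rule ccontr)
      assume contra: "\<not> (\<exists>r>0. GM.mball X r \<subseteq> U)"
      have "\<exists>Y. Y \<in> GM.mball X (1 / real (Suc n)) \<and> Y \<notin> U" for n
        using contra[unfolded not_ex, rule_format, of "1 / real (Suc n)"] by auto
      then obtain s where s: "\<And>n. s n \<in> GM.mball X (1 / real (Suc n))" "\<And>n. s n \<notin> U" by metis
      have sc: "s n \<in> carrier (Gms M)" and d: "gms_dist (s n) X \<le> 1 / real (Suc n)" for n
        using s(1)[of n] GM.commute[of X "s n"] by auto
      have "(\<lambda>n. gms_dist (s n) X) \<longlonglongrightarrow> 0"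
        by (rule tendsto_sandwich[OF _ _ tendsto_const LIMSEQ_Suc[OF lim_1_over_n]])
           (use d in \<open>auto simp del: of_nat_Suc\<close>)
      moreover have XC: "X \<in> carrier (Gms M)" using X sub by blast
      ultimately have "limitin GM.mtopology s X sequentially"
        unfolding GM.limitin_metric_dist_null using sc by simp
      then have L: "\<And>k. integrable M k \<Longrightarrow>
          (\<lambda>n. koopman_dist M (s n) X k) \<longlonglongrightarrow> 0"
        unfolding limitin_mtopology_iff by simp
      have "limitin (Gms_topology M) s X sequentially"
        by (rule koopman_convergence_imp_limitin_Gms[OF sc XC L])
      from limitinD[OF this U X] show False using s(2) by simp
    qed
  qed
qed

section \<open>The Polish group\<close>

lemma limitin_Gms_topology_iff:
  "limitin (Gms_topology M) s X F \<longleftrightarrow> X \<in> carrier (Gms M) \<and> (\<forall>\<^sub>F i in F. s i \<in> carrier (Gms M)) \<and>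
    (\<forall>k. integrable M k \<longrightarrow>
      ((\<lambda>i. koopman_dist M (s i) X k) \<longlongrightarrow> 0) F)"
  using limitin_mtopology_iff unfolding mtopology_eq_Gms_topology .

lemma completely_metrizable_Gms_topology: "completely_metrizable_space (Gms_topology M)"
proof -
  interpret G: group "Gms M" by (rule group_Gms)
  have "GM.mcomplete"
    unfolding GM.mcomplete_def
  proof (intro allI impI)
    fix s assume "GM.MCauchy s"
    then have s: "\<And>n. s n \<in> carrier (Gms M)"
      and C: "\<And>e. e > 0 \<Longrightarrow> \<exists>N. \<forall>n n'. N \<le> n \<longrightarrow> N \<le> n' \<longrightarrow> gms_dist (s n) (s n') < e"
      unfolding GM.MCauchy_def by blast+
    have ev: "\<forall>\<^sub>F p in sequentially \<times>\<^sub>F sequentially. f p \<in> carrier (Gms M)"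
      if "\<And>p. f p \<in> carrier (Gms M)" for f :: "nat \<times> nat \<Rightarrow> _" using that by simp
    have D: "((\<lambda>p. gms_dist (s (fst p)) (s (snd p))) \<longlongrightarrow> 0) (sequentially \<times>\<^sub>F sequentially)"
    proof (rule tendstoI)
      fix e :: real assume "e > 0"
      then obtain N where "\<And>n n'. N \<le> n \<Longrightarrow> N \<le> n' \<Longrightarrow> gms_dist (s n) (s n') < e" using C by blast
      then show "\<forall>\<^sub>F p in sequentially \<times>\<^sub>F sequentially. dist (gms_dist (s (fst p)) (s (snd p))) 0 < e"
        unfolding eventually_prod_filter
        by (intro exI[of _ "\<lambda>n. N \<le> n"] conjI eventually_ge_at_top) auto
    qed
    have D1: "((\<lambda>p. gap (s (fst p)) (s (snd p))) \<longlongrightarrow> 0) (sequentially \<times>\<^sub>F sequentially)"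
      by (rule tendsto_sandwich[OF _ _ tendsto_const D]) (simp_all add: gms_dist_def gap_nonneg)
    have D2: "((\<lambda>p. gap (inv\<^bsub>Gms M\<^esub> s (fst p)) (inv\<^bsub>Gms M\<^esub> s (snd p))) \<longlongrightarrow> 0)
        (sequentially \<times>\<^sub>F sequentially)"
      by (rule tendsto_sandwich[OF _ _ tendsto_const D]) (simp_all add: gms_dist_def gap_nonneg)
    obtain X where X: "X \<in> carrier (Gms M)"
      "\<And>k. integrable M k \<Longrightarrow> (\<lambda>n. koopman_dist M (s n) X k) \<longlonglongrightarrow> 0"
    proof (rule class_koopman_Cauchy_imp_limit[OF s])
      fix k :: "'a \<Rightarrow> real" assume k: "integrable M k"
      show "((\<lambda>(i, j). koopman_dist M (s i) (s j) k) \<longlongrightarrow> 0)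
          (sequentially \<times>\<^sub>F sequentially)"
        using gap_tendsto_iff[OF ev ev, of "\<lambda>p. s (fst p)" "\<lambda>p. s (snd p)"] s D1 k
        by (simp add: case_prod_unfold)
      show "((\<lambda>(i, j). koopman_dist M (inv\<^bsub>Gms M\<^esub> s i) (inv\<^bsub>Gms M\<^esub> s j) k)
          \<longlongrightarrow> 0) (sequentially \<times>\<^sub>F sequentially)"
        using gap_tendsto_iff[OF ev ev, of "\<lambda>p. inv\<^bsub>Gms M\<^esub> s (fst p)" "\<lambda>p. inv\<^bsub>Gms M\<^esub> s (snd p)"] s D2 k
        by (simp add: case_prod_unfold)
    qed (rule that)
    then have "limitin GM.mtopology s X sequentially"
      unfolding limitin_mtopology_iff using s by simp
    then show "\<exists>X. limitin GM.mtopology s X sequentially" by blast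
  qed
  then show ?thesis
    using GM.completely_metrizable_space_mtopology unfolding mtopology_eq_Gms_topology by blast
qed

lemma topological_group_Gms: "topological_group (Gms M) (Gms_topology M)"
  unfolding topological_group_def
proof (intro conjI group_Gms topspace_Gms_topology)
  interpret G: group "Gms M" by (rule group_Gms)
  let ?T = "Gms_topology M"
  show "continuous_map ?T ?T (\<lambda>X. inv\<^bsub>Gms M\<^esub> X)"
    unfolding continuous_map_atin
  proof
    fix X assume "X \<in> topspace ?T"
    then have X: "X \<in> carrier (Gms M)" by simp
    have "limitin ?T (\<lambda>Y. Y) X (atin ?T X)"
      using limitin_continuous_map[OF continuous_map_id, of X ?T X] X by (simp add: id_def)
    then have s: "\<forall>\<^sub>F Y in atin ?T X. Y \<in> carrier (Gms M)"
      and lim: "\<And>k. integrable M k \<Longrightarrow>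
        ((\<lambda>Y. koopman_dist M Y X k) \<longlongrightarrow> 0) (atin ?T X)"
      unfolding limitin_Gms_topology_iff by auto
    have "\<forall>\<^sub>F Y in atin ?T X. inv\<^bsub>Gms M\<^esub> Y \<in> carrier (Gms M)"
      using s by eventually_elim (rule G.inv_closed)
    then show "limitin ?T (\<lambda>X. inv\<^bsub>Gms M\<^esub> X) (inv\<^bsub>Gms M\<^esub> X) (atin ?T X)"
      unfolding limitin_Gms_topology_iff
      using class_koopman_tendsto_inv[OF s X lim] G.inv_closed[OF X] by blast
  qed
  show "continuous_map (prod_topology ?T ?T) ?T (\<lambda>(X, Y). X \<otimes>\<^bsub>Gms M\<^esub> Y)"
    unfolding continuous_map_atin
  proof
    fix p assume p: "p \<in> topspace (prod_topology ?T ?T)"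
    let ?F = "atin (prod_topology ?T ?T) p"
    obtain X Y where XY: "p = (X, Y)" "X \<in> carrier (Gms M)" "Y \<in> carrier (Gms M)" using p by auto
    have l1: "limitin ?T fst X ?F" and l2: "limitin ?T snd Y ?F"
      using limitin_continuous_map[OF continuous_map_fst p] limitin_continuous_map[OF continuous_map_snd p] XY
      by auto
    have s: "\<forall>\<^sub>F q in ?F. fst q \<in> carrier (Gms M)" "\<forall>\<^sub>F q in ?F. snd q \<in> carrier (Gms M)"
      using l1 l2 unfolding limitin_Gms_topology_iff by auto
    have "((\<lambda>q. koopman_dist M (fst q \<otimes>\<^bsub>Gms M\<^esub> snd q) (X \<otimes>\<^bsub>Gms M\<^esub> Y) k)
        \<longlongrightarrow> 0) ?F" if k: "integrable M k" for k
    proof (rule tendsto_sandwich[OF _ _ tendsto_const])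
      let ?u = "class_koopman M X k"
      let ?b = "\<lambda>q. koopman_dist M (fst q) X k
        + koopman_dist M (snd q) Y ?u"
      show "\<forall>\<^sub>F q in ?F. koopman_dist M (fst q \<otimes>\<^bsub>Gms M\<^esub> snd q) (X \<otimes>\<^bsub>Gms M\<^esub> Y) k \<le> ?b q"
        using s by eventually_elim (rule koopman_dist_mult_le[OF XY(2) _ XY(3) _ k])
      have "(?b \<longlongrightarrow> 0 + 0) ?F"
        using l1 l2 k class_koopman_integrable[OF XY(2) k] unfolding limitin_Gms_topology_iff
        by (intro tendsto_add) auto
      then show "(?b \<longlongrightarrow> 0) ?F" by simp
    qed simp
    moreover have "\<forall>\<^sub>F q in ?F. fst q \<otimes>\<^bsub>Gms M\<^esub> snd q \<in> carrier (Gms M)"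
      using s by eventually_elim (rule G.m_closed)
    ultimately show "limitin ?T (\<lambda>(X, Y). X \<otimes>\<^bsub>Gms M\<^esub> Y) (case p of (X, Y) \<Rightarrow> X \<otimes>\<^bsub>Gms M\<^esub> Y) ?F"
      unfolding limitin_Gms_topology_iff using XY by (simp add: case_prod_unfold)
  qed
qed

text \<open>The operator of \<open>inv Y\<close> is isometric and can be cancelled. This turns the conditions of Raikov
  completeness into Cauchy conditions on operators.\<close>

lemma L1_dist_quotient_one:
  assumes X: "X \<in> carrier (Gms M)" and Y: "Y \<in> carrier (Gms M)" and k: "integrable M k"
  shows "koopman_dist M (X \<otimes>\<^bsub>Gms M\<^esub> inv\<^bsub>Gms M\<^esub> Y) \<one>\<^bsub>Gms M\<^esub> k
    = koopman_dist M X Y k"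
proof -
  interpret G: group "Gms M" by (rule group_Gms)
  let ?Y = "inv\<^bsub>Gms M\<^esub> Y"
  note Y' = G.inv_closed[OF Y]
  note ki = class_koopman_integrable[OF X k] class_koopman_integrable[OF Y k]
  have "koopman_dist M (X \<otimes>\<^bsub>Gms M\<^esub> ?Y) (Y \<otimes>\<^bsub>Gms M\<^esub> ?Y) k
      = L1_dist M (class_koopman M ?Y (class_koopman M X k)) (class_koopman M ?Y (class_koopman M Y k))"
    by (rule L1_dist_cong_AE)
       (use class_koopman_mult[OF X Y'] class_koopman_mult[OF Y Y'] X Y k ki in
         \<open>auto intro!: borel_measurable_integrable class_koopman_integrable simp del: G.r_inv\<close>)
  also have "\<dots> = koopman_dist M X Y k"
    by (rule class_koopman_isometry[OF Y' ki])
  finally show ?thesis using Y by simp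
qed

lemma raikov_complete_Gms: "raikov_complete (Gms M) (Gms_topology M)"
  unfolding raikov_complete_def
proof (intro allI impI)
  interpret G: group "Gms M" by (rule group_Gms)
  fix s :: "nat \<Rightarrow> ('a \<Rightarrow> 'a) set"
  let ?F = "sequentially \<times>\<^sub>F sequentially :: (nat \<times> nat) filter"
  assume "range s \<subseteq> carrier (Gms M)"
    and l1: "limitin (Gms_topology M) (\<lambda>(i, j). s i \<otimes>\<^bsub>Gms M\<^esub> inv\<^bsub>Gms M\<^esub> (s j)) \<one>\<^bsub>Gms M\<^esub> ?F"
    and l2: "limitin (Gms_topology M) (\<lambda>(i, j). inv\<^bsub>Gms M\<^esub> (s i) \<otimes>\<^bsub>Gms M\<^esub> s j) \<one>\<^bsub>Gms M\<^esub> ?F"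
  then have s: "\<And>n. s n \<in> carrier (Gms M)" by auto
  obtain X where "X \<in> carrier (Gms M)"
    "\<And>k. integrable M k \<Longrightarrow> (\<lambda>n. koopman_dist M (s n) X k) \<longlonglongrightarrow> 0"
  proof (rule class_koopman_Cauchy_imp_limit[OF s])
    fix k :: "'a \<Rightarrow> real" assume k: "integrable M k"
    show "((\<lambda>(i, j). koopman_dist M (s i) (s j) k) \<longlongrightarrow> 0) ?F"
      using l1 k unfolding limitin_Gms_topology_iff
      by (simp add: case_prod_unfold L1_dist_quotient_one[OF s s])
    show "((\<lambda>(i, j). koopman_dist M (inv\<^bsub>Gms M\<^esub> s i) (inv\<^bsub>Gms M\<^esub> s j) k)
        \<longlongrightarrow> 0) ?F"
      using l2 k L1_dist_quotient_one[OF G.inv_closed[OF s] G.inv_closed[OF s]] s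
      unfolding limitin_Gms_topology_iff
      by (simp add: case_prod_unfold)
  qed (rule that)
  then show "\<exists>X. limitin (Gms_topology M) s X sequentially"
    unfolding limitin_Gms_topology_iff using s by auto
qed

definition rational_comb :: "(rat \<times> nat) list \<Rightarrow> 'a \<Rightarrow> real" where
  "rational_comb l x = (\<Sum>(c, n)\<leftarrow>l. of_rat c * test_fun n x)"

lemma rational_comb_integrable: "integrable M (rational_comb l)"
proof (induction l)
  case (Cons p l)
  have "rational_comb (p # l) = (\<lambda>x. of_rat (fst p) * test_fun (snd p) x + rational_comb l x)"
    by (auto simp: rational_comb_def case_prod_unfold)
  then show ?case using Cons test_fun_integrable by simp
qed (simp add: rational_comb_def[abs_def])

text \<open>The functions that can be approximated form a closed subspace that contains the test functions. Only
  scaling requires an argument: a real factor is replaced by a rational one first.\<close>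

lemma rational_comb_dense:
  assumes k: "integrable M k" and e: "0 < e"
  obtains l where "L1_dist M k (rational_comb l) < e"
proof -
  note ri = rational_comb_integrable
  define Q where "Q f \<longleftrightarrow> (\<forall>e>0. \<exists>l. L1_dist M f (rational_comb l) < e)" for f
  have scale: "\<exists>l. L1_dist M (\<lambda>x. a * f x) (rational_comb l) < e"
    if f: "integrable M f" "Q f" and e: "e > 0" for f a e
  proof -
    define C where "C = L1_dist M f (\<lambda>_. 0)"
    have C: "0 \<le> C" by (simp add: C_def)
    obtain b where b: "a < of_rat b" "of_rat b < a + e / (2 * (C + 1))"
      using of_rat_dense[of a "a + e / (2 * (C + 1))"] e C by auto
    define B where "B = \<bar>of_rat b\<bar> + (1::real)"
    have B: "0 < B" unfolding B_def by (rule add_nonneg_pos) auto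
    then have "0 < e / (2 * B)" using e by simp
    then obtain l where l: "L1_dist M f (rational_comb l) < e / (2 * B)"
      using f(2) unfolding Q_def by blast
    let ?l = "map (\<lambda>(c, n). (b * c, n)) l"
    have eq: "rational_comb ?l = (\<lambda>x. of_rat b * rational_comb l x)"
      by (induction l) (auto simp: rational_comb_def[abs_def] of_rat_mult distrib_left mult.assoc fun_eq_iff)
    have "L1_dist M (\<lambda>x. a * f x) (rational_comb ?l)
        \<le> L1_dist M (\<lambda>x. a * f x) (\<lambda>x. of_rat b * f x) + L1_dist M (\<lambda>x. of_rat b * f x) (rational_comb ?l)"
      by (rule L1_dist_triangle) (use f ri in auto)
    also have "L1_dist M (\<lambda>x. a * f x) (\<lambda>x. of_rat b * f x) = \<bar>a - of_rat b\<bar> * C"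
      by (simp add: L1_dist_def C_def left_diff_distrib[symmetric] abs_mult)
    also have "L1_dist M (\<lambda>x. of_rat b * f x) (rational_comb ?l) = \<bar>of_rat b\<bar> * L1_dist M f (rational_comb l)"
      by (simp add: L1_dist_def eq right_diff_distrib[symmetric] abs_mult)
    also have "\<bar>a - of_rat b\<bar> * C + \<bar>of_rat b\<bar> * L1_dist M f (rational_comb l) < e"
    proof -
      have "\<bar>a - of_rat b\<bar> * C \<le> e / (2 * (C + 1)) * (C + 1)"
        by (rule mult_mono) (use b C e in auto)
      also have "\<dots> = e / 2" using C by (simp add: field_simps)
      finally have 1: "\<bar>a - of_rat b\<bar> * C \<le> e / 2" .
      have "\<bar>of_rat b\<bar> * L1_dist M f (rational_comb l) \<le> B * L1_dist M f (rational_comb l)"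
        by (rule mult_right_mono) (auto simp: B_def)
      also have "\<dots> < B * (e / (2 * B))"
        by (rule mult_strict_left_mono[OF l B])
      also have "\<dots> = e / 2" using B by simp
      finally show ?thesis using 1 by simp
    qed
    finally show ?thesis by blast
  qed
  have "Q k"
    using _ _ k
  proof (rule L1_closed_subspace_test_fun)
    show "Q (test_fun n)" for n
    proof -
      have "rational_comb [(1, n)] = test_fun n" by (auto simp: rational_comb_def)
      then show ?thesis unfolding Q_def by (metis L1_dist_refl)
    qed
    show "L1_closed_subspace M Q"
      unfolding L1_closed_subspace_def
    proof (intro conjI allI impI)
      fix f g :: "'a \<Rightarrow> real" and a b :: real
      assume fg: "integrable M f" "integrable M g" "Q f" "Q g"
      show "Q (\<lambda>x. a * f x + b * g x)"
        unfolding Q_def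
      proof (intro allI impI)
        fix e :: real assume e: "e > 0"
        obtain l where l: "L1_dist M (\<lambda>x. a * f x) (rational_comb l) < e / 2"
          using scale[OF fg(1,3), of "e/2" a] e by auto
        obtain m where m: "L1_dist M (\<lambda>x. b * g x) (rational_comb m) < e / 2"
          using scale[OF fg(2,4), of "e/2" b] e by auto
        have eq: "rational_comb (l @ m) = (\<lambda>x. 1 * rational_comb l x + 1 * rational_comb m x)"
          by (auto simp: rational_comb_def)
        have "L1_dist M (\<lambda>x. 1 * (a * f x) + 1 * (b * g x)) (rational_comb (l @ m))
            \<le> \<bar>1\<bar> * L1_dist M (\<lambda>x. a * f x) (rational_comb l) + \<bar>1\<bar> * L1_dist M (\<lambda>x. b * g x) (rational_comb m)"
          unfolding eq by (rule L1_dist_lincomb) (use fg ri in auto)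
        also have "\<dots> < e" using l m by simp
        finally show "\<exists>l. L1_dist M (\<lambda>x. a * f x + b * g x) (rational_comb l) < e" by auto
      qed
    next
      fix G :: "nat \<Rightarrow> 'a \<Rightarrow> real" and f
      assume G: "\<forall>n. integrable M (G n) \<and> Q (G n)" and f: "integrable M f"
        and lim: "(\<lambda>n. L1_dist M (G n) f) \<longlonglongrightarrow> 0"
      show "Q f"
        unfolding Q_def
      proof (intro allI impI)
        fix e :: real assume e: "e > 0"
        then have "\<forall>\<^sub>F n in sequentially. L1_dist M (G n) f < e / 2"
          using order_tendstoD(2)[OF lim, of "e/2"] by simp
        then obtain n where n: "L1_dist M (G n) f < e / 2" by (auto simp: eventually_sequentially)
        have "Q (G n)" using G by blast
        then obtain l where l: "L1_dist M (G n) (rational_comb l) < e / 2"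
          unfolding Q_def using e half_gt_zero by blast
        have "L1_dist M f (rational_comb l) \<le> L1_dist M f (G n) + L1_dist M (G n) (rational_comb l)"
          by (rule L1_dist_triangle) (use G f ri in auto)
        also have "\<dots> < e" using n l L1_dist_commute[of M f "G n"] by simp
        finally show "\<exists>l. L1_dist M f (rational_comb l) < e" by blast
      qed
    qed
  qed
  then show ?thesis using e that unfolding Q_def by blast
qed

text \<open>For each finite list of rational combinations one element is picked whose operator sends the
  initial test functions close to the members of the list, if there is one. Picking for better
  and better approximations of the images under \<open>X\<close> gives a sequence that converges to \<open>X\<close>.\<close>

lemma separable_Gms_topology: "separable_space (Gms_topology M)"
proof -
  define near where "near ls X \<longleftrightarrow> X \<in> carrier (Gms M) \<and> (\<forall>i<length ls.
    L1_dist M (class_koopman M X (test_fun i)) (rational_comb (ls ! i)) < 1 / real (length ls))"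
    for ls :: "(rat \<times> nat) list list" and X
  define pick where "pick ls = (SOME X. near ls X)" for ls
  define C where "C = pick ` {ls. \<exists>X. near ls X}"
  have pick: "near ls (pick ls)" if "near ls X" for ls X
    unfolding pick_def using that by (rule someI[where P = "near ls"])
  have "countable C" unfolding C_def by simp
  moreover have CC: "C \<subseteq> carrier (Gms M)" using pick by (auto simp: C_def near_def)
  moreover have "X \<in> Gms_topology M closure_of C" if X: "X \<in> carrier (Gms M)" for X
  proof -
    have tf: "integrable M (class_koopman M Y (test_fun i))" if "Y \<in> carrier (Gms M)" for Y i
      by (rule class_koopman_integrable[OF that test_fun_integrable])
    define l where "l N i = (SOME l. L1_dist M (class_koopman M X (test_fun i)) (rational_comb l)
      < 1 / real (Suc N))" for N i
    have l: "L1_dist M (class_koopman M X (test_fun i)) (rational_comb (l N i)) < 1 / real (Suc N)" for N i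
    proof -
      have "0 < 1 / real (Suc N)" by simp
      then have "\<exists>l. L1_dist M (class_koopman M X (test_fun i)) (rational_comb l) < 1 / real (Suc N)"
        using rational_comb_dense[OF tf[OF X]] by blast
      then show ?thesis unfolding l_def by (rule someI_ex)
    qed
    define ls where "ls N = map (l N) [0..<Suc N]" for N
    define Y where "Y N = pick (ls N)" for N
    have len: "length (ls N) = Suc N" for N by (simp add: ls_def)
    have nth: "ls N ! i = l N i" if "i < Suc N" for N i using that by (simp add: ls_def del: upt_Suc)
    have nX: "near (ls N) X" for N
      using X l unfolding near_def len by (auto simp: nth)
    have nY: "near (ls N) (Y N)" for N unfolding Y_def by (rule pick[OF nX])
    have Yc: "Y N \<in> carrier (Gms M)" for N using nY by (simp add: near_def)
    have YC: "Y N \<in> C" for N using nX by (auto simp: C_def Y_def)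
    have tlim: "(\<lambda>N. koopman_dist M (Y N) X (test_fun i)) \<longlonglongrightarrow> 0"
      for i
    proof (rule tendsto_sandwich[OF _ _ tendsto_const])
      have "(\<lambda>N. 2 * (1 / real (Suc N))) \<longlonglongrightarrow> 2 * 0"
        by (intro tendsto_mult tendsto_const LIMSEQ_Suc[OF lim_1_over_n])
      then show "(\<lambda>N. 2 * (1 / real (Suc N))) \<longlonglongrightarrow> 0" by simp
      show "\<forall>\<^sub>F N in sequentially. koopman_dist M (Y N) X (test_fun i)
          \<le> 2 * (1 / real (Suc N))"
        using eventually_ge_at_top[of i]
      proof eventually_elim
        fix N assume "i \<le> N"
        then have i: "i < Suc N" by simp
        have "koopman_dist M (Y N) X (test_fun i)
            \<le> L1_dist M (class_koopman M (Y N) (test_fun i)) (rational_comb (l N i))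
              + L1_dist M (rational_comb (l N i)) (class_koopman M X (test_fun i))"
          by (rule L1_dist_triangle[OF tf[OF Yc] rational_comb_integrable tf[OF X]])
        also have "\<dots> \<le> 1 / real (Suc N) + 1 / real (Suc N)"
          using nY[of N] i l[of i N] unfolding near_def len
          by (intro add_mono) (auto simp: nth L1_dist_commute intro: less_imp_le simp del: of_nat_Suc)
        finally show "koopman_dist M (Y N) X (test_fun i)
          \<le> 2 * (1 / real (Suc N))" by simp
      qed
    qed simp
    have "(\<lambda>N. koopman_dist M (Y N) X k) \<longlonglongrightarrow> 0"
      if k: "integrable M k" for k
      by (rule class_koopman_tendsto_from_test_fun[OF _ _ tlim k]) (simp_all add: Yc X)
    then have lim: "limitin (Gms_topology M) Y X sequentially"
      unfolding limitin_Gms_topology_iff using Yc X by auto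
    show ?thesis
      unfolding in_closure_of
    proof (intro conjI allI impI)
      show "X \<in> topspace (Gms_topology M)" using X by simp
      fix U assume "X \<in> U \<and> openin (Gms_topology M) U"
      then have "\<forall>\<^sub>F N in sequentially. Y N \<in> U" using limitinD[OF lim] by blast
      then obtain N where "Y N \<in> U" by (auto simp: eventually_sequentially)
      then show "\<exists>Z. Z \<in> C \<and> Z \<in> U" using YC by blast
    qed
  qed
  ultimately show ?thesis
    unfolding separable_space_def using closure_of_subset_topspace[of "Gms_topology M" C]
    by (intro exI[of _ C]) auto
qed

end

section \<open>Lebesgue spaces have a coordinate\<close>

text \<open>The isomorphism onto the interval, extended by a constant, is the coordinate. A map
  \<open>u\<close> into the interval that pulls null sets back to null sets is lifted by the inverse
  isomorphism. The inverse is only Lebesgue measurable, so each Lebesgue set is replaced by a Borel set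
  up to a null set, which \<open>u\<close> almost never meets.\<close>

lemma continuous_lebesgue_space_coordinate:
  assumes "continuous_lebesgue_space M"
  obtains coord where "coordinatized_space M coord"
proof -
  define L where "L = lebesgue_on {0..1::real}"
  have M: "prob_space M" "complete_measure M" and "isomorphic_mod0 M L"
    using assms by (auto simp: continuous_lebesgue_space_def L_def)
  interpret prob_space M by fact
  interpret complete_measure M by fact
  obtain A0 B0 f where A0: "A0 \<in> null_sets M" and B0: "B0 \<in> null_sets L"
    and iso: "let M' = restrict_space M (space M - A0); N' = restrict_space L (space L - B0) in
        bij_betw f (space M') (space N') \<and> f \<in> measurable M' N' \<and>
        inv_into (space M') f \<in> measurable N' M' \<and> distr M' N' f = N'"
    using \<open>isomorphic_mod0 M L\<close> unfolding isomorphic_mod0_def by blast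
  define S where "S = space M - A0"
  define R where "R = {0..1} - B0"
  define M' where "M' = restrict_space M S"
  define N' where "N' = restrict_space L R"
  define j where "j = inv_into S f"
  have spL: "space L = {0..1}" by (simp add: L_def space_restrict_space)
  have spM': "space M' = S" by (auto simp: M'_def S_def space_restrict_space)
  have spN': "space N' = R" by (auto simp: N'_def R_def spL space_restrict_space)
  have bij: "bij_betw f S R" and fm: "f \<in> measurable M' N'" and jm: "j \<in> measurable N' M'"
    and distr: "distr M' N' f = N'"
    using iso spM' spN' unfolding Let_def j_def S_def[symmetric] spL R_def[symmetric]
      M'_def[symmetric] N'_def[symmetric] by auto
  have Sm[measurable]: "S \<in> sets M" unfolding S_def using A0 by auto
  have SAE: "AE x in M. x \<in> S" using AE_not_in[OF A0] AE_space by eventually_elim (simp add: S_def)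
  have RL: "R \<in> sets L" unfolding R_def using B0 spL by (metis null_setsD2 sets.compl_sets)
  have setsL: "E \<in> sets L \<Longrightarrow> E \<in> sets lebesgue" for E
    unfolding L_def by (auto simp: sets_restrict_space)
  have L_emeasure: "emeasure L E = emeasure lebesgue E" if "E \<in> sets L" for E
    unfolding L_def
    by (rule emeasure_restrict_space) (use that sets.sets_into_space[OF that] in \<open>auto simp: spL\<close>)
  have setsN': "E \<in> sets N' \<longleftrightarrow> E \<subseteq> R \<and> E \<in> sets L" for E
  proof -
    have "R \<inter> space L \<in> sets L" using RL by (rule sets.Int) simp
    then show ?thesis unfolding N'_def by (rule sets_restrict_space_iff)
  qed
  have N'_emeasure: "emeasure N' E = emeasure lebesgue E" if E: "E \<in> sets N'" for E
  proof -
    have "emeasure N' E = emeasure L E"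
      unfolding N'_def by (rule emeasure_restrict_space) (use RL E setsN' in auto)
    then show ?thesis using L_emeasure E setsN' by auto
  qed
  have f_measure: "{x\<in>S. f x \<in> E} \<in> sets M" "emeasure M {x\<in>S. f x \<in> E} = emeasure lebesgue E"
    if E: "E \<in> sets N'" for E
  proof -
    have eq: "f -` E \<inter> space M' = {x\<in>S. f x \<in> E}" by (auto simp: spM')
    have "f -` E \<inter> space M' \<in> sets M'" by (rule measurable_sets[OF fm E])
    then have "{x\<in>S. f x \<in> E} \<in> sets M'" by (simp only: eq)
    then show m: "{x\<in>S. f x \<in> E} \<in> sets M"
      unfolding M'_def using Sm by (simp add: sets_restrict_space_iff)
    have "emeasure lebesgue E = emeasure (distr M' N' f) E" using N'_emeasure[OF E] distr by simp
    also have "\<dots> = emeasure M' {x\<in>S. f x \<in> E}" using emeasure_distr[OF fm E] eq by simp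
    also have "\<dots> = emeasure M {x\<in>S. f x \<in> E}"
      unfolding M'_def by (rule emeasure_restrict_space) auto
    finally show "emeasure M {x\<in>S. f x \<in> E} = emeasure lebesgue E" ..
  qed
  have fj: "f (j y) = y" and jS: "j y \<in> S" if "y \<in> R" for y
    using that bij by (auto simp: j_def bij_betw_inv_into_right bij_betw_def inv_into_into)
  have jf: "j (f x) = x" and fR: "f x \<in> R" if "x \<in> S" for x
    using that bij by (auto simp: j_def bij_betw_inv_into_left bij_betw_def)

  define coord where "coord x = (if x \<in> S then f x else 0)" for x
  have coord_m[measurable]: "coord \<in> borel_measurable M"
  proof (rule borel_measurableI)
    fix U :: "real set" assume U: "open U"
    have "U \<inter> R \<in> sets N'"
    proof -
      have "U \<inter> {0..1} \<in> sets L" using U unfolding L_def by (auto simp: sets_restrict_space)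
      moreover have "U \<inter> R = (U \<inter> {0..1}) \<inter> R" by (auto simp: R_def)
      ultimately show ?thesis unfolding setsN' using RL by auto
    qed
    from f_measure(1)[OF this] have "{x\<in>S. f x \<in> U \<inter> R} \<in> sets M" .
    moreover have "coord -` U \<inter> space M
        = {x\<in>S. f x \<in> U \<inter> R} \<union> (if 0 \<in> U then space M - S else {})"
      using sets.sets_into_space[OF Sm] fR by (auto simp: coord_def split: if_splits)
    ultimately show "coord -` U \<inter> space M \<in> sets M" by auto
  qed
  have coord01: "0 \<le> coord x \<and> coord x \<le> 1" for x
    using fR by (force simp: coord_def R_def)
  have coord_null: "AE x in M. coord x \<notin> N" if N: "N \<in> null_sets lborel" for N
  proof -
    have NL: "N \<in> null_sets lebesgue" using N by (rule null_sets_completionI)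
    have E: "N \<inter> R \<in> sets N'"
    proof -
      have "{0..1} \<inter> N \<in> sets L"
        unfolding L_def sets_restrict_space by (rule imageI) (rule null_setsD2[OF NL])
      then have "{0..1} \<inter> N \<inter> R \<in> sets L" using RL by (rule sets.Int)
      moreover have "N \<inter> R = {0..1} \<inter> N \<inter> R" by (auto simp: R_def)
      ultimately show ?thesis unfolding setsN' by simp
    qed
    then have "N \<inter> R \<in> sets lebesgue" unfolding setsN' using setsL by blast
    from null_sets_subset[OF NL this] have "emeasure lebesgue (N \<inter> R) = 0"
      by (rule null_setsD1) simp
    then have "{x\<in>S. f x \<in> N \<inter> R} \<in> null_sets M"
      using f_measure[OF E] by (auto simp only: null_sets_def)
    from AE_not_in[OF this] SAE show ?thesis
      by eventually_elim (use fR in \<open>auto simp: coord_def\<close>)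
  qed
  have D: "{y\<in>R. j y \<in> A} \<in> sets N'" if A: "A \<in> sets M" for A
  proof -
    have "A \<inter> S \<in> sets M'" unfolding M'_def using A by (auto simp: sets_restrict_space)
    from measurable_sets[OF jm this] have "j -` (A \<inter> S) \<inter> R \<in> sets N'" by (simp add: spN')
    moreover have "j -` (A \<inter> S) \<inter> R = {y\<in>R. j y \<in> A}" using jS by auto
    ultimately show ?thesis by simp
  qed
  have split: "\<exists>E\<in>sets borel. \<exists>N\<in>null_sets lborel. E \<subseteq> {y\<in>R. j y \<in> A} \<and> {y\<in>R. j y \<in> A} \<subseteq> E \<union> N"
    if A: "A \<in> sets M" for A
  proof -
    have "{y\<in>R. j y \<in> A} \<in> sets (completion lborel)" using D[OF A] setsN' setsL by blast
    then obtain E N0 N where "{y\<in>R. j y \<in> A} = E \<union> N0" "N0 \<subseteq> N" "N \<in> null_sets lborel" "E \<in> sets lborel"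
      by (rule sets_completionE)
    then show ?thesis by (intro bexI[of _ E] bexI[of _ N]) auto
  qed
  have null: "\<exists>N\<in>null_sets lborel. {y\<in>R. j y \<in> A} \<subseteq> N" if A: "A \<in> null_sets M" for A
  proof -
    have Am: "A \<in> sets M" using A by auto
    have "{x\<in>S. f x \<in> {y\<in>R. j y \<in> A}} \<subseteq> A" using jf by auto
    then have "emeasure M {x\<in>S. f x \<in> {y\<in>R. j y \<in> A}} = 0"
      using complete2[OF _ A] by (simp add: null_sets_def)
    then have "emeasure lebesgue {y\<in>R. j y \<in> A} = 0" using f_measure(2)[OF D[OF Am]] by simp
    moreover have "{y\<in>R. j y \<in> A} \<in> sets lebesgue" using D[OF Am] setsN' setsL by blast
    ultimately have "{y\<in>R. j y \<in> A} \<in> null_sets lebesgue" by (rule null_setsI)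
    then show ?thesis unfolding null_sets_completion_iff2 by blast
  qed

  have "coordinatized_space M coord"
  proof (unfold_locales)
    show "coord \<in> borel_measurable M" by (rule coord_m)
    show "0 \<le> coord x \<and> coord x \<le> 1" for x by (rule coord01)
    have "inj_on f S" using bij by (rule bij_betw_imp_inj_on)
    then have "inj_on coord S" by (simp add: inj_on_def coord_def)
    then show "\<exists>N\<in>null_sets M. inj_on coord (space M - N)"
      unfolding S_def by (rule bexI[OF _ A0])
  next
    fix A assume A: "A \<in> sets M"
    obtain E N where E: "E \<in> sets borel" "N \<in> null_sets lborel"
      "E \<subseteq> {y\<in>R. j y \<in> A}" "{y\<in>R. j y \<in> A} \<subseteq> E \<union> N" using split[OF A] by (elim bexE conjE) (rule that)
    have "AE x in M. x \<in> A \<longleftrightarrow> coord x \<in> E"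
      using coord_null[OF E(2)] SAE
    proof eventually_elim
      fix x assume x: "coord x \<notin> N" "x \<in> S"
      have "x \<in> A \<longleftrightarrow> f x \<in> {y\<in>R. j y \<in> A}" using jf[OF x(2)] fR[OF x(2)] by simp
      then show "x \<in> A \<longleftrightarrow> coord x \<in> E" using E(3,4) x by (auto simp: coord_def)
    qed
    then show "\<exists>B\<in>sets borel. AE x in M. x \<in> A \<longleftrightarrow> coord x \<in> B" using E(1) by blast
  next
    fix u :: "'a \<Rightarrow> real" assume u[measurable]: "u \<in> borel_measurable M"
      and abs: "\<And>B. B \<in> sets borel \<Longrightarrow> AE x in M. coord x \<notin> B \<Longrightarrow> AE x in M. u x \<notin> B"
    have u_null: "AE x in M. u x \<notin> N" if "N \<in> null_sets lborel" for N
      by (rule abs[OF _ coord_null[OF that]]) (use that in auto)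
    have "emeasure lebesgue B0 = 0"
      using null_setsD1[OF B0] L_emeasure[OF null_setsD2[OF B0]] by simp
    then have "B0 \<in> null_sets lebesgue" using setsL[OF null_setsD2[OF B0]] by (rule null_setsI)
    then obtain G where G: "G \<in> null_sets lborel" "B0 \<subseteq> G"
      unfolding null_sets_completion_iff2 by blast
    then have [measurable]: "G \<in> sets borel" by auto
    define W where "W = {0..1} - G"
    have [measurable]: "W \<in> sets borel" unfolding W_def by measurable
    have "AE x in M. u x \<notin> - {0..1}" by (rule abs) (use coord01 in auto)
    with u_null[OF G(1)] have uG: "AE x in M. u x \<in> W" by eventually_elim (auto simp: W_def)
    have GR: "W \<subseteq> R" using G(2) by (auto simp: R_def W_def)
    define g where "g x = (if u x \<in> W then j (u x) else x)" for x
    have SM: "S \<subseteq> space M" by (auto simp: S_def)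
    have gm: "g \<in> measurable M M"
    proof (rule measurableI)
      show "g x \<in> space M" if "x \<in> space M" for x
      proof (cases "u x \<in> W")
        case True
        then have "j (u x) \<in> S" using GR jS by blast
        then show ?thesis using True SM by (simp add: g_def subsetD)
      qed (use that in \<open>simp add: g_def\<close>)
      fix A assume A[measurable]: "A \<in> sets M"
      obtain E N where E[measurable]: "E \<in> sets borel" and N: "N \<in> null_sets lborel"
        and EN: "E \<subseteq> {y\<in>R. j y \<in> A}" "{y\<in>R. j y \<in> A} \<subseteq> E \<union> N" using split[OF A] by (elim bexE conjE) (rule that)
      have [measurable]: "N \<in> sets borel" using N by auto
      have nN: "{x\<in>space M. u x \<in> N} \<in> null_sets M"
        using u_null[OF N] by (simp add: AE_iff_null_sets)
      let ?P = "{x\<in>space M. u x \<in> W \<and> u x \<in> E}"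
      let ?Q = "{x\<in>space M. u x \<notin> W \<and> x \<in> A}"
      let ?N = "g -` A \<inter> space M - (?P \<union> ?Q)"
      have "?N \<subseteq> {x\<in>space M. u x \<in> N}"
      proof
        fix x assume x: "x \<in> ?N"
        then have "u x \<in> W" "u x \<notin> E" "j (u x) \<in> A" by (auto simp: g_def split: if_splits)
        then have "u x \<in> {y\<in>R. j y \<in> A}" using GR by blast
        then show "x \<in> {x\<in>space M. u x \<in> N}" using EN(2) \<open>u x \<notin> E\<close> x by blast
      qed
      then have "?N \<in> null_sets M" using nN by (rule complete2)
      then have "?N \<in> sets M" by auto
      moreover have "?P \<in> sets M" "?Q \<in> sets M" by measurable
      ultimately have "?P \<union> ?Q \<union> ?N \<in> sets M" by (intro sets.Un)
      moreover have "?P \<union> ?Q \<union> ?N = g -` A \<inter> space M"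
        using EN(1) by (auto simp: g_def)
      ultimately show "g -` A \<inter> space M \<in> sets M" by simp
    qed
    have "nonsingular M g"
      unfolding nonsingular_def
    proof (intro conjI ballI gm)
      fix A assume A: "A \<in> null_sets M"
      obtain N where N: "N \<in> null_sets lborel" "{y\<in>R. j y \<in> A} \<subseteq> N" using null[OF A] by (elim bexE) (rule that)
      have "AE x in M. g x \<notin> A"
        using u_null[OF N(1)] uG
        by eventually_elim (use N(2) GR in \<open>auto simp: g_def\<close>)
      then have "{x\<in>space M. \<not> g x \<notin> A} \<in> null_sets M" by (simp only: AE_iff_null_sets)
      moreover have "{x\<in>space M. \<not> g x \<notin> A} = g -` A \<inter> space M" by auto
      ultimately show "g -` A \<inter> space M \<in> null_sets M" by simp
    qed
    moreover have "AE x in M. coord (g x) = u x"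
      using uG
    proof eventually_elim
      fix x assume "u x \<in> W"
      moreover from this have "u x \<in> R" using GR by blast
      ultimately show "coord (g x) = u x" using jS[of "u x"] fj[of "u x"] by (simp add: coord_def g_def)
    qed
    ultimately show "\<exists>g. nonsingular M g \<and> (AE x in M. coord (g x) = u x)" by blast
  qed
  then show ?thesis using that by blast
qed

theorem proposition1p1:
  fixes M :: "'a measure"
  assumes "continuous_lebesgue_space M"
  shows "topological_group (Gms M) (Gms_topology M) \<and>
         separable_space (Gms_topology M) \<and>
         raikov_complete (Gms M) (Gms_topology M) \<and>
         completely_metrizable_space (Gms_topology M)"
proof -
  obtain coord where "coordinatized_space M coord"
    using continuous_lebesgue_space_coordinate[OF assms] .
  then interpret coordinatized_space M coord .
  show ?thesis
    using topological_group_Gms separable_Gms_topology raikov_complete_Gms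
      completely_metrizable_Gms_topology by blast
qed

end
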